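(* The $\mathbb{Q}$-linear map $\mathcal{H}_{\mathrm{Pk}} \to \Pi$ defined by $[\pi]_{\mathrm{Pk}} \mapsto K_{|\pi|, \mathrm{Pk}(\pi)}$ is an isomorphism of Hopf algebras.
   Context: A permutation is a finite (possibly empty) sequence $\pi = \pi_1 \cdots \pi_n$ of distinct positive integers, called its letters; $|\pi| = n$ is its length. $\mathrm{Pk}(\pi) = \{2 \le i \le n-1 : \pi_{i-1} < \pi_i > \pi_{i+1}\}$ is the peak set. Write $\pi \sim_{\mathrm{Pk}} \sigma$ if $|\pi| = |\sigma|$ and $\mathrm{Pk}(\pi) = \mathrm{Pk}(\sigma)$; $[\pi]_{\mathrm{Pk}}$ is the equivalence class of $\pi$. For permutations with no letters in common, the shuffle set $\pi ⧢ \sigma$ is the set of all $\binom{|\pi|+|\sigma|}{|\pi|}$ permutations of length $|\pi|+|\sigma|$ containing both $\pi$ and $\sigma$ as subsequences. It is known that $\mathrm{Pk}$ is shuffle-compatible (for disjoint $\pi,\sigma$ the multiset $\{\mathrm{Pk}(\tau):\tau\in\pi⧢\sigma\}$ depends only on the peak sets and lengths of $\pi$ and $\sigma$) and substring-compatible (the peak set and length of $\pi$ determine the peak set of every substring $\pi_i\cdots\pi_j$). $\mathcal{H}_{\mathrm{Pk}}$ is the graded connected Hopf algebra over $\mathbb{Q}$ with basis the classes $[\pi]_{\mathrm{Pk}}$, graded by length, product $[\pi]_{\mathrm{Pk}} \cdot [\sigma]_{\mathrm{Pk}} = \sum_{\tau \in \pi ⧢ \sigma} [\tau]_{\mathrm{Pk}}$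 for disjoint representatives $\pi,\sigma$, unit the class of the empty permutation, coproduct $\Delta([\pi]_{\mathrm{Pk}}) = \sum_{i=0}^{n} [\pi_1 \cdots \pi_i]_{\mathrm{Pk}} \otimes [\pi_{i+1} \cdots \pi_n]_{\mathrm{Pk}}$, and counit sending the class of the empty permutation to $1$ and all other classes to $0$ (the antipode exists uniquely because the bialgebra is graded and connected). $\mathrm{QSym}$ is the Hopf algebra of quasisymmetric functions over $\mathbb{Q}$ with its usual structure. For $n\ge 1$ and $D \subseteq \{1,\dots,n-1\}$ let $F_{n,D} = \sum x_{i_1}\cdots x_{i_n}$ over all $i_1\le\cdots\le i_n$ with $i_j<i_{j+1}$ whenever $j\in D$ (the fundamental basis). For $n\ge1$ and $\Lambda \subseteq \{2,\dots,n-1\}$ containing no two consecutive integers, Stembridge's peak function is $$K_{n,\Lambda} = 2^{|\Lambda|+1} \sum_{D \subseteq \{1,\dots,n-1\},\ \Lambda \subseteq D \mathbin{\triangle} (D+1)} F_{n,D},$$ where $D+1 = \{d+1 : d\in D\}$ and $\triangle$ is symmetric difference; also $K_{0,\varnothing}=1$. $\Pi$ is the $\mathbb{Q}$-span of all the $K_{n,\Lambda}$ in $\mathrm{QSym}$. It is known (Stembridge; Bergeron et al.) that the $K_{n,\Lambda}$ are linearly independent and that $\Pi$ is a Hopf subalgebra of $\mathrm{QSym}$; $\Pi$ carries this Hopf algebra structure. *)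

theory Defs
  imports Complex_Main "HOL-Library.Poly_Mapping"
begin

section \<open>Vector spaces over the rationals and their tensor products\<close>

class rat_vector = ab_group_add +
  fixes scaleQ :: "rat \<Rightarrow> 'a \<Rightarrow> 'a"  (infixr \<open>*\<^sub>Q\<close> 75)
  assumes scaleQ_add_right: "c *\<^sub>Q (x + y) = c *\<^sub>Q x + c *\<^sub>Q y"
    and scaleQ_add_left: "(c + d) *\<^sub>Q x = c *\<^sub>Q x + d *\<^sub>Q x"
    and scaleQ_scaleQ: "c *\<^sub>Q d *\<^sub>Q x = (c * d) *\<^sub>Q x"
    and scaleQ_one: "1 *\<^sub>Q x = x"

global_interpretation ratv: vector_space "scaleQ :: rat \<Rightarrow> 'a \<Rightarrow> 'a::rat_vector"
  by unfold_locales (simp_all add: scaleQ_add_right scaleQ_add_left scaleQ_scaleQ scaleQ_one)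

abbreviation rat_linear :: "('a::rat_vector \<Rightarrow> 'b::rat_vector) \<Rightarrow> bool" where
  "rat_linear f \<equiv> Vector_Spaces.linear scaleQ scaleQ f"

definition rat_bilinear :: "('a::rat_vector \<Rightarrow> 'b::rat_vector \<Rightarrow> 'c::rat_vector) \<Rightarrow> bool" where
  "rat_bilinear B \<longleftrightarrow> (\<forall>a. rat_linear (B a)) \<and> (\<forall>b. rat_linear (\<lambda>a. B a b))"

lemma rat_linear_iff:
  "rat_linear f \<longleftrightarrow> (\<forall>x y. f (x + y) = f x + f y) \<and> (\<forall>c x. f (c *\<^sub>Q x) = c *\<^sub>Q f x)"
  unfolding Vector_Spaces.linear_def module_hom_def module_hom_axioms_def
  by (auto simp: ratv.vector_space_axioms ratv.module_axioms)

instantiation rat :: rat_vector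
begin
definition "scaleQ (c::rat) (x::rat) = c * x"
instance by standard (simp_all add: scaleQ_rat_def algebra_simps)
end

instantiation poly_mapping :: (type, rat_vector) rat_vector
begin
definition "scaleQ c p = Poly_Mapping.map (scaleQ c) (p :: 'a \<Rightarrow>\<^sub>0 'b)"

lemma lookup_scaleQ:
  "Poly_Mapping.lookup (c *\<^sub>Q p) k = c *\<^sub>Q Poly_Mapping.lookup (p :: 'a \<Rightarrow>\<^sub>0 'b) k"
  by (simp add: scaleQ_poly_mapping_def Poly_Mapping.map.rep_eq when_def)

instance
  by standard
    (auto intro!: poly_mapping_eqI simp: lookup_scaleQ lookup_add scaleQ_add_right
      scaleQ_add_left scaleQ_scaleQ scaleQ_one)
end

definition lin_ext :: "('b \<Rightarrow> 'a::rat_vector) \<Rightarrow> ('b \<Rightarrow>\<^sub>0 rat) \<Rightarrow> 'a" where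
  "lin_ext f p = (\<Sum>b\<in>Poly_Mapping.keys p. Poly_Mapping.lookup p b *\<^sub>Q f b)"

lemma lin_ext_superset:
  assumes "finite A" "Poly_Mapping.keys p \<subseteq> A"
  shows "lin_ext f p = (\<Sum>b\<in>A. Poly_Mapping.lookup p b *\<^sub>Q f b)"
  unfolding lin_ext_def
  by (rule sum.mono_neutral_left) (use assms in \<open>auto simp: in_keys_iff\<close>)

lemma rat_linear_lin_ext:
  fixes f :: "'b \<Rightarrow> 'a::rat_vector"
  shows "rat_linear (lin_ext f)"
  unfolding rat_linear_iff
proof (intro conjI allI)
  fix p q :: "'b \<Rightarrow>\<^sub>0 rat"
  let ?A = "Poly_Mapping.keys p \<union> Poly_Mapping.keys q"
  have "lin_ext f (p + q) = (\<Sum>b\<in>?A. Poly_Mapping.lookup (p + q) b *\<^sub>Q f b)"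
    by (rule lin_ext_superset) (auto simp: Poly_Mapping.keys_add)
  also have "\<dots> = (\<Sum>b\<in>?A. Poly_Mapping.lookup p b *\<^sub>Q f b)
      + (\<Sum>b\<in>?A. Poly_Mapping.lookup q b *\<^sub>Q f b)"
    by (simp add: lookup_add scaleQ_add_left sum.distrib)
  also have "\<dots> = lin_ext f p + lin_ext f q"
    by (simp add: lin_ext_superset[of ?A])
  finally show "lin_ext f (p + q) = lin_ext f p + lin_ext f q" .
next
  fix c and p :: "'b \<Rightarrow>\<^sub>0 rat"
  have "lin_ext f (c *\<^sub>Q p) = (\<Sum>b\<in>Poly_Mapping.keys p. Poly_Mapping.lookup (c *\<^sub>Q p) b *\<^sub>Q f b)"
    by (rule lin_ext_superset) (auto simp: in_keys_iff lookup_scaleQ)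
  then show "lin_ext f (c *\<^sub>Q p) = c *\<^sub>Q lin_ext f p"
    by (simp add: lin_ext_def lookup_scaleQ ratv.scale_sum_right scaleQ_rat_def)
qed

lemma lin_ext_single: "lin_ext f (Poly_Mapping.single b c) = c *\<^sub>Q f b"
  by (cases "c = 0") (simp_all add: lin_ext_def)

lemma lin_ext_cong_single:
  assumes "rat_linear h"
  shows "h p = lin_ext (\<lambda>b. h (Poly_Mapping.single b 1)) p"
proof -
  interpret Vector_Spaces.linear scaleQ scaleQ h by (rule assms)
  have "p = (\<Sum>b\<in>Poly_Mapping.keys p. Poly_Mapping.lookup p b *\<^sub>Q Poly_Mapping.single b (1::rat))"
    by (rule poly_mapping_eqI)
      (auto simp: lookup_sum lookup_scaleQ lookup_single scaleQ_rat_def when_def in_keys_iff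
        if_distrib sum.delta cong: if_cong)
  then have "h p = h (\<Sum>b\<in>Poly_Mapping.keys p. Poly_Mapping.lookup p b *\<^sub>Q Poly_Mapping.single b 1)"
    by simp
  also have "\<dots> = lin_ext (\<lambda>b. h (Poly_Mapping.single b 1)) p"
    by (simp add: sum scale lin_ext_def)
  finally show ?thesis .
qed

definition tensor_relators :: "(('a::rat_vector \<times> 'b::rat_vector) \<Rightarrow>\<^sub>0 rat) set" where
  "tensor_relators =
     {Poly_Mapping.single (a + a', b) 1
        - (Poly_Mapping.single (a, b) 1 + Poly_Mapping.single (a', b) 1) | a a' b. True}
   \<union> {Poly_Mapping.single (a, b + b') 1
        - (Poly_Mapping.single (a, b) 1 + Poly_Mapping.single (a, b') 1) | a b b'. True}
   \<union> {Poly_Mapping.single (c *\<^sub>Q a, b) 1 - c *\<^sub>Q Poly_Mapping.single (a, b) 1 | c a b. True}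
   \<union> {Poly_Mapping.single (a, c *\<^sub>Q b) 1 - c *\<^sub>Q Poly_Mapping.single (a, b) 1 | c a b. True}"

definition tensor_rel ::
  "(('a::rat_vector \<times> 'b::rat_vector) \<Rightarrow>\<^sub>0 rat) \<Rightarrow> (('a \<times> 'b) \<Rightarrow>\<^sub>0 rat) \<Rightarrow> bool" where
  "tensor_rel s t \<longleftrightarrow> s - t \<in> ratv.span tensor_relators"

lemma equivp_tensor_rel: "equivp tensor_rel" (is "equivp ?R")
proof (rule equivpI)
  show "reflp ?R"
    by (rule reflpI) (simp add: tensor_rel_def ratv.span_zero)
  show "symp ?R"
    by (rule sympI) (metis tensor_rel_def ratv.span_neg minus_diff_eq)
  show "transp ?R"
  proof (rule transpI)
    fix x y z
    assume "?R x y" "?R y z"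
    then have "(x - y) + (y - z) \<in> ratv.span tensor_relators"
      unfolding tensor_rel_def by (rule ratv.span_add)
    then show "?R x z" by (simp add: tensor_rel_def)
  qed
qed

quotient_type (overloaded) ('a, 'b) tensor =
  "('a::rat_vector \<times> 'b::rat_vector) \<Rightarrow>\<^sub>0 rat" / tensor_rel
  by (rule equivp_tensor_rel)

instantiation tensor :: (rat_vector, rat_vector) rat_vector
begin

lift_definition zero_tensor :: "('a, 'b) tensor" is 0 .

lift_definition plus_tensor :: "('a, 'b) tensor \<Rightarrow> ('a, 'b) tensor \<Rightarrow> ('a, 'b) tensor" is "(+)"
  unfolding tensor_rel_def
  by (metis ratv.span_add add_diff_add)

lift_definition uminus_tensor :: "('a, 'b) tensor \<Rightarrow> ('a, 'b) tensor" is uminus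
  unfolding tensor_rel_def
  by (metis ratv.span_neg minus_diff_minus)

lift_definition minus_tensor :: "('a, 'b) tensor \<Rightarrow> ('a, 'b) tensor \<Rightarrow> ('a, 'b) tensor" is "(-)"
proof -
  fix p p' q q' :: "('a \<times> 'b) \<Rightarrow>\<^sub>0 rat"
  assume "tensor_rel p p'" "tensor_rel q q'"
  then have "(p - p') - (q - q') \<in> ratv.span tensor_relators"
    unfolding tensor_rel_def by (rule ratv.span_diff)
  moreover have "(p - p') - (q - q') = (p - q) - (p' - q')" by simp
  ultimately show "tensor_rel (p - q) (p' - q')" by (simp add: tensor_rel_def)
qed

lift_definition scaleQ_tensor :: "rat \<Rightarrow> ('a, 'b) tensor \<Rightarrow> ('a, 'b) tensor" is scaleQ
  unfolding tensor_rel_def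
  by (metis ratv.span_scale ratv.scale_right_diff_distrib)

instance
proof
  fix a b c :: "('a, 'b) tensor" and r s :: rat
  have refl: "tensor_rel x x" for x :: "('a \<times> 'b) \<Rightarrow>\<^sub>0 rat"
    by (simp add: tensor_rel_def ratv.span_zero)
  show "a + b + c = a + (b + c)" by transfer (simp add: add.assoc refl)
  show "a + b = b + a" by transfer (simp add: add.commute refl)
  show "0 + a = a" by transfer (simp add: refl)
  show "- a + a = 0" by transfer (simp add: refl)
  show "a - b = a + - b" by transfer (simp add: refl)
  show "r *\<^sub>Q (a + b) = r *\<^sub>Q a + r *\<^sub>Q b" by transfer (simp add: refl scaleQ_add_right)
  show "(r + s) *\<^sub>Q a = r *\<^sub>Q a + s *\<^sub>Q a" by transfer (simp add: refl scaleQ_add_left)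
  show "r *\<^sub>Q s *\<^sub>Q a = (r * s) *\<^sub>Q a" by transfer (simp add: refl scaleQ_scaleQ)
  show "1 *\<^sub>Q a = a" by transfer (simp add: refl scaleQ_one)
qed

end

lift_definition pure_tensor :: "'a::rat_vector \<Rightarrow> 'b::rat_vector \<Rightarrow> ('a, 'b) tensor"
    (infixr \<open>\<otimes>\<close> 72)
  is "\<lambda>a b. Poly_Mapping.single (a, b) 1" .

definition tensor_lift ::
  "('a::rat_vector \<Rightarrow> 'b::rat_vector \<Rightarrow> 'c::rat_vector) \<Rightarrow> ('a, 'b) tensor \<Rightarrow> 'c" where
  "tensor_lift B = (THE h. rat_linear h \<and> (\<forall>a b. h (a \<otimes> b) = B a b))"

lemma rat_linear_abs_tensor: "rat_linear abs_tensor"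
  by (simp add: rat_linear_iff plus_tensor.abs_eq scaleQ_tensor.abs_eq)

lemma rat_linear_compose: "rat_linear f \<Longrightarrow> rat_linear g \<Longrightarrow> rat_linear (\<lambda>x. g (f x))"
  by (simp add: rat_linear_iff)

lemma tensor_linear_ext:
  fixes g h :: "('a::rat_vector, 'b::rat_vector) tensor \<Rightarrow> 'c::rat_vector"
  assumes "rat_linear g" "rat_linear h" "\<And>a b. g (a \<otimes> b) = h (a \<otimes> b)"
  shows "g = h"
proof
  fix t :: "('a, 'b) tensor"
  obtain p where t: "t = abs_tensor p"
    by (metis Quotient3_abs_rep Quotient3_tensor)
  have *: "f (abs_tensor p) = lin_ext (\<lambda>(a, b). f (a \<otimes> b)) p" if "rat_linear f"
    for f :: "('a, 'b) tensor \<Rightarrow> 'c"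
    using lin_ext_cong_single[OF rat_linear_compose[OF rat_linear_abs_tensor that], of p]
    by (simp add: pure_tensor.abs_eq case_prod_unfold)
  show "g t = h t" unfolding t using assms by (simp add: *)
qed

lemma tensor_lift_ex:
  fixes B :: "'a::rat_vector \<Rightarrow> 'b::rat_vector \<Rightarrow> 'c::rat_vector"
  assumes "rat_bilinear B"
  shows "\<exists>h. rat_linear h \<and> (\<forall>a b. h (a \<otimes> b) = B a b)"
proof -
  let ?g = "lin_ext (\<lambda>(a, b). B a b)"
  have add: "B (a + a') b = B a b + B a' b" "B a (b + b') = B a b + B a b'"
    and scale: "B (c *\<^sub>Q a) b = c *\<^sub>Q B a b" "B a (c *\<^sub>Q b) = c *\<^sub>Q B a b" for a a' b b' c
    using assms by (auto simp: rat_bilinear_def rat_linear_iff)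
  interpret g: Vector_Spaces.linear scaleQ scaleQ ?g by (rule rat_linear_lin_ext)
  have "?g r = 0" if "r \<in> tensor_relators" for r
    using that unfolding tensor_relators_def
    by (auto simp: g.diff g.add g.scale lin_ext_single add scale scaleQ_one)
  then have ker: "?g r = 0" if "r \<in> ratv.span tensor_relators" for r
    using g.eq_0_on_span that by blast
  have wd: "?g p = ?g q" if "tensor_rel p q" for p q
    using ker[of "p - q"] that by (simp add: tensor_rel_def g.diff)
  define h where "h t = ?g (rep_tensor t)" for t
  have h: "h (abs_tensor p) = ?g p" for p
    unfolding h_def by (rule wd) (metis Quotient3_rep_abs Quotient3_tensor ratv.span_zero
        tensor_rel_def diff_self)
  have "rat_linear h"
    unfolding rat_linear_iff
  proof (intro allI conjI)
    fix x y :: "('a, 'b) tensor" and c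
    obtain p q where xy: "x = abs_tensor p" "y = abs_tensor q"
      by (metis Quotient3_abs_rep Quotient3_tensor)
    show "h (x + y) = h x + h y"
      by (simp add: xy plus_tensor.abs_eq h g.add)
    show "h (c *\<^sub>Q x) = c *\<^sub>Q h x"
      by (simp add: xy scaleQ_tensor.abs_eq h g.scale)
  qed
  moreover have "h (a \<otimes> b) = B a b" for a b
    by (simp add: pure_tensor.abs_eq h lin_ext_single scaleQ_one)
  ultimately show ?thesis by blast
qed

lemma tensor_lift:
  assumes "rat_bilinear B"
  shows "rat_linear (tensor_lift B)" and "tensor_lift B (a \<otimes> b) = B a b"
proof -
  have "\<exists>!h. rat_linear h \<and> (\<forall>a b. h (a \<otimes> b) = B a b)"
    using tensor_lift_ex[OF assms] by (auto intro: tensor_linear_ext)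
  from theI'[OF this] show "rat_linear (tensor_lift B)" and "tensor_lift B (a \<otimes> b) = B a b"
    by (auto simp: tensor_lift_def)
qed

definition tensor_map ::
  "('a::rat_vector \<Rightarrow> 'c::rat_vector) \<Rightarrow> ('b::rat_vector \<Rightarrow> 'd::rat_vector)
     \<Rightarrow> ('a, 'b) tensor \<Rightarrow> ('c, 'd) tensor" where
  "tensor_map f g = tensor_lift (\<lambda>a b. f a \<otimes> g b)"

definition tensor_assoc ::
  "(('a::rat_vector, 'b::rat_vector) tensor, 'c::rat_vector) tensor
     \<Rightarrow> ('a, ('b, 'c) tensor) tensor" where
  "tensor_assoc = tensor_lift (\<lambda>t c. tensor_lift (\<lambda>a b. a \<otimes> b \<otimes> c) t)"

definition tensor_times ::
  "('a::rat_vector \<Rightarrow> 'a \<Rightarrow> 'a) \<Rightarrow> ('a, 'a) tensor \<Rightarrow> ('a, 'a) tensor \<Rightarrow> ('a, 'a) tensor" where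
  "tensor_times m s t = tensor_lift (\<lambda>a b. tensor_lift (\<lambda>c d. m a c \<otimes> m b d) t) s"


section \<open>Hopf algebras over the rationals\<close>

record (overloaded) ('a::rat_vector) bialg =
  mul :: "'a \<Rightarrow> 'a \<Rightarrow> 'a"
  unit :: 'a
  comult :: "'a \<Rightarrow> ('a, 'a) tensor"
  counit :: "'a \<Rightarrow> rat"

definition assoc_algebra :: "'a::rat_vector bialg \<Rightarrow> bool" where
  "assoc_algebra H \<longleftrightarrow> rat_bilinear (mul H)
     \<and> (\<forall>x y z. mul H (mul H x y) z = mul H x (mul H y z))
     \<and> (\<forall>x. mul H (unit H) x = x) \<and> (\<forall>x. mul H x (unit H) = x)"

definition coalgebra :: "'a::rat_vector bialg \<Rightarrow> bool" where
  "coalgebra H \<longleftrightarrow> rat_linear (comult H) \<and> rat_linear (counit H)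
     \<and> (\<forall>x. tensor_assoc (tensor_map (comult H) id (comult H x))
             = tensor_map id (comult H) (comult H x))
     \<and> (\<forall>x. tensor_lift (\<lambda>a b. counit H a *\<^sub>Q b) (comult H x) = x)
     \<and> (\<forall>x. tensor_lift (\<lambda>a b. counit H b *\<^sub>Q a) (comult H x) = x)"

definition bialgebra :: "'a::rat_vector bialg \<Rightarrow> bool" where
  "bialgebra H \<longleftrightarrow> assoc_algebra H \<and> coalgebra H
     \<and> (\<forall>x y. comult H (mul H x y) = tensor_times (mul H) (comult H x) (comult H y))
     \<and> comult H (unit H) = unit H \<otimes> unit H
     \<and> (\<forall>x y. counit H (mul H x y) = counit H x * counit H y)
     \<and> counit H (unit H) = 1"

definition is_antipode :: "'a::rat_vector bialg \<Rightarrow> ('a \<Rightarrow> 'a) \<Rightarrow> bool" where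
  "is_antipode H S \<longleftrightarrow> rat_linear S
     \<and> (\<forall>x. tensor_lift (\<lambda>a b. mul H (S a) b) (comult H x) = counit H x *\<^sub>Q unit H)
     \<and> (\<forall>x. tensor_lift (\<lambda>a b. mul H a (S b)) (comult H x) = counit H x *\<^sub>Q unit H)"

definition hopf_algebra :: "'a::rat_vector bialg \<Rightarrow> bool" where
  "hopf_algebra H \<longleftrightarrow> bialgebra H \<and> (\<exists>S. is_antipode H S)"

definition antipode :: "'a::rat_vector bialg \<Rightarrow> 'a \<Rightarrow> 'a" where
  "antipode H = (THE S. is_antipode H S)"

definition hopf_hom ::
  "'a::rat_vector bialg \<Rightarrow> 'b::rat_vector bialg \<Rightarrow> ('a \<Rightarrow> 'b) \<Rightarrow> bool" where
  "hopf_hom H H' f \<longleftrightarrow> rat_linear f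
     \<and> (\<forall>x y. f (mul H x y) = mul H' (f x) (f y))
     \<and> f (unit H) = unit H'
     \<and> (\<forall>x. comult H' (f x) = tensor_map f f (comult H x))
     \<and> (\<forall>x. counit H' (f x) = counit H x)
     \<and> (\<forall>x. f (antipode H x) = antipode H' (f x))"

definition hopf_iso ::
  "'a::rat_vector bialg \<Rightarrow> 'b::rat_vector bialg \<Rightarrow> ('a \<Rightarrow> 'b) \<Rightarrow> bool" where
  "hopf_iso H H' f \<longleftrightarrow> hopf_algebra H \<and> hopf_algebra H' \<and> hopf_hom H H' f \<and> bij f"


section \<open>Quasisymmetric functions\<close>

text \<open>A power series in the variables \<open>x\<^sub>0, x\<^sub>1, x\<^sub>2, \<dots>\<close> is the function that assigns to each
  monomial its coefficient. The exponents of a monomial are listed in the order of the variables,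
  without zeros.\<close>

definition exponents :: "(nat \<Rightarrow>\<^sub>0 nat) \<Rightarrow> nat list" where
  "exponents m = map (Poly_Mapping.lookup m) (sorted_list_of_set (Poly_Mapping.keys m))"

definition quasisymmetric :: "((nat \<Rightarrow>\<^sub>0 nat) \<Rightarrow> rat) \<Rightarrow> bool" where
  "quasisymmetric f \<longleftrightarrow> (\<forall>m m'. exponents m = exponents m' \<longrightarrow> f m = f m')
     \<and> (\<exists>d. \<forall>m. f m \<noteq> 0 \<longrightarrow> sum_list (exponents m) \<le> d)"

lemma exponents_zero [simp]: "exponents 0 = []"
  by (simp add: exponents_def)

lemma exponents_eq_Nil_iff: "exponents m = [] \<longleftrightarrow> m = 0"
  by (auto simp: exponents_def sorted_list_of_set_eq_Nil_iff)

lemma zero_notin_exponents: "0 \<notin> set (exponents m)"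
  by (auto simp: exponents_def in_keys_iff)

lemma sum_list_exponents:
  assumes "finite A" "Poly_Mapping.keys m \<subseteq> A"
  shows "sum_list (exponents m) = (\<Sum>i\<in>A. Poly_Mapping.lookup m i)"
proof -
  have "sum_list (exponents m) = (\<Sum>i\<in>Poly_Mapping.keys m. Poly_Mapping.lookup m i)"
    by (simp add: exponents_def sum_list_distinct_conv_sum_set)
  also have "\<dots> = (\<Sum>i\<in>A. Poly_Mapping.lookup m i)"
    by (rule sum.mono_neutral_left) (use assms in \<open>auto simp: in_keys_iff\<close>)
  finally show ?thesis .
qed

lemma sum_list_exponents_add:
  "sum_list (exponents (a + b)) = sum_list (exponents a) + sum_list (exponents b)"
proof -
  let ?A = "Poly_Mapping.keys a \<union> Poly_Mapping.keys b"
  show ?thesis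
    by (subst (1 2 3) sum_list_exponents[of ?A])
      (use Poly_Mapping.keys_add[of a b] in \<open>auto simp: lookup_add sum.distrib\<close>)
qed

definition push :: "nat set \<Rightarrow> (nat \<Rightarrow> nat) \<Rightarrow> (nat \<Rightarrow>\<^sub>0 nat) \<Rightarrow> (nat \<Rightarrow>\<^sub>0 nat)" where
  "push A \<phi> m = (\<Sum>i\<in>A. Poly_Mapping.single (\<phi> i) (Poly_Mapping.lookup m i))"

lemma push_add: "push A \<phi> (a + b) = push A \<phi> a + push A \<phi> b"
  by (simp add: push_def lookup_add single_add sum.distrib)

lemma lookup_push:
  assumes "finite A" "inj_on \<phi> A" "i \<in> A"
  shows "Poly_Mapping.lookup (push A \<phi> m) (\<phi> i) = Poly_Mapping.lookup m i"
proof -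
  have "Poly_Mapping.lookup (push A \<phi> m) (\<phi> i)
      = (\<Sum>k\<in>A. if k = i then Poly_Mapping.lookup m k else 0)"
    unfolding push_def lookup_sum
    by (rule sum.cong) (use assms in \<open>auto simp: lookup_single when_def inj_on_eq_iff\<close>)
  then show ?thesis using assms by simp
qed

lemma lookup_push_notin: "j \<notin> \<phi> ` A \<Longrightarrow> Poly_Mapping.lookup (push A \<phi> m) j = 0"
  by (auto simp: push_def lookup_sum lookup_single when_def intro!: sum.neutral)

lemma keys_push:
  assumes "finite A" "inj_on \<phi> A" "Poly_Mapping.keys m \<subseteq> A"
  shows "Poly_Mapping.keys (push A \<phi> m) = \<phi> ` Poly_Mapping.keys m"
proof (rule set_eqI)
  fix j
  show "j \<in> Poly_Mapping.keys (push A \<phi> m) \<longleftrightarrow> j \<in> \<phi> ` Poly_Mapping.keys m"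
  proof (cases "j \<in> \<phi> ` A")
    case True
    then obtain i where "i \<in> A" "j = \<phi> i" by auto
    then show ?thesis
      using assms lookup_push[of A \<phi> i m] by (auto simp: in_keys_iff inj_on_eq_iff subset_iff)
  next
    case False
    then show ?thesis using assms lookup_push_notin[of j \<phi> A m] by (auto simp: in_keys_iff subset_iff)
  qed
qed

lemma sorted_list_of_set_image:
  fixes \<phi> :: "nat \<Rightarrow> nat"
  assumes "finite A" "strict_mono_on A \<phi>"
  shows "sorted_list_of_set (\<phi> ` A) = map \<phi> (sorted_list_of_set A)"
proof (rule strict_sorted_equal)
  show "sorted_wrt (<) (map \<phi> (sorted_list_of_set A))"
    unfolding sorted_wrt_map
    by (rule sorted_wrt_mono_rel[OF _ strict_sorted_list_of_set])
      (use assms in \<open>auto simp: strict_mono_on_def\<close>)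
qed (use assms in auto)

lemma exponents_push:
  assumes "finite A" "strict_mono_on A \<phi>" "Poly_Mapping.keys m \<subseteq> A"
  shows "exponents (push A \<phi> m) = exponents m"
proof -
  have inj: "inj_on \<phi> A" using assms(2) by (rule strict_mono_on_imp_inj_on)
  have "strict_mono_on (Poly_Mapping.keys m) \<phi>"
    using assms by (auto simp: strict_mono_on_def)
  then show ?thesis
    using assms inj
    by (auto simp: exponents_def keys_push sorted_list_of_set_image lookup_push subset_iff)
qed

lemma exponents_eq_transport:
  assumes "exponents m = exponents m'"
  obtains \<phi> where "strict_mono_on (Poly_Mapping.keys m) \<phi>"
    and "push (Poly_Mapping.keys m) \<phi> m = m'"
proof -
  define xs where "xs = sorted_list_of_set (Poly_Mapping.keys m)"
  define ys where "ys = sorted_list_of_set (Poly_Mapping.keys m')"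
  have len: "length xs = length ys"
    using arg_cong[OF assms, of length] by (simp add: exponents_def xs_def ys_def)
  have sets: "set xs = Poly_Mapping.keys m" "set ys = Poly_Mapping.keys m'"
    by (simp_all add: xs_def ys_def)
  have sorted: "sorted_wrt (<) xs" "sorted_wrt (<) ys"
    unfolding xs_def ys_def by (rule strict_sorted_list_of_set)+
  have dist: "distinct xs" by (simp add: xs_def)
  have lk: "Poly_Mapping.lookup m (xs ! p) = Poly_Mapping.lookup m' (ys ! p)"
    if "p < length xs" for p
    using arg_cong[OF assms, of "\<lambda>l. l ! p"] that len
    by (simp add: exponents_def flip: xs_def ys_def)
  define \<phi> where "\<phi> i = the (map_of (zip xs ys) i)" for i
  have \<phi>: "\<phi> (xs ! p) = ys ! p" if "p < length xs" for p
    using that len dist by (simp add: \<phi>_def map_of_zip_nth)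
  have mono: "strict_mono_on (Poly_Mapping.keys m) \<phi>"
    unfolding sets[symmetric]
  proof (rule strict_mono_onI)
    fix i j assume "i \<in> set xs" "j \<in> set xs" "i < j"
    then obtain p q where pq: "p < length xs" "q < length xs" "i = xs ! p" "j = xs ! q"
      by (metis in_set_conv_nth)
    have "p < q"
    proof (rule ccontr)
      assume "\<not> p < q"
      then have "q < p \<or> p = q" by auto
      then have "xs ! q \<le> xs ! p" using sorted(1) pq by (auto simp: sorted_wrt_iff_nth_less intro: less_imp_le)
      then show False using pq \<open>i < j\<close> by simp
    qed
    then show "\<phi> i < \<phi> j"
      using pq sorted(2) len by (simp add: \<phi> sorted_wrt_iff_nth_less)
  qed
  then have inj: "inj_on \<phi> (Poly_Mapping.keys m)" by (rule strict_mono_on_imp_inj_on)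
  have img: "\<phi> ` Poly_Mapping.keys m = Poly_Mapping.keys m'"
  proof -
    have "map \<phi> xs = ys" by (rule nth_equalityI) (auto simp: \<phi> len)
    then show ?thesis using sets by (metis list.set_map)
  qed
  have "push (Poly_Mapping.keys m) \<phi> m = m'"
  proof (rule poly_mapping_eqI)
    fix j
    show "Poly_Mapping.lookup (push (Poly_Mapping.keys m) \<phi> m) j = Poly_Mapping.lookup m' j"
    proof (cases "j \<in> \<phi> ` Poly_Mapping.keys m")
      case True
      then obtain i where i: "i \<in> set xs" "j = \<phi> i" using sets by auto
      then obtain p where p: "p < length xs" "i = xs ! p" by (metis in_set_conv_nth)
      have "Poly_Mapping.lookup (push (Poly_Mapping.keys m) \<phi> m) j = Poly_Mapping.lookup m i"
        using i inj sets by (simp add: lookup_push)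
      then show ?thesis using i p by (simp add: \<phi> lk)
    next
      case False
      then show ?thesis using img by (simp add: lookup_push_notin in_keys_iff)
    qed
  qed
  with mono show ?thesis by (rule that)
qed

lemma push_push:
  assumes "finite A" "inj_on \<phi> A" "Poly_Mapping.keys m \<subseteq> A"
  shows "push (\<phi> ` A) (inv_into A \<phi>) (push A \<phi> m) = m"
proof -
  have "push (\<phi> ` A) (inv_into A \<phi>) (push A \<phi> m)
      = (\<Sum>i\<in>A. Poly_Mapping.single i (Poly_Mapping.lookup m i))"
    unfolding push_def[of "\<phi> ` A"] sum.reindex[OF assms(2)]
    by (rule sum.cong) (use assms in \<open>auto simp: lookup_push\<close>)
  also have "\<dots> = m"
    by (rule poly_mapping_eqI)
      (use assms in \<open>auto simp: lookup_sum lookup_single when_def in_keys_iff subset_iff\<close>)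
  finally show ?thesis .
qed

lemma strict_mono_on_inv_into:
  fixes \<phi> :: "nat \<Rightarrow> nat"
  assumes "strict_mono_on A \<phi>"
  shows "strict_mono_on (\<phi> ` A) (inv_into A \<phi>)"
proof (rule strict_mono_onI)
  have inj: "inj_on \<phi> A" using assms by (rule strict_mono_on_imp_inj_on)
  fix r s assume "r \<in> \<phi> ` A" "s \<in> \<phi> ` A" "r < s"
  then obtain i j where ij: "i \<in> A" "j \<in> A" "r = \<phi> i" "s = \<phi> j" by auto
  have "i < j"
  proof (rule ccontr)
    assume "\<not> i < j"
    then have "\<phi> j \<le> \<phi> i"
      using ij assms by (cases "i = j") (auto simp: strict_mono_on_def intro: less_imp_le)
    then show False using ij \<open>r < s\<close> by simp
  qed
  then show "inv_into A \<phi> r < inv_into A \<phi> s" using ij inj by simp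
qed

definition series_times ::
  "((nat \<Rightarrow>\<^sub>0 nat) \<Rightarrow> rat) \<Rightarrow> ((nat \<Rightarrow>\<^sub>0 nat) \<Rightarrow> rat) \<Rightarrow> (nat \<Rightarrow>\<^sub>0 nat) \<Rightarrow> rat" where
  "series_times f g m = (\<Sum>(a, b)\<in>{(a, b). a + b = m}. f a * g b)"

lemma keys_add_nat:
  "Poly_Mapping.keys (a + b :: nat \<Rightarrow>\<^sub>0 nat) = Poly_Mapping.keys a \<union> Poly_Mapping.keys b"
  by (auto simp: in_keys_iff lookup_add)

lemma finite_decompositions: "finite {(a, b). a + b = (m :: nat \<Rightarrow>\<^sub>0 nat)}"
proof -
  let ?K = "Poly_Mapping.keys m" and ?N = "sum_list (exponents m)"
  let ?S = "{f. \<forall>i. (i \<in> ?K \<longrightarrow> f i \<in> {..?N}) \<and> (i \<notin> ?K \<longrightarrow> f i = 0)}"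
  have le: "Poly_Mapping.lookup a i \<le> ?N" if "a + b = m" for a b i
  proof (cases "i \<in> ?K")
    case True
    have "Poly_Mapping.lookup m i \<le> ?N"
      unfolding sum_list_exponents[OF finite_keys subset_refl]
      by (rule member_le_sum) (use True in auto)
    moreover have "Poly_Mapping.lookup a i \<le> Poly_Mapping.lookup m i"
      using that by (auto simp: lookup_add)
    ultimately show ?thesis by simp
  next
    case False
    then show ?thesis using that by (auto simp: lookup_add in_keys_iff)
  qed
  have sub: "Poly_Mapping.lookup ` {a. \<exists>b. a + b = m} \<subseteq> ?S"
    using le by (auto simp: in_keys_iff lookup_add)
  have "finite ?S" by (rule finite_set_of_finite_funs) auto
  then have "finite (Poly_Mapping.lookup ` {a. \<exists>b. a + b = m})"
    using sub by (rule rev_finite_subset)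
  then have fin: "finite {a. \<exists>b. a + b = m}"
    by (rule finite_imageD) (auto simp: inj_on_def intro: poly_mapping_eqI)
  have "{(a, b). a + b = m} \<subseteq> {a. \<exists>b. a + b = m} \<times> {a. \<exists>b. a + b = m}"
    by auto (metis add.commute)
  then show ?thesis by (rule finite_subset) (use fin in auto)
qed

lemma quasisymmetric_times:
  assumes f: "quasisymmetric f" and g: "quasisymmetric g"
  shows "quasisymmetric (series_times f g)"
  unfolding quasisymmetric_def
proof (intro conjI allI impI)
  fix m m' assume "exponents m = exponents m'"
  then obtain \<phi> where \<phi>: "strict_mono_on (Poly_Mapping.keys m) \<phi>"
    and m': "push (Poly_Mapping.keys m) \<phi> m = m'"
    by (rule exponents_eq_transport)
  let ?A = "Poly_Mapping.keys m" and ?A' = "Poly_Mapping.keys m'"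
  let ?\<psi> = "inv_into ?A \<phi>"
  have inj: "inj_on \<phi> ?A" using \<phi> by (rule strict_mono_on_imp_inj_on)
  have A': "?A' = \<phi> ` ?A" using keys_push[OF _ inj subset_refl] m' by simp
  have \<psi>: "strict_mono_on ?A' ?\<psi>" unfolding A' using \<phi> by (rule strict_mono_on_inv_into)
  have inj': "inj_on ?\<psi> ?A'" using \<psi> by (rule strict_mono_on_imp_inj_on)
  have m: "push ?A' ?\<psi> m' = m"
    using push_push[OF _ inj subset_refl] m' A' by simp
  have pp: "push ?A' ?\<psi> (push ?A \<phi> a) = a" if "Poly_Mapping.keys a \<subseteq> ?A" for a
    using push_push[OF _ inj that] A' by simp
  have pp': "push ?A \<phi> (push ?A' ?\<psi> a) = a" if a: "Poly_Mapping.keys a \<subseteq> ?A'" for a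
  proof -
    have 1: "?\<psi> ` ?A' = ?A" unfolding A' using inj by force
    have "push ?A (inv_into ?A' ?\<psi>) (push ?A' ?\<psi> a) = a"
      using push_push[OF _ inj' a] 1 by simp
    moreover have "inv_into ?A' ?\<psi> i = \<phi> i" if "i \<in> ?A" for i
      by (rule inv_into_f_eq[OF inj']) (use that inj A' in auto)
    then have "push ?A (inv_into ?A' ?\<psi>) x = push ?A \<phi> x" for x
      unfolding push_def by (intro sum.cong) auto
    ultimately show ?thesis by simp
  qed
  have fg: "f (push ?A \<phi> a) = f a" "g (push ?A \<phi> a) = g a" if "Poly_Mapping.keys a \<subseteq> ?A" for a
    using f g exponents_push[OF finite_keys \<phi> that] unfolding quasisymmetric_def by metis+
  show "series_times f g m = series_times f g m'"
    unfolding series_times_def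
  proof (rule sum.reindex_bij_witness[where
        i = "\<lambda>(a, b). (push ?A' ?\<psi> a, push ?A' ?\<psi> b)" and
        j = "\<lambda>(a, b). (push ?A \<phi> a, push ?A \<phi> b)"])
    fix p assume p: "p \<in> {(a, b). a + b = m}"
    then obtain a b where ab: "p = (a, b)" "a + b = m" by auto
    then have k: "Poly_Mapping.keys a \<subseteq> ?A" "Poly_Mapping.keys b \<subseteq> ?A"
      by (auto simp: keys_add_nat)
    show "(case (case p of (a, b) \<Rightarrow> (push ?A \<phi> a, push ?A \<phi> b)) of
        (a, b) \<Rightarrow> (push ?A' ?\<psi> a, push ?A' ?\<psi> b)) = p"
      using k ab by (simp add: pp)
    show "(case p of (a, b) \<Rightarrow> (push ?A \<phi> a, push ?A \<phi> b)) \<in> {(a, b). a + b = m'}"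
      using ab m' by (simp flip: push_add)
    show "(case (case p of (a, b) \<Rightarrow> (push ?A \<phi> a, push ?A \<phi> b)) of (a, b) \<Rightarrow> f a * g b)
        = (case p of (a, b) \<Rightarrow> f a * g b)"
      using k ab by (simp add: fg)
  next
    fix p assume p: "p \<in> {(a, b). a + b = m'}"
    then obtain a b where ab: "p = (a, b)" "a + b = m'" by auto
    then have k: "Poly_Mapping.keys a \<subseteq> ?A'" "Poly_Mapping.keys b \<subseteq> ?A'"
      by (auto simp: keys_add_nat)
    show "(case (case p of (a, b) \<Rightarrow> (push ?A' ?\<psi> a, push ?A' ?\<psi> b)) of
        (a, b) \<Rightarrow> (push ?A \<phi> a, push ?A \<phi> b)) = p"
      using k ab by (simp add: pp')
    show "(case p of (a, b) \<Rightarrow> (push ?A' ?\<psi> a, push ?A' ?\<psi> b)) \<in> {(a, b). a + b = m}"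
      using ab m by (simp flip: push_add)
  qed
next
  obtain d e where d: "\<And>m. f m \<noteq> 0 \<Longrightarrow> sum_list (exponents m) \<le> d"
    and e: "\<And>m. g m \<noteq> 0 \<Longrightarrow> sum_list (exponents m) \<le> e"
    using f g unfolding quasisymmetric_def by metis
  show "\<exists>d. \<forall>m. series_times f g m \<noteq> 0 \<longrightarrow> sum_list (exponents m) \<le> d"
  proof (intro exI allI impI)
    fix m assume "series_times f g m \<noteq> 0"
    then obtain a b where "a + b = m" "f a * g b \<noteq> 0"
      unfolding series_times_def by (auto elim!: sum.not_neutral_contains_not_neutral)
    then show "sum_list (exponents m) \<le> d + e"
      using d[of a] e[of b] by (auto simp: sum_list_exponents_add)
  qed
qed

typedef qsym = "{f. quasisymmetric f}"
  morphisms qsym_coeff Abs_qsym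
  by (rule exI[of _ "\<lambda>_. 0"]) (simp add: quasisymmetric_def)

setup_lifting type_definition_qsym

lemma quasisymmetric_pointwise:
  assumes "quasisymmetric f" "quasisymmetric g" "h 0 0 = 0"
  shows "quasisymmetric (\<lambda>m. h (f m) (g m))"
proof -
  obtain d e where d: "\<And>m. f m \<noteq> 0 \<Longrightarrow> sum_list (exponents m) \<le> d"
    and e: "\<And>m. g m \<noteq> 0 \<Longrightarrow> sum_list (exponents m) \<le> e"
    using assms unfolding quasisymmetric_def by metis
  have "h (f m) (g m) \<noteq> 0 \<Longrightarrow> sum_list (exponents m) \<le> max d e" for m
    using d[of m] e[of m] assms(3) by (cases "f m = 0"; cases "g m = 0") auto
  then show ?thesis using assms unfolding quasisymmetric_def by metis
qed

instantiation qsym :: rat_vector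
begin

lift_definition zero_qsym :: qsym is "\<lambda>_. 0"
  by (simp add: quasisymmetric_def)

lift_definition plus_qsym :: "qsym \<Rightarrow> qsym \<Rightarrow> qsym" is "\<lambda>f g m. f m + g m"
  by (rule quasisymmetric_pointwise[where h = "(+)"]) auto

lift_definition minus_qsym :: "qsym \<Rightarrow> qsym \<Rightarrow> qsym" is "\<lambda>f g m. f m - g m"
  by (rule quasisymmetric_pointwise[where h = "(-)"]) auto

lift_definition uminus_qsym :: "qsym \<Rightarrow> qsym" is "\<lambda>f m. - f m"
  using quasisymmetric_pointwise[where h = "\<lambda>a _. - a"] by fastforce

lift_definition scaleQ_qsym :: "rat \<Rightarrow> qsym \<Rightarrow> qsym" is "\<lambda>c f m. c * f m"
  using quasisymmetric_pointwise[where h = "\<lambda>a _. c * a" for c] by fastforce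

instance
  by standard (transfer; auto simp: algebra_simps)+

end

lift_definition qsym_times :: "qsym \<Rightarrow> qsym \<Rightarrow> qsym" is series_times
  by (rule quasisymmetric_times)

lift_definition qsym_one :: qsym is "\<lambda>m. if m = 0 then 1 else 0"
  by (auto simp: quasisymmetric_def) (metis exponents_eq_Nil_iff)+

lift_definition qsym_M :: "nat list \<Rightarrow> qsym" is "\<lambda>\<alpha> m. if exponents m = \<alpha> then 1 else 0"
  by (auto simp: quasisymmetric_def)

definition packed :: "nat list \<Rightarrow> nat \<Rightarrow>\<^sub>0 nat" where
  "packed \<alpha> = (\<Sum>i<length \<alpha>. Poly_Mapping.single i (\<alpha> ! i))"

text \<open>The coefficient of \<open>M\<^sub>\<alpha>\<close> in \<open>f\<close> is the coefficient of the monomial \<open>packed \<alpha>\<close>, and the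
  coproduct sends \<open>M\<^sub>\<alpha>\<close> to the sum of \<open>M\<^sub>\<beta> \<otimes> M\<^sub>\<gamma>\<close> over all deconcatenations
  \<open>\<alpha> = \<beta>\<gamma>\<close>.\<close>

definition qsym_comult :: "qsym \<Rightarrow> (qsym, qsym) tensor" where
  "qsym_comult f = (\<Sum>\<alpha>\<in>{\<alpha>. 0 \<notin> set \<alpha> \<and> qsym_coeff f (packed \<alpha>) \<noteq> 0}.
     qsym_coeff f (packed \<alpha>) *\<^sub>Q (\<Sum>i\<le>length \<alpha>. qsym_M (take i \<alpha>) \<otimes> qsym_M (drop i \<alpha>)))"

lemma lookup_packed:
  "Poly_Mapping.lookup (packed \<alpha>) i = (if i < length \<alpha> then \<alpha> ! i else 0)"
  by (auto simp: packed_def lookup_sum lookup_single when_def)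

lemma exponents_packed:
  assumes "0 \<notin> set \<alpha>"
  shows "exponents (packed \<alpha>) = \<alpha>"
proof -
  have "Poly_Mapping.keys (packed \<alpha>) = {0..<length \<alpha>}"
    using assms by (auto simp: in_keys_iff lookup_packed in_set_conv_nth split: if_splits)
  then show ?thesis
    by (auto simp: exponents_def lookup_packed intro: nth_equalityI)
qed

lemma finite_qsym_support: "finite {\<alpha>. 0 \<notin> set \<alpha> \<and> qsym_coeff f (packed \<alpha>) \<noteq> 0}"
proof -
  have "quasisymmetric (qsym_coeff f)" using qsym_coeff by auto
  then obtain d where d: "\<And>m. qsym_coeff f m \<noteq> 0 \<Longrightarrow> sum_list (exponents m) \<le> d"
    unfolding quasisymmetric_def by blast
  have len: "length \<alpha> \<le> sum_list \<alpha>" if "0 \<notin> set \<alpha>" for \<alpha> :: "nat list"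
    using that by (induction \<alpha>) auto
  have "set \<alpha> \<subseteq> {..d} \<and> length \<alpha> \<le> d" if "0 \<notin> set \<alpha>" "qsym_coeff f (packed \<alpha>) \<noteq> 0" for \<alpha>
  proof -
    have "sum_list \<alpha> \<le> d"
      using d[OF that(2)] by (simp only: exponents_packed[OF that(1)])
    then show ?thesis
      using len[OF that(1)] by (auto dest: member_le_sum_list)
  qed
  then have "{\<alpha>. 0 \<notin> set \<alpha> \<and> qsym_coeff f (packed \<alpha>) \<noteq> 0} \<subseteq> {\<alpha>. set \<alpha> \<subseteq> {..d} \<and> length \<alpha> \<le> d}"
    by auto
  then show ?thesis by (rule finite_subset) (simp add: finite_lists_length_le)
qed

lemma qsym_comult_M:
  assumes "0 \<notin> set \<alpha>"
  shows "qsym_comult (qsym_M \<alpha>) = (\<Sum>i\<le>length \<alpha>. qsym_M (take i \<alpha>) \<otimes> qsym_M (drop i \<alpha>))"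
proof -
  have coeff: "qsym_coeff (qsym_M \<alpha>) (packed \<beta>) = (if \<beta> = \<alpha> then 1 else 0)" if "0 \<notin> set \<beta>" for \<beta>
    by (simp only: qsym_M.rep_eq exponents_packed[OF that])
  have "{\<beta>. 0 \<notin> set \<beta> \<and> qsym_coeff (qsym_M \<alpha>) (packed \<beta>) \<noteq> 0} = {\<alpha>}"
  proof (intro set_eqI iffI)
    fix \<beta> assume "\<beta> \<in> {\<beta>. 0 \<notin> set \<beta> \<and> qsym_coeff (qsym_M \<alpha>) (packed \<beta>) \<noteq> 0}"
    then have "0 \<notin> set \<beta>" "qsym_coeff (qsym_M \<alpha>) (packed \<beta>) \<noteq> 0" by simp_all
    then show "\<beta> \<in> {\<alpha>}" using coeff[of \<beta>] by (cases "\<beta> = \<alpha>") simp_all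
  next
    fix \<beta> assume "\<beta> \<in> {\<alpha>}"
    then show "\<beta> \<in> {\<beta>. 0 \<notin> set \<beta> \<and> qsym_coeff (qsym_M \<alpha>) (packed \<beta>) \<noteq> 0}"
      using assms coeff[OF assms] by simp
  qed
  then show ?thesis
    unfolding qsym_comult_def using coeff[OF assms] by (simp add: scaleQ_one)
qed

definition QSym :: "qsym bialg" where
  "QSym = \<lparr>mul = qsym_times, unit = qsym_one, comult = qsym_comult,
           counit = (\<lambda>f. qsym_coeff f 0)\<rparr>"


section \<open>Peak functions\<close>

definition word_monomial :: "nat list \<Rightarrow> nat \<Rightarrow>\<^sub>0 nat" where
  "word_monomial w = (\<Sum>i\<leftarrow>w. Poly_Mapping.single i 1)"

definition F_words :: "nat \<Rightarrow> nat set \<Rightarrow> nat list set" where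
  "F_words n D = {w. length w = n \<and> sorted w \<and> (\<forall>j\<in>D \<inter> {1..<n}. w ! (j - 1) < w ! j)}"

lemma keys_word_monomial: "Poly_Mapping.keys (word_monomial w) = set w"
  by (induction w) (auto simp: word_monomial_def keys_add_nat)

lemma sum_list_exponents_word: "sum_list (exponents (word_monomial w)) = length w"
proof (induction w)
  case (Cons i w)
  have "word_monomial (i # w) = Poly_Mapping.single i 1 + word_monomial w"
    by (simp add: word_monomial_def)
  moreover have "sum_list (exponents (Poly_Mapping.single i 1)) = 1"
    by (simp add: exponents_def)
  ultimately show ?case using Cons by (simp add: sum_list_exponents_add)
qed (simp add: word_monomial_def)

lemma push_word_monomial:
  assumes "finite A" "set w \<subseteq> A"
  shows "push A \<phi> (word_monomial w) = word_monomial (map \<phi> w)"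
  using assms(2)
proof (induction w)
  case Nil
  then show ?case by (simp add: word_monomial_def push_def)
next
  case (Cons i w)
  have "push A \<phi> (Poly_Mapping.single i 1)
      = (\<Sum>k\<in>A. if k = i then Poly_Mapping.single (\<phi> k) 1 else 0)"
    unfolding push_def by (rule sum.cong) (auto simp: lookup_single when_def)
  also have "\<dots> = Poly_Mapping.single (\<phi> i) 1"
    using assms(1) Cons by simp
  finally show ?case
    using Cons by (simp add: word_monomial_def push_add)
qed

lemma finite_F_words: "finite {w \<in> F_words n D. word_monomial w = m}"
  by (rule finite_subset[OF _ finite_lists_length_eq[of "Poly_Mapping.keys m" n]])
    (auto simp: F_words_def keys_word_monomial)

lemma card_F_words_le:
  assumes "exponents m = exponents m'"
  shows "card {w \<in> F_words n D. word_monomial w = m} \<le> card {w \<in> F_words n D. word_monomial w = m'}"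
proof -
  obtain \<phi> where \<phi>: "strict_mono_on (Poly_Mapping.keys m) \<phi>"
    and m': "push (Poly_Mapping.keys m) \<phi> m = m'"
    using assms by (rule exponents_eq_transport)
  have inj: "inj_on \<phi> (Poly_Mapping.keys m)" using \<phi> by (rule strict_mono_on_imp_inj_on)
  have img: "map \<phi> w \<in> {w \<in> F_words n D. word_monomial w = m'}"
    if w: "w \<in> {w \<in> F_words n D. word_monomial w = m}" for w
  proof -
    have sw: "set w = Poly_Mapping.keys m" using w keys_word_monomial by blast
    have lt: "\<phi> (w ! p) < \<phi> (w ! q)" if "p < length w" "q < length w" "w ! p < w ! q" for p q
      by (rule strict_mono_onD[OF \<phi>]) (use that sw nth_mem[of _ w] in simp_all)
    have "sorted (map \<phi> w)"
    proof (rule sorted_iff_nth_mono_less[THEN iffD2], intro allI impI)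
      fix p q assume "p < q" "q < length (map \<phi> w)"
      moreover have "sorted w" using w by (simp add: F_words_def)
      ultimately show "map \<phi> w ! p \<le> map \<phi> w ! q"
        using lt[of p q] sorted_nth_mono[of w p q] by (cases "w ! p = w ! q") auto
    qed
    moreover have "map \<phi> w ! (j - 1) < map \<phi> w ! j" if "j \<in> D \<inter> {1..<n}" for j
    proof -
      have len: "length w = n" and less: "w ! (j - 1) < w ! j"
        using w that unfolding F_words_def by blast+
      have "j < n" "j - 1 < n" using that by auto
      then show ?thesis using lt[OF _ _ less] len by simp
    qed
    moreover have "word_monomial (map \<phi> w) = m'"
    proof -
      have "word_monomial w = m" using w by blast
      then show ?thesis
        using push_word_monomial[of "Poly_Mapping.keys m" w \<phi>] sw m' by simp
    qed
    ultimately show ?thesis using w by (simp add: F_words_def)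
  qed
  show ?thesis
  proof (rule card_inj_on_le[of "map \<phi>"])
    show "inj_on (map \<phi>) {w \<in> F_words n D. word_monomial w = m}"
    proof (rule inj_onI)
      fix v w assume "v \<in> {w \<in> F_words n D. word_monomial w = m}"
        "w \<in> {w \<in> F_words n D. word_monomial w = m}" "map \<phi> v = map \<phi> w"
      then have "word_monomial v = m" "word_monomial w = m" by blast+
      then have "set v = Poly_Mapping.keys m" "set w = Poly_Mapping.keys m"
        using keys_word_monomial[of v] keys_word_monomial[of w] by (simp_all only:)
      then show "v = w"
        using inj by (intro map_inj_on[OF \<open>map \<phi> v = map \<phi> w\<close>]) simp
    qed
    show "map \<phi> ` {w \<in> F_words n D. word_monomial w = m}
        \<subseteq> {w \<in> F_words n D. word_monomial w = m'}"
      using img by blast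
  qed (rule finite_F_words)
qed

lift_definition qsym_F :: "nat \<Rightarrow> nat set \<Rightarrow> qsym" is
  "\<lambda>n D m. of_nat (card {w \<in> F_words n D. word_monomial w = m})"
proof -
  fix n D
  have "sum_list (exponents m) \<le> n" if "of_nat (card {w \<in> F_words n D. word_monomial w = m}) \<noteq> (0::rat)"
    for m
  proof -
    have "{w \<in> F_words n D. word_monomial w = m} \<noteq> {}"
      using that by (metis card.empty of_nat_0)
    then show ?thesis by (auto simp: F_words_def sum_list_exponents_word)
  qed
  moreover have "card {w \<in> F_words n D. word_monomial w = m}
      = card {w \<in> F_words n D. word_monomial w = m'}" if "exponents m = exponents m'" for m m'
    using card_F_words_le[OF that] card_F_words_le[OF that[symmetric]] by (rule order_antisym)
  ultimately show "quasisymmetric (\<lambda>m. of_nat (card {w \<in> F_words n D. word_monomial w = m}))"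
    unfolding quasisymmetric_def by (intro conjI allI impI exI[of _ n] arg_cong[where f = of_nat])
qed

definition qsym_K :: "nat \<Rightarrow> nat set \<Rightarrow> qsym" where
  "qsym_K n \<Lambda> = (if n = 0 then qsym_one else
     2 ^ (card \<Lambda> + 1) *\<^sub>Q
       (\<Sum>D\<in>{D. D \<subseteq> {1..n - 1} \<and> \<Lambda> \<subseteq> (D - Suc ` D) \<union> (Suc ` D - D)}. qsym_F n D))"

definition peak_space :: "qsym set" where
  "peak_space = ratv.span {qsym_K n \<Lambda> | n \<Lambda>. \<Lambda> \<subseteq> {2..n - 1} \<and> (\<forall>i\<in>\<Lambda>. Suc i \<notin> \<Lambda>)}"

typedef peak_fun = peak_space
  morphisms peak_incl Abs_peak_fun
  by (rule exI[of _ 0]) (simp add: peak_space_def ratv.span_zero)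

setup_lifting type_definition_peak_fun

instantiation peak_fun :: rat_vector
begin

lift_definition zero_peak_fun :: peak_fun is 0
  by (simp add: peak_space_def ratv.span_zero)

lift_definition plus_peak_fun :: "peak_fun \<Rightarrow> peak_fun \<Rightarrow> peak_fun" is "(+)"
  by (simp add: peak_space_def ratv.span_add)

lift_definition minus_peak_fun :: "peak_fun \<Rightarrow> peak_fun \<Rightarrow> peak_fun" is "(-)"
  by (simp add: peak_space_def ratv.span_diff)

lift_definition uminus_peak_fun :: "peak_fun \<Rightarrow> peak_fun" is uminus
  by (simp add: peak_space_def ratv.span_neg)

lift_definition scaleQ_peak_fun :: "rat \<Rightarrow> peak_fun \<Rightarrow> peak_fun" is scaleQ
  by (simp add: peak_space_def ratv.span_scale)

instance
  by standard (transfer; simp add: algebra_simps scaleQ_add_right scaleQ_add_left scaleQ_scaleQ)+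

end

text \<open>The Hopf structure that a subspace, given by its inclusion map, inherits from the ambient
  algebra. It is meaningful if the subspace contains the unit and is closed under the product, and
  if the coproduct maps it into its tensor square; the latter is identified with its image, the
  map \<^term>\<open>tensor_map \<iota> \<iota>\<close> being injective over a field.\<close>

definition sub_bialg :: "('a::rat_vector \<Rightarrow> 'b::rat_vector) \<Rightarrow> 'b bialg \<Rightarrow> 'a bialg" where
  "sub_bialg \<iota> H =
     \<lparr>mul = (\<lambda>x y. inv \<iota> (mul H (\<iota> x) (\<iota> y))),
      unit = inv \<iota> (unit H),
      comult = (\<lambda>x. inv (tensor_map \<iota> \<iota>) (comult H (\<iota> x))),
      counit = (\<lambda>x. counit H (\<iota> x))\<rparr>"

definition Peak_Pi :: "peak_fun bialg" where
  "Peak_Pi = sub_bialg peak_incl QSym"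


section \<open>The shuffle Hopf algebra of the peak set\<close>

definition permutation :: "nat list \<Rightarrow> bool" where
  "permutation \<pi> \<longleftrightarrow> distinct \<pi> \<and> 0 \<notin> set \<pi>"

definition Pk :: "nat list \<Rightarrow> nat set" where
  "Pk \<pi> = {i. 2 \<le> i \<and> i \<le> length \<pi> - 1 \<and> \<pi> ! (i - 2) < \<pi> ! (i - 1) \<and> \<pi> ! (i - 1) > \<pi> ! i}"

definition pk_equiv :: "nat list \<Rightarrow> nat list \<Rightarrow> bool" where
  "pk_equiv \<pi> \<sigma> \<longleftrightarrow> permutation \<pi> \<and> permutation \<sigma> \<and> length \<pi> = length \<sigma> \<and> Pk \<pi> = Pk \<sigma>"

quotient_type pk_class = "nat list" / partial: pk_equiv
  morphisms rep_pk_class pk_class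
proof (rule part_equivpI)
  show "\<exists>\<pi>. pk_equiv \<pi> \<pi>"
    by (rule exI[of _ "[]"]) (simp add: pk_equiv_def permutation_def)
qed (auto simp: symp_def transp_def pk_equiv_def)

definition pk_basis :: "nat list \<Rightarrow> pk_class \<Rightarrow>\<^sub>0 rat" where
  "pk_basis \<pi> = Poly_Mapping.single (pk_class \<pi>) 1"

text \<open>By shuffle-compatibility of the peak set, the sum over the shuffles is the same for all
  disjoint representatives.\<close>

definition pk_times_basis :: "pk_class \<Rightarrow> pk_class \<Rightarrow> (pk_class \<Rightarrow>\<^sub>0 rat)" where
  "pk_times_basis c d = (THE h. \<forall>\<pi> \<sigma>.
     permutation \<pi> \<and> permutation \<sigma> \<and> set \<pi> \<inter> set \<sigma> = {} \<and> pk_class \<pi> = c \<and> pk_class \<sigma> = d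
     \<longrightarrow> h = (\<Sum>\<tau>\<in>shuffles \<pi> \<sigma>. pk_basis \<tau>))"

definition pk_times :: "(pk_class \<Rightarrow>\<^sub>0 rat) \<Rightarrow> (pk_class \<Rightarrow>\<^sub>0 rat) \<Rightarrow> (pk_class \<Rightarrow>\<^sub>0 rat)" where
  "pk_times p q = lin_ext (\<lambda>c. lin_ext (\<lambda>d. pk_times_basis c d) q) p"

definition pk_comult_basis :: "pk_class \<Rightarrow> (pk_class \<Rightarrow>\<^sub>0 rat, pk_class \<Rightarrow>\<^sub>0 rat) tensor" where
  "pk_comult_basis c = (THE t. \<forall>\<pi>. permutation \<pi> \<and> pk_class \<pi> = c
     \<longrightarrow> t = (\<Sum>i\<le>length \<pi>. pk_basis (take i \<pi>) \<otimes> pk_basis (drop i \<pi>)))"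

definition H_Pk :: "(pk_class \<Rightarrow>\<^sub>0 rat) bialg" where
  "H_Pk = \<lparr>mul = pk_times, unit = pk_basis [], comult = lin_ext pk_comult_basis,
           counit = (\<lambda>p. Poly_Mapping.lookup p (pk_class []))\<rparr>"

lemma pk_class_eq_iff:
  assumes "permutation \<pi>" "permutation \<sigma>"
  shows "pk_class \<pi> = pk_class \<sigma> \<longleftrightarrow> length \<pi> = length \<sigma> \<and> Pk \<pi> = Pk \<sigma>"
  using assms Quotient3_rel[OF Quotient3_pk_class, of \<pi> \<sigma>] by (auto simp: pk_equiv_def)

lemma ex_pk_class: "\<exists>\<pi>. permutation \<pi> \<and> pk_class \<pi> = c"
  by (metis Quotient3_abs_rep Quotient3_pk_class Quotient3_rep_reflp pk_equiv_def)

lemma Pk_take: "i \<le> length \<pi> \<Longrightarrow> Pk (take i \<pi>) = {j \<in> Pk \<pi>. j < i}"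
  by (auto simp: Pk_def min_def)

lemma Pk_drop: "Pk (drop i \<pi>) = {j. 2 \<le> j \<and> i + j \<in> Pk \<pi>}"
  by (auto simp: Pk_def nth_drop)

lemma pk_comult_basis:
  assumes "permutation \<pi>"
  shows "pk_comult_basis (pk_class \<pi>)
    = (\<Sum>i\<le>length \<pi>. pk_basis (take i \<pi>) \<otimes> pk_basis (drop i \<pi>))"
proof -
  have "pk_basis (take i \<sigma>) = pk_basis (take i \<pi>) \<and> pk_basis (drop i \<sigma>) = pk_basis (drop i \<pi>)"
    if "permutation \<sigma>" "pk_class \<sigma> = pk_class \<pi>" "i \<le> length \<pi>" for \<sigma> i
  proof -
    have "length \<sigma> = length \<pi>" "Pk \<sigma> = Pk \<pi>"
      using that assms by (simp_all add: pk_class_eq_iff)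
    moreover have "permutation (take i \<sigma>)" "permutation (take i \<pi>)"
      "permutation (drop i \<sigma>)" "permutation (drop i \<pi>)"
      using that assms by (auto simp: permutation_def dest: in_set_takeD in_set_dropD)
    ultimately show ?thesis
      using that(3) pk_class_eq_iff[of "take i \<sigma>" "take i \<pi>"] pk_class_eq_iff[of "drop i \<sigma>" "drop i \<pi>"]
      by (simp add: pk_basis_def Pk_take Pk_drop)
  qed
  moreover have "length \<sigma> = length \<pi>" if "permutation \<sigma>" "pk_class \<sigma> = pk_class \<pi>" for \<sigma>
    using that assms by (simp add: pk_class_eq_iff)
  ultimately have wd: "(\<Sum>i\<le>length \<sigma>. pk_basis (take i \<sigma>) \<otimes> pk_basis (drop i \<sigma>))
      = (\<Sum>i\<le>length \<pi>. pk_basis (take i \<pi>) \<otimes> pk_basis (drop i \<pi>))"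
    if "permutation \<sigma>" "pk_class \<sigma> = pk_class \<pi>" for \<sigma>
    using that by (intro sum.cong) auto
  show ?thesis
    unfolding pk_comult_basis_def
  proof (rule the_equality, intro allI impI)
    fix \<sigma> assume "permutation \<sigma> \<and> pk_class \<sigma> = pk_class \<pi>"
    then show "(\<Sum>i\<le>length \<pi>. pk_basis (take i \<pi>) \<otimes> pk_basis (drop i \<pi>))
        = (\<Sum>i\<le>length \<sigma>. pk_basis (take i \<sigma>) \<otimes> pk_basis (drop i \<sigma>))"
      by (intro wd[symmetric]) simp_all
  qed (use assms in blast)
qed

lift_definition K_of_class :: "pk_class \<Rightarrow> qsym" is "\<lambda>\<pi>. qsym_K (length \<pi>) (Pk \<pi>)"
  by (simp add: pk_equiv_def)

definition pk_to_peak :: "(pk_class \<Rightarrow>\<^sub>0 rat) \<Rightarrow> peak_fun" where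
  "pk_to_peak = lin_ext (\<lambda>c. Abs_peak_fun (K_of_class c))"

lemma pk_to_peak_basis:
  assumes "permutation \<pi>"
  shows "peak_incl (pk_to_peak (pk_basis \<pi>)) = qsym_K (length \<pi>) (Pk \<pi>)"
proof -
  have "qsym_K (length \<pi>) (Pk \<pi>) \<in> peak_space"
    unfolding peak_space_def by (rule ratv.span_base) (fastforce simp: Pk_def)
  moreover have "K_of_class (pk_class \<pi>) = qsym_K (length \<pi>) (Pk \<pi>)"
    using assms by (simp add: K_of_class.abs_eq pk_equiv_def)
  ultimately show ?thesis
    by (simp add: pk_to_peak_def pk_basis_def lin_ext_single scaleQ_one Abs_peak_fun_inverse)
qed

end

theory Submission
  imports Defs "HOL-Library.Multiset"
begin

text \<open>The coefficient of \<open>K\<^bsub>|\<pi>|, Pk \<pi>\<^esub>\<close> at the monomial with exponents \<open>a\<^sub>1, \<dots>, a\<^sub>k\<close> is the product of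
  \<open>\<chi>\<close> over the consecutive blocks of \<open>\<pi>\<close> of lengths \<open>a\<^sub>1, \<dots>, a\<^sub>k\<close>, where \<open>\<chi>\<close> is \<open>1\<close> on the empty word,
  \<open>2\<close> on the other words without peaks and \<open>0\<close> on words with peaks. Now \<open>\<chi>\<close> is the convolution of the
  indicators of decreasing and of increasing words, both of which are multiplicative on shuffles;
  hence so is \<open>\<chi>\<close>, and \<open>[\<pi>] \<mapsto> K\<^bsub>|\<pi>|, Pk \<pi>\<^esub>\<close> respects products. It respects coproducts because
  both sides deconcatenate. A triangularity argument shows that it is injective, which gives the
  shuffle-compatibility of the peak set and the associativity of the product of classes. The
  antipode is \<open>[\<pi>] \<mapsto> (-1)\<^bsup>|\<pi>|\<^esup> [rev \<pi>]\<close>. Finally the Hopf structure is carried over to the span of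
  the peak functions along the linear bijection.\<close>

section \<open>Linear maps and tensor products\<close>

text \<open>The shape of \<chi> comes from the normalisation of \<open>qsym_K\<close>. Take a sorted
  word whose set of strict rises is \<open>E\<close>. The sets \<open>D\<close> that count lie
  inside \<open>E\<close>, and as long as every peak lies in \<open>E\<close> or directly after an
  element of \<open>E\<close>, each peak halves their number. The factor 2^(|Pk|+1) compensates for
  this exactly and leaves 2^(|E|+1), one factor 2 for each block of equal letters. So the
  coefficients factor over blocks, and the map is the one that the universal property of
  quasisymmetric functions attaches to the character \<chi>. The obstacle is that the product of
  classes is a definite description and the structure of \<open>Peak_Pi\<close> is made of inverses
  of inclusions, neither of which can be evaluated at the outset. Products are therefore computed in
  \<open>QSym\<close>, and well-definedness is read off from injectivity; closure of the span
  follows because its generators are images of classes. The compatibility of product and coproduct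
  of classes comes instead from an identity on words, \<open>shuffle_sum_deconcat\<close>, which
  also drives the multiplicativity of \<chi>.\<close>

lemma rat_linearI:
  assumes "\<And>x y. f (x + y) = f x + f y" "\<And>c x. f (c *\<^sub>Q x) = c *\<^sub>Q f x"
  shows "rat_linear f"
  using assms by (simp add: rat_linear_iff)

lemma rat_linear_simps:
  assumes "rat_linear f"
  shows "f (x + y) = f x + f y" "f (c *\<^sub>Q x) = c *\<^sub>Q f x" "f 0 = 0" "f (x - y) = f x - f y"
    "f (sum g A) = (\<Sum>a\<in>A. f (g a))"
proof -
  interpret Vector_Spaces.linear scaleQ scaleQ f by (rule assms)
  show "f (x + y) = f x + f y" "f (c *\<^sub>Q x) = c *\<^sub>Q f x" "f 0 = 0" "f (x - y) = f x - f y"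
    "f (sum g A) = (\<Sum>a\<in>A. f (g a))"
    by (rule add scale zero diff sum)+
qed

lemma rat_linear_id: "rat_linear id" "rat_linear (\<lambda>x. x)"
  by (simp_all add: rat_linear_iff)

lemma rat_linear_scale: "rat_linear f \<Longrightarrow> rat_linear (\<lambda>x. c *\<^sub>Q f x)"
  by (simp add: rat_linear_iff scaleQ_add_right scaleQ_scaleQ mult.commute)

lemma rat_linear_scale_left: "rat_linear f \<Longrightarrow> rat_linear (\<lambda>x. f x *\<^sub>Q y)"
  by (simp add: rat_linear_iff scaleQ_add_left scaleQ_scaleQ scaleQ_rat_def)

lemma rat_bilinearI:
  assumes "\<And>a. rat_linear (B a)" "\<And>b. rat_linear (\<lambda>a. B a b)"
  shows "rat_bilinear B"
  using assms by (simp add: rat_bilinear_def)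

lemma rat_bilinearD:
  assumes "rat_bilinear B"
  shows "rat_linear (B a)" "rat_linear (\<lambda>a. B a b)"
  using assms by (simp_all add: rat_bilinear_def)

lemma rat_bilinear_compose:
  assumes "rat_bilinear B" "rat_linear f" "rat_linear g"
  shows "rat_bilinear (\<lambda>a b. B (f a) (g b))"
  using rat_bilinearD[OF assms(1)] assms(2-)
  by (intro rat_bilinearI) (auto intro: rat_linear_compose)

lemma poly_mapping_linear_ext:
  fixes g h :: "('a \<Rightarrow>\<^sub>0 rat) \<Rightarrow> 'b::rat_vector"
  assumes "rat_linear g" "rat_linear h"
    and "\<And>b. g (Poly_Mapping.single b 1) = h (Poly_Mapping.single b 1)"
  shows "g x = h x"
  using lin_ext_cong_single[OF assms(1), of x] lin_ext_cong_single[OF assms(2), of x] assms(3)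
  by simp

lemma rat_linear_lookup: "rat_linear (\<lambda>p :: 'a \<Rightarrow>\<^sub>0 rat. Poly_Mapping.lookup p k)"
  by (simp add: rat_linear_iff lookup_add lookup_scaleQ)

lemma lin_ext_add_fun: "lin_ext (\<lambda>b. f b + g b) p = lin_ext f p + lin_ext g p"
  by (simp add: lin_ext_def scaleQ_add_right sum.distrib)

lemma lin_ext_scale_fun: "lin_ext (\<lambda>b. c *\<^sub>Q f b) p = c *\<^sub>Q lin_ext f p"
  by (simp add: lin_ext_def ratv.scale_sum_right scaleQ_scaleQ mult.commute)

section \<open>Bilinearity, induction and functoriality for tensor products\<close>

lemma tensor_rel_of_relator:
  assumes "s - t \<in> tensor_relators"
  shows "tensor_rel s t"
  using assms by (simp add: tensor_rel_def ratv.span_base)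

lemma pure_tensor_add_left: "(a + a') \<otimes> b = a \<otimes> b + a' \<otimes> b"
  by transfer (rule tensor_rel_of_relator, unfold tensor_relators_def, blast)

lemma pure_tensor_add_right: "a \<otimes> (b + b') = a \<otimes> b + a \<otimes> b'"
  by transfer (rule tensor_rel_of_relator, unfold tensor_relators_def, blast)

lemma pure_tensor_scale_left: "(c *\<^sub>Q a) \<otimes> b = c *\<^sub>Q (a \<otimes> b)"
  by transfer (rule tensor_rel_of_relator, unfold tensor_relators_def, blast)

lemma pure_tensor_scale_right: "a \<otimes> (c *\<^sub>Q b) = c *\<^sub>Q (a \<otimes> b)"
  by transfer (rule tensor_rel_of_relator, unfold tensor_relators_def, blast)

lemma rat_bilinear_pure_tensor: "rat_bilinear (\<otimes>)"
  by (auto intro!: rat_bilinearI rat_linearI simp: pure_tensor_add_left pure_tensor_add_right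
      pure_tensor_scale_left pure_tensor_scale_right)

text \<open>Scalars are absorbed into the left factor and 0 is the pure tensor of zeros, so sums of
  pure tensors exhaust the tensor product.\<close>

lemma tensor_induct [case_names pure add]:
  fixes t :: "('a::rat_vector, 'b::rat_vector) tensor"
  assumes pure: "\<And>a b. P (a \<otimes> b)" and add: "\<And>s t. P s \<Longrightarrow> P t \<Longrightarrow> P (s + t)"
  shows "P t"
proof -
  obtain p where t: "t = abs_tensor p"
    by (metis Quotient3_abs_rep Quotient3_tensor)
  have "abs_tensor p = lin_ext (\<lambda>(a, b). a \<otimes> b) p"
    using lin_ext_cong_single[OF rat_linear_abs_tensor, of p]
    by (simp add: pure_tensor.abs_eq case_prod_unfold)
  moreover have "P (\<Sum>b\<in>A. f b *\<^sub>Q (case b of (a, b) \<Rightarrow> a \<otimes> b))" if "finite A" for A f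
    using that
  proof (induction A)
    case empty
    have "0 \<otimes> 0 = (0 :: ('a, 'b) tensor)"
      using pure_tensor_add_left[of 0 0 "0 :: 'b"] by simp
    then show ?case using pure[of 0 0] by simp
  next
    case (insert x A)
    have "P (f x *\<^sub>Q (case x of (a, b) \<Rightarrow> a \<otimes> b))"
      using pure by (cases x) (simp flip: pure_tensor_scale_left)
    then show ?case using insert by (simp add: add)
  qed
  ultimately show ?thesis by (simp add: t lin_ext_def)
qed

context
  fixes f :: "'a::rat_vector \<Rightarrow> 'c::rat_vector" and g :: "'b::rat_vector \<Rightarrow> 'd::rat_vector"
  assumes f: "rat_linear f" and g: "rat_linear g"
begin

lemma rat_bilinear_tensor_map: "rat_bilinear (\<lambda>a b. f a \<otimes> g b)"
  by (rule rat_bilinear_compose[OF rat_bilinear_pure_tensor f g])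

lemma rat_linear_tensor_map: "rat_linear (tensor_map f g)"
  unfolding tensor_map_def by (rule tensor_lift[OF rat_bilinear_tensor_map])

lemma tensor_map_pure: "tensor_map f g (a \<otimes> b) = f a \<otimes> g b"
  unfolding tensor_map_def by (rule tensor_lift[OF rat_bilinear_tensor_map])

end

lemma tensor_map_compose:
  assumes "rat_linear f" "rat_linear g" "rat_linear f'" "rat_linear g'"
  shows "tensor_map f g (tensor_map f' g' t) = tensor_map (\<lambda>x. f (f' x)) (\<lambda>x. g (g' x)) t"
  by (induction t rule: tensor_induct)
    (simp_all add: assms tensor_map_pure rat_linear_compose rat_linear_tensor_map rat_linear_simps)

lemma tensor_map_id: "tensor_map id id t = t"
  by (induction t rule: tensor_induct)
    (simp_all add: tensor_map_pure rat_linear_id rat_linear_simps(1)[OF rat_linear_tensor_map])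

text \<open>Over a field \<open>f\<close> has a linear left inverse \<open>g\<close>, and
  \<open>tensor_map g g\<close> is then a left inverse. This makes the \<open>inv\<close> in the
  coproduct of \<open>sub_bialg\<close> a true inverse on the range.\<close>

lemma inj_tensor_map:
  fixes f :: "'a::rat_vector \<Rightarrow> 'b::rat_vector"
  assumes "rat_linear f" "inj f"
  shows "inj (tensor_map f f)"
proof -
  interpret vector_space_pair "scaleQ :: rat \<Rightarrow> 'a \<Rightarrow> 'a" "scaleQ :: rat \<Rightarrow> 'b \<Rightarrow> 'b"
    by unfold_locales
  obtain g where g: "rat_linear g" "g \<circ> f = id"
    using linear_injective_left_inverse[OF assms] by blast
  have "tensor_map g g (tensor_map f f t) = t" for t
    unfolding tensor_map_compose[OF g(1) g(1) assms(1) assms(1)] g(2)[unfolded o_def]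
    by (rule tensor_map_id)
  then show ?thesis by (rule inj_on_inverseI)
qed

lemma rat_bilinear_tensor_assoc_aux:
  "rat_bilinear (\<lambda>a b. a \<otimes> b \<otimes> (c :: 'c::rat_vector))"
  by (auto intro!: rat_bilinearI rat_linearI simp: pure_tensor_add_left pure_tensor_add_right
      pure_tensor_scale_left pure_tensor_scale_right)

text \<open>\<open>tensor_assoc\<close> and \<open>tensor_times\<close> are nested lifts, so the
  outer lift needs the inner one to be linear in its parameter.\<close>

lemma rat_linear_tensor_lift_param:
  assumes "\<And>x. rat_bilinear (B x)" "\<And>a b. rat_linear (\<lambda>x. B x a b)"
  shows "rat_linear (\<lambda>x. tensor_lift (B x) t)"
proof (rule rat_linearI)
  note lift = tensor_lift(2)[OF assms(1)] rat_linear_simps(1)[OF tensor_lift(1)[OF assms(1)]]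
  show "tensor_lift (B (x + y)) t = tensor_lift (B x) t + tensor_lift (B y) t" for x y
  proof (induction t rule: tensor_induct)
    case (pure a b)
    show ?case unfolding lift by (rule rat_linear_simps(1)[OF assms(2)])
  qed (simp add: lift)
  show "tensor_lift (B (c *\<^sub>Q x)) t = c *\<^sub>Q tensor_lift (B x) t" for c x
  proof (induction t rule: tensor_induct)
    case (pure a b)
    show ?case unfolding lift by (rule rat_linear_simps(2)[OF assms(2)])
  qed (simp add: lift scaleQ_add_right)
qed

lemma rat_bilinear_tensor_assoc:
  "rat_bilinear (\<lambda>t c. tensor_lift (\<lambda>a b. a \<otimes> b \<otimes> c) t)"
  by (intro rat_bilinearI rat_linear_tensor_lift_param rat_bilinear_tensor_assoc_aux
      tensor_lift(1)[OF rat_bilinear_tensor_assoc_aux]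
      rat_linear_compose[OF rat_bilinearD(1)[OF rat_bilinear_pure_tensor]]
      rat_bilinearD[OF rat_bilinear_pure_tensor])

lemma rat_linear_tensor_assoc: "rat_linear tensor_assoc"
  unfolding tensor_assoc_def by (rule tensor_lift[OF rat_bilinear_tensor_assoc])

lemma tensor_assoc_pure: "tensor_assoc ((a \<otimes> b) \<otimes> c) = a \<otimes> b \<otimes> c"
  unfolding tensor_assoc_def
  by (simp add: tensor_lift(2)[OF rat_bilinear_tensor_assoc]
      tensor_lift(2)[OF rat_bilinear_tensor_assoc_aux])

lemma tensor_assoc_natural:
  assumes "rat_linear f"
  shows "tensor_assoc (tensor_map (tensor_map f f) f t)
    = tensor_map f (tensor_map f f) (tensor_assoc t)"
proof (induction t rule: tensor_induct)
  case (pure s c)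
  then show ?case
    by (induction s rule: tensor_induct)
      (simp_all add: assms tensor_map_pure rat_linear_tensor_map tensor_assoc_pure
        rat_linear_simps pure_tensor_add_left rat_linear_tensor_assoc)
qed (simp_all add: assms rat_linear_simps rat_linear_tensor_map rat_linear_tensor_assoc)

context
  fixes m :: "'a::rat_vector \<Rightarrow> 'a \<Rightarrow> 'a"
  assumes m: "rat_bilinear m"
begin

lemma rat_bilinear_tensor_times_inner: "rat_bilinear (\<lambda>c d. m a c \<otimes> m b d)"
  by (rule rat_bilinear_compose[OF rat_bilinear_pure_tensor rat_bilinearD(1)[OF m]
        rat_bilinearD(1)[OF m]])

lemma rat_bilinear_tensor_times_outer:
  "rat_bilinear (\<lambda>a b. tensor_lift (\<lambda>c d. m a c \<otimes> m b d) t)"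
  by (intro rat_bilinearI rat_linear_tensor_lift_param rat_bilinear_tensor_times_inner
      rat_linear_compose[OF rat_bilinearD(2)[OF m] rat_bilinearD(1)[OF rat_bilinear_pure_tensor]]
      rat_linear_compose[OF rat_bilinearD(2)[OF m] rat_bilinearD(2)[OF rat_bilinear_pure_tensor]])

lemma rat_linear_tensor_times_left: "rat_linear (\<lambda>s. tensor_times m s t)"
  unfolding tensor_times_def by (rule tensor_lift[OF rat_bilinear_tensor_times_outer])

lemma tensor_times_pure_left: "tensor_times m (a \<otimes> b) t = tensor_lift (\<lambda>c d. m a c \<otimes> m b d) t"
  unfolding tensor_times_def by (rule tensor_lift[OF rat_bilinear_tensor_times_outer])

lemma tensor_times_pure: "tensor_times m (a \<otimes> b) (c \<otimes> d) = m a c \<otimes> m b d"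
  by (simp add: tensor_times_pure_left tensor_lift[OF rat_bilinear_tensor_times_inner])

lemma rat_linear_tensor_times_right: "rat_linear (tensor_times m s)"
proof (rule rat_linearI)
  note inner = rat_linear_simps[OF tensor_lift(1)[OF rat_bilinear_tensor_times_inner]]
  note left = rat_linear_simps(1)[OF rat_linear_tensor_times_left]
  show "tensor_times m s (x + y) = tensor_times m s x + tensor_times m s y" for x y
    by (induction s rule: tensor_induct) (simp_all add: tensor_times_pure_left inner left)
  show "tensor_times m s (k *\<^sub>Q x) = k *\<^sub>Q tensor_times m s x" for k x
    by (induction s rule: tensor_induct)
      (simp_all add: tensor_times_pure_left inner left scaleQ_add_right)
qed

lemma rat_bilinear_tensor_times: "rat_bilinear (tensor_times m)"
  by (rule rat_bilinearI[OF rat_linear_tensor_times_right rat_linear_tensor_times_left])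

end

section \<open>Transport of Hopf algebras along linear bijections\<close>

text \<open>A single naturality statement that serves both counit laws and both antipode laws; only
  the bilinear maps change.\<close>

lemma tensor_lift_map:
  assumes "rat_bilinear B" "rat_bilinear C" "rat_linear f" "rat_linear h"
    and "\<And>a b. C (f a) (f b) = h (B a b)"
  shows "tensor_lift C (tensor_map f f t) = h (tensor_lift B t)"
  by (induction t rule: tensor_induct)
    (simp_all add: assms tensor_map_pure rat_linear_simps rat_linear_tensor_map tensor_lift)

lemma inv_rat_linear:
  assumes "rat_linear f" "bij f"
  shows "rat_linear (inv f)"
proof (rule rat_linearI)
  have f: "f (inv f x) = x" for x by (simp add: assms(2) bij_is_surj surj_f_inv_f)
  have inj: "inj f" using assms(2) by (rule bij_is_inj)
  show "inv f (x + y) = inv f x + inv f y" for x y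
    by (rule injD[OF inj]) (simp add: f rat_linear_simps[OF assms(1)])
  show "inv f (c *\<^sub>Q x) = c *\<^sub>Q inv f x" for c x
    by (rule injD[OF inj]) (simp add: f rat_linear_simps[OF assms(1)])
qed

text \<open>The target is constrained only at images under \<open>f\<close>; as \<open>f\<close> is
  surjective, that determines it, and every axiom can be carried over. This suits
  \<open>Peak_Pi\<close>, whose operations are defined through inverses of inclusions.\<close>

locale bialg_bijection =
  fixes H :: "'a::rat_vector bialg" and H' :: "'b::rat_vector bialg" and f :: "'a \<Rightarrow> 'b"
  assumes lin: "rat_linear f" and bij: "bij f"
    and mul: "mul H' (f x) (f y) = f (mul H x y)"
    and unit: "unit H' = f (unit H)"
    and comult: "comult H' (f x) = tensor_map f f (comult H x)"
    and counit: "counit H' (f x) = counit H x"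
begin

lemma f_inv: "f (inv f x) = x"
  by (simp add: bij bij_is_surj surj_f_inv_f)

lemma inv_f: "inv f (f x) = x"
  by (simp add: bij bij_is_inj)

lemma all_iff: "(\<forall>x. P x) \<longleftrightarrow> (\<forall>x. P (f x))"
  by (metis f_inv)

lemma rat_linear_inv: "rat_linear (inv f)"
  by (rule inv_rat_linear[OF lin bij])

lemma rat_linear_transport:
  assumes "rat_linear (\<lambda>x. h (f x))"
  shows "rat_linear h"
  using rat_linear_compose[OF rat_linear_inv assms] by (simp add: f_inv)

lemma mul_eq: "mul H' x y = f (mul H (inv f x) (inv f y))"
  using mul[of "inv f x" "inv f y"] by (simp add: f_inv)

lemma rat_bilinear_mul:
  assumes "rat_bilinear (mul H)"
  shows "rat_bilinear (mul H')"
proof (rule rat_bilinearI)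
  show "rat_linear (mul H' a)" for a
    unfolding mul_eq
    by (intro rat_linear_compose[OF _ lin] rat_linear_compose[OF rat_linear_inv]
        rat_bilinearD[OF assms])
  show "rat_linear (\<lambda>a. mul H' a b)" for b
    unfolding mul_eq
    by (intro rat_linear_compose[OF _ lin] rat_linear_compose[OF rat_linear_inv]
        rat_bilinearD[OF assms])
qed

lemma assoc_algebra_transport:
  assumes "assoc_algebra H"
  shows "assoc_algebra H'"
  using assms unfolding assoc_algebra_def
  by (simp add: rat_bilinear_mul mul_eq unit inv_f f_inv)

lemma rat_linear_comult:
  assumes "rat_linear (comult H)"
  shows "rat_linear (comult H')"
  by (rule rat_linear_transport)
    (simp add: comult rat_linear_compose[OF assms rat_linear_tensor_map[OF lin lin]])

lemma coalgebra_transport: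
  assumes "coalgebra H"
  shows "coalgebra H'"
proof -
  have lin\<Delta>: "rat_linear (comult H)" and lin\<epsilon>: "rat_linear (counit H)"
    and assoc: "\<And>x. tensor_assoc (tensor_map (comult H) id (comult H x))
             = tensor_map id (comult H) (comult H x)"
    and left: "\<And>x. tensor_lift (\<lambda>a b. counit H a *\<^sub>Q b) (comult H x) = x"
    and right: "\<And>x. tensor_lift (\<lambda>a b. counit H b *\<^sub>Q a) (comult H x) = x"
    using assms by (auto simp: coalgebra_def)
  have lin\<Delta>': "rat_linear (comult H')" by (rule rat_linear_comult[OF lin\<Delta>])
  have lin\<epsilon>': "rat_linear (counit H')" by (rule rat_linear_transport) (simp add: counit lin\<epsilon>)
  note lins = lin lin\<Delta> lin\<Delta>' rat_linear_id rat_linear_tensor_map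
  have 1: "tensor_map (comult H') id (tensor_map f f t)
      = tensor_map (tensor_map f f) f (tensor_map (comult H) id t)" for t
    by (simp add: tensor_map_compose lins comult)
  have 2: "tensor_map id (comult H') (tensor_map f f t)
      = tensor_map f (tensor_map f f) (tensor_map id (comult H) t)" for t
    by (simp add: tensor_map_compose lins comult)
  have bil: "rat_bilinear (\<lambda>a b. e a *\<^sub>Q b)" "rat_bilinear (\<lambda>a b. e b *\<^sub>Q a)"
    if "rat_linear e" for e :: "'x::rat_vector \<Rightarrow> rat"
    by (intro rat_bilinearI rat_linear_scale rat_linear_scale_left that rat_linear_id)+
  show ?thesis
    unfolding coalgebra_def
  proof (intro conjI)
    show "\<forall>x. tensor_assoc (tensor_map (comult H') id (comult H' x))
        = tensor_map id (comult H') (comult H' x)"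
      by (subst all_iff) (simp add: comult 1 2 tensor_assoc_natural lin assoc)
    show "\<forall>x. tensor_lift (\<lambda>a b. counit H' a *\<^sub>Q b) (comult H' x) = x"
      by (subst all_iff)
        (simp add: comult left tensor_lift_map[OF bil(1)[OF lin\<epsilon>] bil(1)[OF lin\<epsilon>'] lin lin]
          counit rat_linear_simps[OF lin])
    show "\<forall>x. tensor_lift (\<lambda>a b. counit H' b *\<^sub>Q a) (comult H' x) = x"
      by (subst all_iff)
        (simp add: comult right tensor_lift_map[OF bil(2)[OF lin\<epsilon>] bil(2)[OF lin\<epsilon>'] lin lin]
          counit rat_linear_simps[OF lin])
  qed (rule lin\<Delta>' lin\<epsilon>')+
qed

lemma tensor_times_transport:
  assumes "rat_bilinear (mul H)"
  shows "tensor_times (mul H') (tensor_map f f s) (tensor_map f f t)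
    = tensor_map f f (tensor_times (mul H) s t)"
proof -
  note tt = rat_bilinear_tensor_times[OF assms]
    rat_bilinear_tensor_times[OF rat_bilinear_mul[OF assms]]
  note simps = rat_linear_simps(1)[OF rat_linear_tensor_map[OF lin lin]]
    rat_linear_simps(1)[OF rat_bilinearD(1)[OF tt(1)]]
    rat_linear_simps(1)[OF rat_bilinearD(2)[OF tt(1)]]
    rat_linear_simps(1)[OF rat_bilinearD(1)[OF tt(2)]]
    rat_linear_simps(1)[OF rat_bilinearD(2)[OF tt(2)]]
  show ?thesis
  proof (induction s rule: tensor_induct)
    case (pure a b)
    show ?case
      by (induction t rule: tensor_induct)
        (simp_all add: simps tensor_map_pure lin tensor_times_pure assms rat_bilinear_mul mul)
  qed (simp add: simps)
qed

lemma bialgebra_transport: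
  assumes "bialgebra H"
  shows "bialgebra H'"
proof -
  have bil: "rat_bilinear (mul H)" using assms by (auto simp: bialgebra_def assoc_algebra_def)
  have alg: "assoc_algebra H" "coalgebra H"
    and \<Delta>: "comult H (mul H x y) = tensor_times (mul H) (comult H x) (comult H y)"
      "comult H (unit H) = unit H \<otimes> unit H"
    and \<epsilon>: "counit H (mul H x y) = counit H x * counit H y" "counit H (unit H) = 1" for x y
    using assms by (auto simp: bialgebra_def)
  have "comult H' (mul H' (f x) (f y)) = tensor_times (mul H') (comult H' (f x)) (comult H' (f y))"
    and "counit H' (mul H' (f x) (f y)) = counit H' (f x) * counit H' (f y)" for x y
    by (simp_all add: mul comult counit \<Delta> \<epsilon> tensor_times_transport[OF bil])
  then have "comult H' (mul H' x y) = tensor_times (mul H') (comult H' x) (comult H' y)"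
    and "counit H' (mul H' x y) = counit H' x * counit H' y" for x y
    by (metis f_inv)+
  then show ?thesis
    unfolding bialgebra_def
    by (simp add: assoc_algebra_transport coalgebra_transport alg unit comult \<Delta> counit \<epsilon>
        tensor_map_pure lin)
qed

text \<open>The equivalence is used in both directions: forwards for existence of an antipode on
  \<open>H'\<close>, backwards for its uniqueness.\<close>

lemma is_antipode_transport_iff:
  assumes "bialgebra H" "rat_linear S" "rat_linear S'" "\<And>x. S' (f x) = f (S x)"
  shows "is_antipode H' S' \<longleftrightarrow> is_antipode H S"
proof -
  have bil: "rat_bilinear (mul H)" using assms by (auto simp: bialgebra_def assoc_algebra_def)
  note bils = rat_bilinear_compose[OF bil assms(2) rat_linear_id(2)]
    rat_bilinear_compose[OF bil rat_linear_id(2) assms(2)]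
    rat_bilinear_compose[OF rat_bilinear_mul[OF bil] assms(3) rat_linear_id(2)]
    rat_bilinear_compose[OF rat_bilinear_mul[OF bil] rat_linear_id(2) assms(3)]
  have "tensor_lift (\<lambda>a b. mul H' (S' a) b) (tensor_map f f t)
      = f (tensor_lift (\<lambda>a b. mul H (S a) b) t)" for t
    by (rule tensor_lift_map[OF bils(1,3) lin lin]) (simp add: assms(4) mul)
  moreover have "tensor_lift (\<lambda>a b. mul H' a (S' b)) (tensor_map f f t)
      = f (tensor_lift (\<lambda>a b. mul H a (S b)) t)" for t
    by (rule tensor_lift_map[OF bils(2,4) lin lin]) (simp add: assms(4) mul)
  moreover have "f u = c *\<^sub>Q f v \<longleftrightarrow> u = c *\<^sub>Q v" for c u v
    by (metis inv_f rat_linear_simps(2)[OF lin])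
  ultimately show ?thesis
    unfolding is_antipode_def
    by (subst (1 2) all_iff) (simp add: comult unit counit assms)
qed

text \<open>\<open>antipode\<close> is a definite description, so it can be evaluated only with
  uniqueness at hand. Conjugation by \<open>f\<close> moves uniqueness from \<open>H\<close> to
  \<open>H'\<close>, after which both descriptions have known values.\<close>

lemma hopf_iso_transport:
  assumes H: "hopf_algebra H" and unique: "\<And>S T. is_antipode H S \<Longrightarrow> is_antipode H T \<Longrightarrow> S = T"
  shows "hopf_iso H H' f"
proof -
  have bi: "bialgebra H" using H by (simp add: hopf_algebra_def)
  obtain S where S: "is_antipode H S" using H by (auto simp: hopf_algebra_def)
  then have linS: "rat_linear S" by (simp add: is_antipode_def)
  define S' where "S' x = f (S (inv f x))" for x
  have linS': "rat_linear S'"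
    unfolding S'_def
    by (rule rat_linear_compose[OF rat_linear_compose[OF rat_linear_inv linS] lin])
  have S': "is_antipode H' S'"
    using is_antipode_transport_iff[OF bi linS linS'] S by (simp add: S'_def inv_f)
  have unique': "T = S'" if T: "is_antipode H' T" for T
  proof -
    have linT: "rat_linear T" using T by (simp add: is_antipode_def)
    define U where "U x = inv f (T (f x))" for x
    have linU: "rat_linear U"
      unfolding U_def
      by (rule rat_linear_compose[OF rat_linear_compose[OF lin linT] rat_linear_inv])
    have "is_antipode H U"
      using is_antipode_transport_iff[OF bi linU linT] T by (simp add: U_def f_inv)
    then have "U = S" by (rule unique[OF _ S])
    have "T x = S' x" for x
      using fun_cong[OF \<open>U = S\<close>, of "inv f x", THEN arg_cong[where f = f]]
      by (simp add: S'_def U_def f_inv)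
    then show ?thesis by (rule ext)
  qed
  have "antipode H = S"
    unfolding antipode_def by (rule the_equality) (rule S unique[OF _ S], assumption?)+
  moreover have "antipode H' = S'"
    unfolding antipode_def by (rule the_equality) (rule S' unique', assumption?)+
  ultimately show ?thesis
    unfolding hopf_iso_def hopf_hom_def hopf_algebra_def
    using bi S S' by (auto simp: bialgebra_transport lin bij mul unit comult counit S'_def inv_f)
qed

end

section \<open>Sums over shuffles\<close>

text \<open>The sum of \<open>f\<close> over the shuffles counted with multiplicity, which makes the recursion valid
  without any distinctness assumption.\<close>

fun shuffle_sum :: "('a list \<Rightarrow> 'b::comm_monoid_add) \<Rightarrow> 'a list \<Rightarrow> 'a list \<Rightarrow> 'b" where
  "shuffle_sum f [] ys = f ys"
| "shuffle_sum f (x # xs) [] = f (x # xs)"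
| "shuffle_sum f (x # xs) (y # ys)
     = shuffle_sum (\<lambda>t. f (x # t)) xs (y # ys) + shuffle_sum (\<lambda>t. f (y # t)) (x # xs) ys"

lemma shuffle_sum_Nil2 [simp]: "shuffle_sum f xs [] = f xs"
  by (cases xs) auto

text \<open>\<open>shuffles\<close> is a set, so a word arising in two ways would count once. With
  disjoint letters the heads \<open>x\<close> and \<open>y\<close> tell the two branches apart and
  nothing collapses.\<close>

lemma sum_shuffles:
  assumes "distinct xs" "distinct ys" "set xs \<inter> set ys = {}"
  shows "(\<Sum>t\<in>shuffles xs ys. f t) = shuffle_sum f xs ys"
  using assms
proof (induction f xs ys rule: shuffle_sum.induct)
  case (3 f x xs y ys)
  have "(\<Sum>t\<in>shuffles (x # xs) (y # ys). f t)
      = (\<Sum>t\<in>(#) x ` shuffles xs (y # ys). f t) + (\<Sum>t\<in>(#) y ` shuffles (x # xs) ys. f t)"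
    unfolding shuffles.simps by (rule sum.union_disjoint) (use 3 in auto)
  also have "\<dots> = (\<Sum>t\<in>shuffles xs (y # ys). f (x # t)) + (\<Sum>t\<in>shuffles (x # xs) ys. f (y # t))"
    by (simp add: sum.reindex)
  finally show ?case using 3 by simp
qed auto

lemma shuffle_sum_cong:
  assumes "\<And>t. t \<in> shuffles xs ys \<Longrightarrow> f t = g t"
  shows "shuffle_sum f xs ys = shuffle_sum g xs ys"
  using assms
proof (induction f xs ys arbitrary: g rule: shuffle_sum.induct)
  case (3 f x xs y ys)
  have "shuffle_sum (\<lambda>t. f (x # t)) xs (y # ys) = shuffle_sum (\<lambda>t. g (x # t)) xs (y # ys)"
    by (rule 3) (use 3(3) in auto)
  moreover have "shuffle_sum (\<lambda>t. f (y # t)) (x # xs) ys = shuffle_sum (\<lambda>t. g (y # t)) (x # xs) ys"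
    by (rule 3) (use 3(3) in auto)
  ultimately show ?case by simp
qed auto

lemma shuffle_sum_add:
  "shuffle_sum (\<lambda>t. f t + g t) xs ys = shuffle_sum f xs ys + shuffle_sum g xs ys"
  by (induction xs ys arbitrary: f g rule: shuffles.induct)
    (simp_all add: add.assoc add.left_commute)

lemma additive_shuffle_sum:
  assumes "\<And>x y. h (x + y) = h x + h y"
  shows "h (shuffle_sum f xs ys) = shuffle_sum (\<lambda>t. h (f t)) xs ys"
  by (induction f xs ys rule: shuffle_sum.induct) (simp_all add: assms)

lemma shuffle_sum_product:
  fixes f g :: "'a list \<Rightarrow> 'b::semiring_0"
  shows "shuffle_sum (\<lambda>s. shuffle_sum (\<lambda>t. f s * g t) xs ys) us vs
    = shuffle_sum f us vs * shuffle_sum g xs ys"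
  by (simp add: distrib_left distrib_right flip: additive_shuffle_sum[where h = "\<lambda>x. c * x" for c]
      additive_shuffle_sum[where h = "\<lambda>x. x * c" for c])

lemma sum_deconcat_Cons:
  "(\<Sum>k\<le>length (x # t). G (take k (x # t)) (drop k (x # t)))
    = G [] (x # t) + (\<Sum>k\<le>length t. G (x # take k t) (drop k t))"
  by (simp add: sum.atMost_Suc_shift del: sum.atMost_Suc)

lemma sum_deconcat_Cons2:
  "(\<Sum>k\<le>length (x # y # t). G (take k (x # y # t)) (drop k (x # y # t)))
    = G [] (x # y # t) + (G [x] (y # t) + (\<Sum>k\<le>length t. G (x # y # take k t) (drop k t)))"
  unfolding sum_deconcat_Cons[of G] sum_deconcat_Cons[of "\<lambda>s. G (x # s)"] ..

text \<open>Cutting a shuffle in two cuts each of the words in two, and the parts are shuffled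
  separately. This is the compatibility of shuffling with deconcatenation; keeping \<open>G\<close>
  arbitrary makes it serve for \<chi>, for the coefficients and for the coproduct alike.\<close>

lemma shuffle_sum_deconcat:
  fixes G :: "'a list \<Rightarrow> 'a list \<Rightarrow> 'b::comm_monoid_add"
  shows "shuffle_sum (\<lambda>t. \<Sum>k\<le>length t. G (take k t) (drop k t)) xs ys
    = (\<Sum>i\<le>length xs. \<Sum>j\<le>length ys.
        shuffle_sum (\<lambda>s. shuffle_sum (G s) (drop i xs) (drop j ys)) (take i xs) (take j ys))"
proof (induction xs ys arbitrary: G rule: shuffles.induct)
  case (3 x xs y ys)
  define R where "R G xs ys i j
    = shuffle_sum (\<lambda>s. shuffle_sum (G s) (drop i xs) (drop j ys)) (take i xs) (take j ys)"
    for G :: "'a list \<Rightarrow> 'a list \<Rightarrow> 'b" and xs ys i j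
  define D where "D G t = (\<Sum>k\<le>length t. G (take k t) (drop k t))"
    for G :: "'a list \<Rightarrow> 'a list \<Rightarrow> 'b" and t
  have D_Cons: "D G (z # t) = G [] (z # t) + D (\<lambda>s. G (z # s)) t" for G z t
    unfolding D_def by (rule sum_deconcat_Cons)
  let ?xs = "x # xs" and ?ys = "y # ys"
  let ?X = "\<lambda>s. G (x # s)" and ?Y = "\<lambda>s. G (y # s)"
  \<comment> \<open>The cases follow the first letter of the left part: it is empty, takes letters
    from one word only, or takes letters from both.\<close>
  have R00: "R G ?xs ?ys 0 0 = shuffle_sum (G []) ?xs ?ys" by (simp add: R_def)
  have RS0: "R G ?xs ?ys (Suc i) 0 = R ?X xs ?ys i 0" for i by (simp add: R_def)
  have R0S: "R G ?xs ?ys 0 (Suc j) = R ?Y ?xs ys 0 j" for j by (simp add: R_def)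
  have RSS: "R G ?xs ?ys (Suc i) (Suc j) = R ?X xs ?ys i (Suc j) + R ?Y ?xs ys (Suc i) j" for i j
    by (simp add: R_def)
  have IH: "shuffle_sum (D ?X) xs ?ys = (\<Sum>i\<le>length xs. \<Sum>j\<le>Suc (length ys). R ?X xs ?ys i j)"
    "shuffle_sum (D ?Y) ?xs ys = (\<Sum>i\<le>Suc (length xs). \<Sum>j\<le>length ys. R ?Y ?xs ys i j)"
    unfolding D_def R_def using 3(1)[of ?X] 3(2)[of ?Y] by (simp_all only: list.size(4) add_Suc_right add_0_right)
  have "shuffle_sum (D G) ?xs ?ys
    = shuffle_sum (G []) ?xs ?ys
      + (\<Sum>i\<le>length xs. \<Sum>j\<le>Suc (length ys). R ?X xs ?ys i j)
      + (\<Sum>i\<le>Suc (length xs). \<Sum>j\<le>length ys. R ?Y ?xs ys i j)"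
    unfolding IH[symmetric] by (simp add: D_Cons shuffle_sum_add add_ac)
  also have "\<dots> = (\<Sum>i\<le>Suc (length xs). \<Sum>j\<le>Suc (length ys). R G ?xs ?ys i j)"
    by (simp only: sum.atMost_Suc_shift RS0 R0S RSS R00 sum.distrib add_ac)
  finally show ?case by (simp add: R_def D_def)
qed simp_all

text \<open>For a strict total order two sorted words have exactly one sorted shuffle, their merge,
  and a shuffle with an unsorted word is never sorted. Both \<open><\<close> and \<open>>\<close>
  are instances.\<close>

lemma shuffle_sum_sorted_wrt:
  assumes "transp R" "\<And>x y. x \<noteq> y \<Longrightarrow> R x y \<longleftrightarrow> \<not> R y x" "set xs \<inter> set ys = {}"
  shows "shuffle_sum (\<lambda>t. of_bool (sorted_wrt R t) :: rat) xs ys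
    = of_bool (sorted_wrt R xs) * of_bool (sorted_wrt R ys)"
  using assms(3)
proof (induction xs ys rule: shuffles.induct)
  case (3 x xs y ys)
  \<comment> \<open>All shuffles of \<open>us\<close> and \<open>vs\<close> have the same letters,
    so the condition on the head is a constant factor.\<close>
  have head: "shuffle_sum (\<lambda>t. of_bool (sorted_wrt R (z # t)) :: rat) us vs
      = of_bool (\<forall>w\<in>set us \<union> set vs. R z w) * shuffle_sum (\<lambda>t. of_bool (sorted_wrt R t)) us vs"
    for z us vs
    unfolding additive_shuffle_sum[where h = "\<lambda>x. c * x" for c, OF distrib_left]
    by (rule shuffle_sum_cong) (simp add: set_shuffles flip: of_bool_conj)
  have xy: "R x y \<longleftrightarrow> \<not> R y x" using assms(2)[of x y] 3(3) by auto
  have tr: "R a c" if "R a b" "R b c" for a b c using assms(1) that by (rule transpD)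
  have "shuffle_sum (\<lambda>t. of_bool (sorted_wrt R t) :: rat) (x # xs) (y # ys)
      = of_bool (\<forall>w\<in>set xs \<union> set (y # ys). R x w) * (of_bool (sorted_wrt R xs) * of_bool (sorted_wrt R (y # ys)))
      + of_bool (\<forall>w\<in>set (x # xs) \<union> set ys. R y w) * (of_bool (sorted_wrt R (x # xs)) * of_bool (sorted_wrt R ys))"
    unfolding shuffle_sum.simps head using 3 by simp
  also have "\<dots> = of_bool (sorted_wrt R (x # xs)) * of_bool (sorted_wrt R (y # ys))"
    using xy by (auto simp: of_bool_def dest: tr)
  finally show ?case .
qed simp_all

section \<open>The peakless character\<close>

definition peakless_char :: "nat list \<Rightarrow> rat" where
  "peakless_char \<pi> = (if \<pi> = [] then 1 else if Pk \<pi> = {} then 2 else 0)"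

lemma Pk_short: "length \<pi> \<le> 2 \<Longrightarrow> Pk \<pi> = {}"
  by (auto simp: Pk_def)

lemma Pk_Cons3_empty_iff:
  "Pk (x # y # z # zs) = {} \<longleftrightarrow> \<not> (x < y \<and> z < y) \<and> Pk (y # z # zs) = {}"
proof -
  have "Pk (y # z # zs) = {j. 2 \<le> j \<and> 1 + j \<in> Pk (x # y # z # zs)}"
    using Pk_drop[of 1 "x # y # z # zs"] by simp
  moreover have "2 \<in> Pk (x # y # z # zs) \<longleftrightarrow> x < y \<and> z < y"
    by (auto simp: Pk_def)
  moreover have "j = 2 \<or> (\<exists>i\<ge>2. j = 1 + i)" if "j \<in> Pk (x # y # z # zs)" for j
  proof -
    have "2 \<le> j" using that by (simp add: Pk_def)
    then have "j = 2 \<or> 2 \<le> j - 1 \<and> j = 1 + (j - 1)" by auto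
    then show ?thesis by blast
  qed
  ultimately show ?thesis by blast
qed

text \<open>Once a word has risen, its first later descent creates a peak.\<close>

lemma Pk_Cons2_empty_iff:
  assumes "x < y" "distinct (y # zs)"
  shows "Pk (x # y # zs) = {} \<longleftrightarrow> sorted_wrt (<) (y # zs)"
  using assms
proof (induction zs arbitrary: x y)
  case Nil
  then show ?case by (simp add: Pk_short)
next
  case (Cons z zs)
  show ?case
  proof (cases "y < z")
    case True
    have "(\<forall>w\<in>set (z # zs). y < w) \<and> sorted_wrt (<) (z # zs) \<longleftrightarrow> sorted_wrt (<) (z # zs)"
      using True by auto
    then show ?thesis
      using Cons.IH[OF True] Cons.prems True by (auto simp: Pk_Cons3_empty_iff)
  next
    case False
    then have "z < y" using Cons.prems by auto
    then show ?thesis using Cons.prems by (auto simp: Pk_Cons3_empty_iff)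
  qed
qed

text \<open>A nonempty word of distinct letters without peaks is decreasing up to its least letter and
  increasing from there; the least letter can be put into either part.\<close>

lemma peakless_char_deconcat:
  assumes "distinct \<pi>"
  shows "peakless_char \<pi>
    = (\<Sum>k\<le>length \<pi>. of_bool (sorted_wrt (>) (take k \<pi>)) * of_bool (sorted_wrt (<) (drop k \<pi>)))"
  using assms
proof (induction \<pi> rule: induct_list012)
  case (3 x y zs)
  let ?G = "\<lambda>(s :: nat list) (t :: nat list). of_bool (sorted_wrt (>) s) * of_bool (sorted_wrt (<) t) :: rat"
  have eq: "(\<Sum>k\<le>length (x # y # zs). ?G (take k (x # y # zs)) (drop k (x # y # zs)))
    = ?G [] (x # y # zs) + (?G [x] (y # zs) + (\<Sum>k\<le>length zs. ?G (x # y # take k zs) (drop k zs)))"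
    by (rule sum_deconcat_Cons2[where G = ?G])
  show ?case
  proof (cases "x < y")
    case True
    have "\<not> sorted_wrt (>) (x # y # t)" for t using True by auto
    moreover have "sorted_wrt (<) (x # y # zs) \<longleftrightarrow> sorted_wrt (<) (y # zs)"
      using True by auto
    ultimately show ?thesis
      unfolding eq using Pk_Cons2_empty_iff[OF True, of zs] 3(3) by (auto simp: peakless_char_def)
  next
    case False
    then have yx: "y < x" using 3(3) by auto
    have "sorted_wrt (>) (x # y # t) \<longleftrightarrow> sorted_wrt (>) (y # t)" for t
      using yx by auto
    \<comment> \<open>The empty prefix contributes 0 because of the descent. The split after
      \<open>x\<close> takes over the role of the empty prefix of \<open>y # zs\<close>, and putting
      the larger \<open>x\<close> in front preserves all later splits.\<close>
    then have "(\<Sum>k\<le>length (x # y # zs). ?G (take k (x # y # zs)) (drop k (x # y # zs)))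
        = ?G [] (y # zs) + (\<Sum>k\<le>length zs. ?G (y # take k zs) (drop k zs))"
      unfolding eq using yx by auto
    also have "\<dots> = peakless_char (y # zs)"
      using 3(2,3) unfolding sum_deconcat_Cons[of ?G, symmetric] by simp
    also have "\<dots> = peakless_char (x # y # zs)"
      using yx by (cases zs) (auto simp: peakless_char_def Pk_Cons3_empty_iff Pk_short)
    finally show ?thesis by simp
  qed
qed (simp_all add: peakless_char_def Pk_short)

lemma disjoint_take_drop:
  assumes "set xs \<inter> set ys = {}"
  shows "set (take i xs) \<inter> set (take j ys) = {}" "set (drop i xs) \<inter> set (drop j ys) = {}"
  using assms set_take_subset[of i xs] set_take_subset[of j ys]
      set_drop_subset[of i xs] set_drop_subset[of j ys] by blast+

text \<open>Multiplicativity passes to a convolution because the values commute: the two middle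
  factors of each product are exchanged.\<close>

lemma shuffle_sum_peakless_char:
  assumes "distinct xs" "distinct ys" "set xs \<inter> set ys = {}"
  shows "shuffle_sum peakless_char xs ys = peakless_char xs * peakless_char ys"
proof -
  let ?d = "\<lambda>t. of_bool (sorted_wrt (>) t) :: rat" and ?i = "\<lambda>t. of_bool (sorted_wrt (<) t) :: rat"
  have "shuffle_sum peakless_char xs ys
      = shuffle_sum (\<lambda>t. \<Sum>k\<le>length t. ?d (take k t) * ?i (drop k t)) xs ys"
    by (rule shuffle_sum_cong, rule peakless_char_deconcat, rule distinct_disjoint_shuffles[OF assms])
  also have "\<dots> = (\<Sum>i\<le>length xs. \<Sum>j\<le>length ys. (?d (take i xs) * ?d (take j ys))
      * (?i (drop i xs) * ?i (drop j ys)))"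
    unfolding shuffle_sum_deconcat[of "\<lambda>s t. ?d s * ?i t"] shuffle_sum_product
    by (intro sum.cong refl arg_cong2[where f = "(*)"] shuffle_sum_sorted_wrt
        disjoint_take_drop[OF assms(3)])
      (auto simp: transp_def)
  also have "\<dots> = peakless_char xs * peakless_char ys"
    unfolding peakless_char_deconcat[OF assms(1)] peakless_char_deconcat[OF assms(2)] sum_product
    by (simp add: mult_ac)
  finally show ?thesis .
qed

section \<open>Coefficients of the peak functions\<close>

lemma mem_symdiff_Suc_iff:
  assumes "0 < x"
  shows "x \<in> (D - Suc ` D) \<union> (Suc ` D - D) \<longleftrightarrow> (x \<in> D \<longleftrightarrow> x - 1 \<notin> D)"
  using assms by (cases x) auto

text \<open>Toggling an element of \<open>E\<close> in \<open>{\<lambda> - 1, \<lambda>}\<close> exchanges the sets \<open>D\<close> that satisfy the condition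
  at \<open>\<lambda>\<close> with those that do not, and does not affect the conditions at the other elements.\<close>

lemma card_symdiff_Suc_subsets:
  assumes "finite E" "finite \<Lambda>" "0 \<notin> \<Lambda>" "\<forall>i\<in>\<Lambda>. Suc i \<notin> \<Lambda>"
  shows "2 ^ card \<Lambda> * card {D. D \<subseteq> E \<and> \<Lambda> \<subseteq> (D - Suc ` D) \<union> (Suc ` D - D)}
    = (if \<Lambda> \<subseteq> E \<union> Suc ` E then 2 ^ card E else 0)"
  using assms(2-)
proof (induction \<Lambda>)
  case empty
  have "card {D. D \<subseteq> E} = 2 ^ card E" using card_Pow[OF assms(1)] by (simp add: Pow_def)
  then show ?case by simp
next
  case (insert l \<Lambda>)
  define S where "S D = (D - Suc ` D) \<union> (Suc ` D - D)" for D
  have S_iff: "x \<in> S D \<longleftrightarrow> (x \<in> D \<longleftrightarrow> x - 1 \<notin> D)" if "0 < x" for x D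
    unfolding S_def by (rule mem_symdiff_Suc_iff[OF that])
  let ?A = "{D. D \<subseteq> E \<and> \<Lambda> \<subseteq> S D}"
  let ?B = "{D. D \<subseteq> E \<and> insert l \<Lambda> \<subseteq> S D}"
  let ?C = "{D. D \<subseteq> E \<and> \<Lambda> \<subseteq> S D \<and> l \<notin> S D}"
  have l: "0 < l" using insert.prems by auto
  have pos: "0 < x" if "x \<in> \<Lambda>" for x using that insert.prems by (cases x) auto
  have IH: "2 ^ card \<Lambda> * card ?A = (if \<Lambda> \<subseteq> E \<union> Suc ` E then 2 ^ card E else 0)"
    unfolding S_def by (rule insert.IH) (use insert.prems in auto)
  have "2 ^ card (insert l \<Lambda>) * card ?B = (if insert l \<Lambda> \<subseteq> E \<union> Suc ` E then 2 ^ card E else 0)"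
  proof (cases "l \<in> E \<union> Suc ` E")
    case True
    \<comment> \<open>The letter to toggle is \<open>l\<close> or \<open>l - 1\<close>, whichever
      lies in \<open>E\<close>; exactly this makes the condition at \<open>l\<close> flip.\<close>
    then obtain e where e: "e \<in> E" "e = l \<or> e = l - 1" "Suc e = l \<or> e = l" by auto
    define t where "t D = (if e \<in> D then D - {e} else insert e D)" for D
    have tt: "t (t D) = D" for D by (auto simp: t_def)
    have te: "x \<in> t D \<longleftrightarrow> x \<in> D" if "x \<noteq> e" for x D using that by (auto simp: t_def)
    have tl: "l \<in> S (t D) \<longleftrightarrow> l \<notin> S D" for D
      unfolding S_iff[OF l] using e(2) l by (auto simp: t_def)
    have tx: "x \<in> S (t D) \<longleftrightarrow> x \<in> S D" if "x \<in> \<Lambda>" for x D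
    proof -
      \<comment> \<open>As \<Lambda> has no consecutive elements, the pair \<open>x - 1\<close>,
        \<open>x\<close> avoids both \<open>l - 1\<close> and \<open>l\<close>, hence
        \<open>e\<close>.\<close>
      have "x \<noteq> l" "Suc x \<noteq> l" "x \<noteq> Suc l" using insert.prems insert.hyps that by auto
      then have "x \<noteq> e" "x - 1 \<noteq> e" using e(3) pos[OF that] by auto
      then show ?thesis unfolding S_iff[OF pos[OF that]] by (simp add: te)
    qed
    have tE: "t D \<subseteq> E" if "D \<subseteq> E" for D using that e(1) by (auto simp: t_def)
    have "bij_betw t ?B ?C"
    proof (rule bij_betw_byWitness[where f' = t])
      show "t ` ?B \<subseteq> ?C" "t ` ?C \<subseteq> ?B"
        using tl tx tE by blast+
    qed (simp_all add: tt)
    then have "card ?C = card ?B" by (simp add: bij_betw_same_card)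
    moreover have "card ?A = card ?B + card ?C"
    proof -
      have A: "?A = ?B \<union> ?C" by blast
      show ?thesis
        unfolding A
        by (rule card_Un_disjoint) (auto intro: finite_subset[of _ "Pow E"] simp: assms(1))
    qed
    ultimately have "card ?A = 2 * card ?B" by linarith
    moreover have "2 ^ card (insert l \<Lambda>) * card ?B = 2 ^ card \<Lambda> * (2 * card ?B)"
      unfolding card_insert_disjoint[OF insert.hyps] power_Suc by (simp only: mult_ac)
    ultimately have "2 ^ card (insert l \<Lambda>) * card ?B = 2 ^ card \<Lambda> * card ?A" by (simp only:)
    moreover have "insert l \<Lambda> \<subseteq> E \<union> Suc ` E \<longleftrightarrow> \<Lambda> \<subseteq> E \<union> Suc ` E" using True by blast
    ultimately show ?thesis using IH by (simp only:)
  next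
    case False
    then have "?B = {}" unfolding S_def by blast
    then have "card ?B = 0" by (simp only: card.empty)
    moreover have "\<not> insert l \<Lambda> \<subseteq> E \<union> Suc ` E" using False by blast
    ultimately show ?thesis by (simp only: mult_0_right if_False)
  qed
  then show ?case unfolding S_def .
qed

section \<open>Fundamental and peak functions evaluated at sorted words\<close>

lemma lookup_word_monomial: "Poly_Mapping.lookup (word_monomial w) i = count (mset w) i"
  by (induction w) (auto simp: word_monomial_def lookup_add lookup_single when_def)

lemma word_monomial_inj:
  assumes "sorted v" "sorted w" "word_monomial v = word_monomial w"
  shows "v = w"
proof -
  have "mset v = mset w"
    by (rule multiset_eqI) (metis lookup_word_monomial assms(3))
  then show ?thesis using assms by (metis properties_for_sort)
qed

text \<open>The indexing agrees with that of \<open>D\<close> in \<open>F_words\<close>. In a sorted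
  word the ascents are the boundaries between blocks of equal letters.\<close>

definition ascents :: "nat list \<Rightarrow> nat set" where
  "ascents w = {j. 1 \<le> j \<and> j < length w \<and> w ! (j - 1) < w ! j}"

lemma finite_ascents: "finite (ascents w)"
  by (simp add: ascents_def)

lemma rat_linear_qsym_coeff: "rat_linear (\<lambda>f. qsym_coeff f m)"
  by (simp add: rat_linear_iff plus_qsym.rep_eq scaleQ_qsym.rep_eq scaleQ_rat_def)

lemma coeff_F_word:
  assumes "sorted w" "D \<subseteq> {1..n - 1}"
  shows "qsym_coeff (qsym_F n D) (word_monomial w) = of_bool (length w = n \<and> D \<subseteq> ascents w)"
proof -
  have "{v \<in> F_words n D. word_monomial v = word_monomial w}
      = (if length w = n \<and> D \<subseteq> ascents w then {w} else {})"
  proof -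
    have "v = w" if "v \<in> F_words n D" "word_monomial v = word_monomial w" for v
      using that assms(1) by (intro word_monomial_inj) (auto simp: F_words_def)
    moreover have "w \<in> F_words n D \<longleftrightarrow> length w = n \<and> D \<subseteq> ascents w"
      using assms by (auto simp: F_words_def ascents_def subset_iff)
    ultimately show ?thesis by auto
  qed
  then show ?thesis by (simp add: qsym_F.rep_eq)
qed

text \<open>The power has one factor 2 for each block of equal letters. The empty permutation is
  separate because its peak function is 1, not 2.\<close>

definition K_word_coeff :: "nat list \<Rightarrow> nat list \<Rightarrow> rat" where
  "K_word_coeff w \<pi> = (if length w \<noteq> length \<pi> then 0 else if \<pi> = [] then 1
     else if Pk \<pi> \<subseteq> ascents w \<union> Suc ` ascents w then 2 ^ (card (ascents w) + 1) else 0)"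

lemma finite_Pk: "finite (Pk \<pi>)"
  by (simp add: Pk_def)

lemma Pk_no_consecutive: "i \<in> Pk \<pi> \<Longrightarrow> Suc i \<notin> Pk \<pi>"
  by (auto simp: Pk_def)

lemma Pk_ge_2: "i \<in> Pk \<pi> \<Longrightarrow> 2 \<le> i"
  by (simp add: Pk_def)

text \<open>A sorted word is determined by its monomial, so each fundamental function contributes 0
  or 1 and the coefficient counts the admissible \<open>D\<close> inside \<open>ascents w\<close>.
  There are 2^(|E| - |Pk|) of them or none, and the prefactor of \<open>qsym_K\<close> removes the
  dependence on the number of peaks.\<close>

lemma coeff_K_word:
  assumes "sorted w"
  shows "qsym_coeff (qsym_K (length \<pi>) (Pk \<pi>)) (word_monomial w) = K_word_coeff w \<pi>"
proof (cases "\<pi> = []")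
  case True
  have "word_monomial w = 0 \<longleftrightarrow> w = []"
    using keys_word_monomial[of w] by (auto simp: word_monomial_def)
  then show ?thesis using True by (simp add: qsym_K_def qsym_one.rep_eq K_word_coeff_def)
next
  case False
  let ?n = "length \<pi>" and ?P = "\<lambda>D. Pk \<pi> \<subseteq> (D - Suc ` D) \<union> (Suc ` D - D)"
  let ?E = "ascents w"
  have "qsym_coeff (qsym_K ?n (Pk \<pi>)) (word_monomial w)
      = 2 ^ (card (Pk \<pi>) + 1)
        * (\<Sum>D\<in>{D. D \<subseteq> {1..?n - 1} \<and> ?P D}. qsym_coeff (qsym_F ?n D) (word_monomial w))"
    using False by (simp add: qsym_K_def rat_linear_simps[OF rat_linear_qsym_coeff] scaleQ_rat_def)
  also have "\<dots> = 2 ^ (card (Pk \<pi>) + 1)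
        * (\<Sum>D\<in>{D. D \<subseteq> {1..?n - 1} \<and> ?P D}. of_bool (length w = ?n \<and> D \<subseteq> ?E))"
    using coeff_F_word[OF assms] by simp
  also have "\<dots> = K_word_coeff w \<pi>"
  proof (cases "length w = ?n")
    case True
    have E: "?E \<subseteq> {1..?n - 1}" using True by (auto simp: ascents_def)
    have fin: "finite {D. D \<subseteq> {1..?n - 1} \<and> ?P D}" by simp
    have "(\<Sum>D\<in>{D. D \<subseteq> {1..?n - 1} \<and> ?P D}. of_bool (length w = ?n \<and> D \<subseteq> ?E))
        = (of_nat (card {D. D \<subseteq> ?E \<and> ?P D}) :: rat)"
      using True E fin
      by (auto simp: sum_of_bool_eq Collect_conj_eq[symmetric] intro!: arg_cong[where f = card])
    moreover have "(2 ^ (card (Pk \<pi>) + 1) * of_nat (card {D. D \<subseteq> ?E \<and> ?P D}) :: rat)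
        = of_nat (2 * (2 ^ card (Pk \<pi>) * card {D. D \<subseteq> ?E \<and> ?P D}))"
      by simp
    moreover have "2 ^ card (Pk \<pi>) * card {D. D \<subseteq> ?E \<and> ?P D}
        = (if Pk \<pi> \<subseteq> ?E \<union> Suc ` ?E then 2 ^ card ?E else 0)"
      by (rule card_symdiff_Suc_subsets)
        (auto simp: finite_ascents finite_Pk Pk_no_consecutive dest: Pk_ge_2)
    ultimately show ?thesis using True False by (simp only: K_word_coeff_def) simp
  next
    case False
    then show ?thesis by (simp add: K_word_coeff_def)
  qed
  finally show ?thesis .
qed

section \<open>Factorisation of the coefficients over blocks\<close>

lemma ascents_replicate: "ascents (replicate a k) = {}"
  by (auto simp: ascents_def)

lemma ascents_replicate_append:
  assumes "0 < a" "w \<noteq> []" "\<forall>x\<in>set w. k < x"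
  shows "ascents (replicate a k @ w) = insert a ((+) a ` ascents w)"
proof (intro set_eqI iffI)
  fix j assume j: "j \<in> ascents (replicate a k @ w)"
  then have "a \<le> j" by (auto simp: ascents_def nth_append split: if_splits)
  moreover have "j - a \<in> ascents w" if "a < j"
    using j that by (auto simp: ascents_def nth_append diff_right_commute split: if_splits)
  ultimately show "j \<in> insert a ((+) a ` ascents w)"
    by (metis image_eqI insertCI le_add_diff_inverse le_neq_implies_less)
next
  fix j assume "j \<in> insert a ((+) a ` ascents w)"
  then show "j \<in> ascents (replicate a k @ w)"
    using assms by (auto simp: ascents_def nth_append Suc_le_eq)
qed

text \<open>The new ascent \<open>a\<close> admits peaks at \<open>a\<close> and
  \<open>a + 1\<close>, precisely the positions where a peak of \<pi> is lost when \<pi> is cut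
  after \<open>a\<close> letters. Every other peak survives in one of the two pieces and is tested
  there.\<close>

lemma K_word_coeff_replicate_append:
  assumes "\<forall>x\<in>set w. k < x"
  shows "K_word_coeff (replicate a k @ w) \<pi>
    = (if a \<le> length \<pi> then peakless_char (take a \<pi>) * K_word_coeff w (drop a \<pi>) else 0)"
proof (cases "0 < a \<and> length \<pi> = a + length w")
  case False
  \<comment> \<open>For \<open>a = 0\<close> the block contributes
    \<open>peakless_char [] = 1\<close>; otherwise the lengths do not match and both sides
    vanish.\<close>
  then show ?thesis by (cases "a = 0") (auto simp: K_word_coeff_def peakless_char_def)
next
  case True
  then have a: "0 < a" "\<pi> \<noteq> []" "a \<le> length \<pi>" "length \<pi> = a + length w" by auto
  show ?thesis
  proof (cases "w = []")
    case True
    then show ?thesis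
      using a by (simp add: K_word_coeff_def peakless_char_def ascents_replicate)
  next
    case False
    let ?E = "ascents w" and ?F = "ascents (replicate a k @ w)"
    have F: "?F = insert a ((+) a ` ?E)"
      by (rule ascents_replicate_append[OF a(1) False assms])
    have pos: "0 < x" if "x \<in> ?E" for x using that by (auto simp: ascents_def)
    have card: "card ?F = Suc (card ?E)"
      unfolding F using pos[of 0] by (subst card_insert_disjoint) (auto simp: finite_ascents card_image)
    have "Pk \<pi> \<subseteq> ?F \<union> Suc ` ?F \<longleftrightarrow> Pk (take a \<pi>) = {} \<and> Pk (drop a \<pi>) \<subseteq> ?E \<union> Suc ` ?E"
    proof -
      have memF: "j \<in> ?F \<union> Suc ` ?F \<longleftrightarrow> a \<le> j \<and> (j - a \<le> 1 \<or> j - a \<in> ?E \<union> Suc ` ?E)" for j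
      proof -
        have "j - a \<in> ?E \<longleftrightarrow> j \<in> (+) a ` ?E" if "a \<le> j"
          using that by (force simp: image_iff)
        moreover have "j - a \<in> Suc ` ?E \<longleftrightarrow> j \<in> Suc ` (+) a ` ?E" if "a \<le> j"
          using that by (force simp: image_iff)
        moreover have "j - a \<le> 1 \<longleftrightarrow> j = a \<or> j = Suc a" if "a \<le> j" using that by auto
        ultimately show ?thesis unfolding F by auto
      qed
      show ?thesis
        unfolding Pk_take[OF a(3)] Pk_drop
      proof (intro iffI conjI)
        assume L: "Pk \<pi> \<subseteq> ?F \<union> Suc ` ?F"
        show "{j \<in> Pk \<pi>. j < a} = {}"
          using subsetD[OF L] memF by (metis (no_types, lifting) Collect_empty_eq not_le)
        show "{j. 2 \<le> j \<and> a + j \<in> Pk \<pi>} \<subseteq> ?E \<union> Suc ` ?E"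
        proof
          fix j assume "j \<in> {j. 2 \<le> j \<and> a + j \<in> Pk \<pi>}"
          then show "j \<in> ?E \<union> Suc ` ?E" using subsetD[OF L, of "a + j"] memF[of "a + j"] by simp
        qed
      next
        assume R: "{j \<in> Pk \<pi>. j < a} = {} \<and> {j. 2 \<le> j \<and> a + j \<in> Pk \<pi>} \<subseteq> ?E \<union> Suc ` ?E"
        show "Pk \<pi> \<subseteq> ?F \<union> Suc ` ?F"
        proof
          fix j assume j: "j \<in> Pk \<pi>"
          then have "a \<le> j" using R by force
          moreover have "j - a \<in> ?E \<union> Suc ` ?E" if "\<not> j - a \<le> 1"
            using subsetD[OF conjunct2[OF R], of "j - a"] j that \<open>a \<le> j\<close> by simp
          ultimately show "j \<in> ?F \<union> Suc ` ?F" unfolding memF by blast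
        qed
      qed
    qed
    then show ?thesis
      using a False by (simp add: K_word_coeff_def peakless_char_def card)
  qed
qed

text \<open>Zero entries are allowed and contribute a factor 1; they arise when exponents are
  distributed over the two factors of a product.\<close>

fun comp_coeff :: "nat list \<Rightarrow> nat list \<Rightarrow> rat" where
  "comp_coeff [] \<pi> = of_bool (\<pi> = [])"
| "comp_coeff (a # as) \<pi>
     = (if a \<le> length \<pi> then peakless_char (take a \<pi>) * comp_coeff as (drop a \<pi>) else 0)"

fun comp_word :: "nat \<Rightarrow> nat list \<Rightarrow> nat list" where
  "comp_word k [] = []"
| "comp_word k (a # as) = replicate a k @ comp_word (Suc k) as"

lemma set_comp_word: "x \<in> set (comp_word k as) \<Longrightarrow> k \<le> x"
  by (induction as arbitrary: k) fastforce+

lemma sorted_comp_word: "sorted (comp_word k as)"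
  by (induction as arbitrary: k) (auto simp: sorted_append dest: set_comp_word)

lemma K_word_coeff_comp_word: "K_word_coeff (comp_word k as) \<pi> = comp_coeff as \<pi>"
proof (induction as arbitrary: k \<pi>)
  case (Cons a as)
  have "\<forall>x\<in>set (comp_word (Suc k) as). k < x"
    using set_comp_word[of _ "Suc k" as] by (auto simp: Suc_le_eq)
  then show ?case using Cons by (simp add: K_word_coeff_replicate_append)
qed (simp add: K_word_coeff_def)

lemma word_monomial_append: "word_monomial (v @ w) = word_monomial v + word_monomial w"
  by (simp add: word_monomial_def)

lemma word_monomial_replicate: "word_monomial (replicate a k) = Poly_Mapping.single k a"
  by (rule poly_mapping_eqI) (simp add: lookup_word_monomial lookup_single when_def)

lemma word_monomial_comp_word:
  "word_monomial (comp_word k as) = (\<Sum>i<length as. Poly_Mapping.single (k + i) (as ! i))"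
proof (induction as arbitrary: k)
  case (Cons a as)
  then show ?case
    by (simp add: word_monomial_append word_monomial_replicate sum.lessThan_Suc_shift
        del: sum.lessThan_Suc)
qed (simp add: word_monomial_def)

lemma coeff_K_packed: "qsym_coeff (qsym_K (length \<pi>) (Pk \<pi>)) (packed as) = comp_coeff as \<pi>"
  using coeff_K_word[OF sorted_comp_word, of \<pi> 0 as]
  by (simp add: K_word_coeff_comp_word word_monomial_comp_word packed_def)

section \<open>Products and coproducts of the peak functions\<close>

lemma qsym_coeff_packed_exponents: "qsym_coeff f (packed (exponents m)) = qsym_coeff f m"
proof -
  have "quasisymmetric (qsym_coeff f)" using qsym_coeff by auto
  moreover have "exponents (packed (exponents m)) = exponents m"
    by (rule exponents_packed[OF zero_notin_exponents])
  ultimately show ?thesis unfolding quasisymmetric_def by blast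
qed

lemma qsym_eqI:
  assumes "\<And>\<alpha>. 0 \<notin> set \<alpha> \<Longrightarrow> qsym_coeff f (packed \<alpha>) = qsym_coeff g (packed \<alpha>)"
  shows "f = g"
proof -
  have "qsym_coeff f m = qsym_coeff g m" for m
    using assms[OF zero_notin_exponents[of m]] by (simp add: qsym_coeff_packed_exponents)
  then show ?thesis by (simp add: qsym_coeff_inject[symmetric] ext)
qed

text \<open>Keeping zeros aligns both lists with the same variables, so products of quasisymmetric
  functions can be handled without overlapping shuffles of compositions.\<close>

definition comp_splits :: "nat list \<Rightarrow> (nat list \<times> nat list) set" where
  "comp_splits as = {(bs, cs). length bs = length cs \<and> map2 (+) bs cs = as}"

lemma comp_splits_Nil: "comp_splits [] = {([], [])}"
  by (auto simp: comp_splits_def)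

lemma sum_comp_splits_Cons:
  "(\<Sum>(bs, cs)\<in>comp_splits (a # as). g bs cs)
    = (\<Sum>b\<le>a. \<Sum>(bs, cs)\<in>comp_splits as. g (b # bs) ((a - b) # cs))"
proof -
  have Cons: "\<exists>b bs' cs'. b \<le> a \<and> bs = b # bs' \<and> cs = (a - b) # cs' \<and> (bs', cs') \<in> comp_splits as"
    if "(bs, cs) \<in> comp_splits (a # as)" for bs cs
    using that by (cases bs; cases cs) (auto simp: comp_splits_def)
  have "(\<Sum>(bs, cs)\<in>comp_splits (a # as). g bs cs)
    = (\<Sum>(b, (bs, cs))\<in>{..a} \<times> comp_splits as. g (b # bs) ((a - b) # cs))"
    by (rule sum.reindex_bij_witness[where j = "\<lambda>(bs, cs). (hd bs, (tl bs, tl cs))"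
          and i = "\<lambda>(b, (bs, cs)). (b # bs, (a - b) # cs)"])
      (auto dest!: Cons, auto simp: comp_splits_def)
  then show ?thesis by (simp add: sum.cartesian_product)
qed

lemma coeff_times_packed:
  "qsym_coeff (qsym_times f g) (packed as)
    = (\<Sum>(bs, cs)\<in>comp_splits as. qsym_coeff f (packed bs) * qsym_coeff g (packed cs))"
proof -
  \<comment> \<open>The exponent list of a divisor of \<open>packed as\<close>, with zeros kept;
    such a divisor involves only the first \<open>length as\<close> variables.\<close>
  let ?l = "\<lambda>u. map (Poly_Mapping.lookup u) [0..<length as]"
  have packed_l: "packed (?l u) = u" "packed (?l v) = v" if "u + v = packed as" for u v
  proof -
    have "Poly_Mapping.lookup u i + Poly_Mapping.lookup v i = 0" if "\<not> i < length as" for i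
      using that \<open>u + v = packed as\<close> by (simp add: lookup_packed flip: lookup_add)
    then show "packed (?l u) = u" "packed (?l v) = v"
      by (auto intro!: poly_mapping_eqI simp: lookup_packed)
  qed
  have "(\<Sum>(u, v)\<in>{(u, v). u + v = packed as}. qsym_coeff f u * qsym_coeff g v)
      = (\<Sum>(bs, cs)\<in>comp_splits as. qsym_coeff f (packed bs) * qsym_coeff g (packed cs))"
  proof (rule sum.reindex_bij_witness[where j = "\<lambda>(u, v). (?l u, ?l v)"
        and i = "\<lambda>(bs, cs). (packed bs, packed cs)"])
    fix p assume "p \<in> {(u, v). u + v = packed as}"
    then obtain u v where p: "p = (u, v)" "u + v = packed as" by auto
    have "Poly_Mapping.lookup u i + Poly_Mapping.lookup v i = as ! i" if "i < length as" for i
      using that p by (simp add: lookup_packed flip: lookup_add)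
    then show "(case p of (u, v) \<Rightarrow> (?l u, ?l v)) \<in> comp_splits as"
      by (auto simp: p comp_splits_def intro: nth_equalityI)
    show "(case (case p of (u, v) \<Rightarrow> (?l u, ?l v)) of (bs, cs) \<Rightarrow> (packed bs, packed cs)) = p"
      "(case (case p of (u, v) \<Rightarrow> (?l u, ?l v)) of (bs, cs) \<Rightarrow>
          qsym_coeff f (packed bs) * qsym_coeff g (packed cs))
        = (case p of (u, v) \<Rightarrow> qsym_coeff f u * qsym_coeff g v)"
      using packed_l[OF p(2)] by (simp_all add: p)
  next
    fix p assume "p \<in> comp_splits as"
    then obtain bs cs where p: "p = (bs, cs)" "length bs = length cs" "map2 (+) bs cs = as"
      by (auto simp: comp_splits_def)
    have len: "length as = length cs" using p by auto
    show "(case p of (bs, cs) \<Rightarrow> (packed bs, packed cs)) \<in> {(u, v). u + v = packed as}"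
      using p(2) by (auto intro!: poly_mapping_eqI simp: p(1) p(3)[symmetric] lookup_packed lookup_add)
    show "(case (case p of (bs, cs) \<Rightarrow> (packed bs, packed cs)) of (u, v) \<Rightarrow> (?l u, ?l v)) = p"
      using p(2) len by (auto simp: p(1) lookup_packed intro!: nth_equalityI)
  qed
  then show ?thesis by (simp add: qsym_times.rep_eq series_times_def)
qed

lemma shuffle_sum_zero: "shuffle_sum (\<lambda>_. 0) xs ys = 0"
  by (induction xs ys rule: shuffles.induct) simp_all

text \<open>Building the length into the character turns \<open>comp_coeff\<close> into an iterated
  convolution, to which \<open>shuffle_sum_deconcat\<close> applies.\<close>

definition graded_char :: "nat \<Rightarrow> nat list \<Rightarrow> rat" where
  "graded_char a t = of_bool (length t = a) * peakless_char t"

lemma comp_coeff_Cons_deconcat: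
  "comp_coeff (a # as) t = (\<Sum>k\<le>length t. graded_char a (take k t) * comp_coeff as (drop k t))"
proof -
  have "(\<Sum>k\<le>length t. graded_char a (take k t) * comp_coeff as (drop k t))
      = (\<Sum>k\<le>length t. if k = a then peakless_char (take k t) * comp_coeff as (drop k t) else 0)"
    by (intro sum.cong) (auto simp: graded_char_def)
  then show ?thesis by simp
qed

lemma shuffle_sum_graded_char:
  assumes "distinct xs" "distinct ys" "set xs \<inter> set ys = {}"
  shows "shuffle_sum (graded_char a) xs ys = (\<Sum>b\<le>a. graded_char b xs * graded_char (a - b) ys)"
proof -
  have "shuffle_sum (graded_char a) xs ys
      = shuffle_sum (\<lambda>t. of_bool (length xs + length ys = a) * peakless_char t) xs ys"
    by (rule shuffle_sum_cong) (simp add: graded_char_def length_shuffles)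
  also have "\<dots> = of_bool (length xs + length ys = a) * (peakless_char xs * peakless_char ys)"
    unfolding shuffle_sum_peakless_char[OF assms, symmetric]
    by (rule additive_shuffle_sum[symmetric]) (rule distrib_left)
  also have "\<dots> = (\<Sum>b\<le>a. if b = length xs then peakless_char xs * graded_char (a - b) ys else 0)"
    by (auto simp: graded_char_def)
  also have "\<dots> = (\<Sum>b\<le>a. graded_char b xs * graded_char (a - b) ys)"
    by (intro sum.cong) (auto simp: graded_char_def)
  finally show ?thesis .
qed

lemma sum_swap_pairs:
  "(\<Sum>i\<in>A. \<Sum>j\<in>B. \<Sum>k\<in>C. \<Sum>l\<in>D. f i j k l) = (\<Sum>k\<in>C. \<Sum>l\<in>D. \<Sum>i\<in>A. \<Sum>j\<in>B. f i j k l)"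
proof -
  have "(\<Sum>i\<in>A. \<Sum>j\<in>B. \<Sum>k\<in>C. \<Sum>l\<in>D. f i j k l) = (\<Sum>i\<in>A. \<Sum>k\<in>C. \<Sum>j\<in>B. \<Sum>l\<in>D. f i j k l)"
    by (intro sum.cong refl sum.swap)
  also have "\<dots> = (\<Sum>k\<in>C. \<Sum>i\<in>A. \<Sum>j\<in>B. \<Sum>l\<in>D. f i j k l)"
    by (rule sum.swap)
  also have "\<dots> = (\<Sum>k\<in>C. \<Sum>i\<in>A. \<Sum>l\<in>D. \<Sum>j\<in>B. f i j k l)"
    by (intro sum.cong refl sum.swap)
  also have "\<dots> = (\<Sum>k\<in>C. \<Sum>l\<in>D. \<Sum>i\<in>A. \<Sum>j\<in>B. f i j k l)"
    by (intro sum.cong refl sum.swap)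
  finally show ?thesis .
qed

text \<open>Peeling off the first exponent leaves suffixes of both words, so the induction ranges
  over all disjoint pairs. At each step the exponent \<open>a\<close> is shared out as
  \<open>b\<close> and \<open>a - b\<close>, just as in a product of series.\<close>

lemma shuffle_sum_comp_coeff:
  assumes "distinct xs" "distinct ys" "set xs \<inter> set ys = {}"
  shows "shuffle_sum (comp_coeff as) xs ys
    = (\<Sum>(bs, cs)\<in>comp_splits as. comp_coeff bs xs * comp_coeff cs ys)"
  using assms
proof (induction as arbitrary: xs ys)
  case Nil
  then show ?case
    by (cases xs; cases ys) (simp_all add: comp_splits_Nil shuffle_sum_zero)
next
  case (Cons a as)
  have "shuffle_sum (comp_coeff (a # as)) xs ys
    = shuffle_sum (\<lambda>t. \<Sum>k\<le>length t. graded_char a (take k t) * comp_coeff as (drop k t)) xs ys"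
    by (rule shuffle_sum_cong) (rule comp_coeff_Cons_deconcat)
  also have "\<dots> = (\<Sum>i\<le>length xs. \<Sum>j\<le>length ys.
      shuffle_sum (graded_char a) (take i xs) (take j ys)
      * shuffle_sum (comp_coeff as) (drop i xs) (drop j ys))"
    unfolding shuffle_sum_deconcat[of "\<lambda>s t. graded_char a s * comp_coeff as t"] shuffle_sum_product ..
  also have "\<dots> = (\<Sum>i\<le>length xs. \<Sum>j\<le>length ys.
      (\<Sum>b\<le>a. graded_char b (take i xs) * graded_char (a - b) (take j ys))
      * (\<Sum>(bs, cs)\<in>comp_splits as. comp_coeff bs (drop i xs) * comp_coeff cs (drop j ys)))"
    using Cons.prems by (simp add: shuffle_sum_graded_char Cons.IH disjoint_take_drop)
  also have "\<dots> = (\<Sum>i\<le>length xs. \<Sum>j\<le>length ys. \<Sum>b\<le>a. \<Sum>p\<in>comp_splits as.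
      (graded_char b (take i xs) * comp_coeff (fst p) (drop i xs))
      * (graded_char (a - b) (take j ys) * comp_coeff (snd p) (drop j ys)))"
    by (simp add: sum_product case_prod_unfold mult_ac)
  also have "\<dots> = (\<Sum>b\<le>a. \<Sum>p\<in>comp_splits as. \<Sum>i\<le>length xs. \<Sum>j\<le>length ys.
      (graded_char b (take i xs) * comp_coeff (fst p) (drop i xs))
      * (graded_char (a - b) (take j ys) * comp_coeff (snd p) (drop j ys)))"
    by (rule sum_swap_pairs)
  also have "\<dots> = (\<Sum>b\<le>a. \<Sum>p\<in>comp_splits as.
      comp_coeff (b # fst p) xs * comp_coeff ((a - b) # snd p) ys)"
    by (simp only: comp_coeff_Cons_deconcat sum_product)
  finally show ?case unfolding sum_comp_splits_Cons by (simp only: case_prod_unfold)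
qed

abbreviation K_perm :: "nat list \<Rightarrow> qsym" where
  "K_perm \<pi> \<equiv> qsym_K (length \<pi>) (Pk \<pi>)"

lemma qsym_times_K:
  assumes "distinct \<pi>" "distinct \<sigma>" "set \<pi> \<inter> set \<sigma> = {}"
  shows "qsym_times (K_perm \<pi>) (K_perm \<sigma>) = (\<Sum>\<tau>\<in>shuffles \<pi> \<sigma>. K_perm \<tau>)"
  by (rule qsym_eqI)
    (simp only: coeff_times_packed coeff_K_packed rat_linear_simps(5)[OF rat_linear_qsym_coeff],
      simp add: sum_shuffles[OF assms] shuffle_sum_comp_coeff[OF assms])

section \<open>Coproducts of peak functions\<close>

lemma comp_coeff_eq_0: "sum_list as \<noteq> length \<pi> \<Longrightarrow> comp_coeff as \<pi> = 0"
  by (induction as arbitrary: \<pi>) auto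

lemma comp_coeff_append:
  "comp_coeff (as @ bs) \<pi> = (if sum_list as \<le> length \<pi>
     then comp_coeff as (take (sum_list as) \<pi>) * comp_coeff bs (drop (sum_list as) \<pi>) else 0)"
proof (induction as arbitrary: \<pi>)
  case (Cons a as)
  show ?case
    by (auto simp: Cons.IH drop_take min_def add_ac)
qed simp

text \<open>Only the cut at \<open>sum_list as\<close> contributes; summing over all cuts matches
  the form of the coproduct.\<close>

lemma comp_coeff_append_deconcat:
  "comp_coeff (as @ bs) \<pi> = (\<Sum>k\<le>length \<pi>. comp_coeff as (take k \<pi>) * comp_coeff bs (drop k \<pi>))"
proof -
  have "(\<Sum>k\<le>length \<pi>. comp_coeff as (take k \<pi>) * comp_coeff bs (drop k \<pi>))
      = (\<Sum>k\<le>length \<pi>. if k = sum_list as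
          then comp_coeff as (take k \<pi>) * comp_coeff bs (drop k \<pi>) else 0)"
    by (intro sum.cong) (auto intro: comp_coeff_eq_0)
  then show ?thesis by (simp add: comp_coeff_append)
qed

text \<open>Bounding the weight instead of fixing it gives one finite index set for a permutation
  and all its prefixes and suffixes.\<close>

definition comps_upto :: "nat \<Rightarrow> nat list set" where
  "comps_upto N = {\<alpha>. 0 \<notin> set \<alpha> \<and> sum_list \<alpha> \<le> N}"

lemma finite_comps_upto: "finite (comps_upto N)"
proof -
  have "length \<alpha> \<le> sum_list \<alpha>" if "0 \<notin> set \<alpha>" for \<alpha> :: "nat list"
    using that by (induction \<alpha>) auto
  then have "comps_upto N \<subseteq> {\<alpha>. set \<alpha> \<subseteq> {..N} \<and> length \<alpha> \<le> N}"
    by (fastforce simp: comps_upto_def dest: member_le_sum_list)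
  then show ?thesis by (rule finite_subset) (simp add: finite_lists_length_le)
qed

lemma K_expansion:
  assumes "length \<pi> \<le> N"
  shows "K_perm \<pi> = (\<Sum>\<alpha>\<in>comps_upto N. comp_coeff \<alpha> \<pi> *\<^sub>Q qsym_M \<alpha>)"
proof (rule qsym_eqI)
  fix \<beta> :: "nat list" assume \<beta>: "0 \<notin> set \<beta>"
  have "qsym_coeff (\<Sum>\<alpha>\<in>comps_upto N. comp_coeff \<alpha> \<pi> *\<^sub>Q qsym_M \<alpha>) (packed \<beta>)
      = (\<Sum>\<alpha>\<in>comps_upto N. if \<alpha> = \<beta> then comp_coeff \<alpha> \<pi> else 0)"
    unfolding rat_linear_simps[OF rat_linear_qsym_coeff]
    by (intro sum.cong refl) (auto simp: qsym_M.rep_eq exponents_packed[OF \<beta>] scaleQ_rat_def)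
  also have "\<dots> = comp_coeff \<beta> \<pi>"
    unfolding sum.delta[OF finite_comps_upto]
    using \<beta> assms by (auto simp: comps_upto_def comp_coeff_eq_0)
  finally show "qsym_coeff (K_perm \<pi>) (packed \<beta>)
      = qsym_coeff (\<Sum>\<alpha>\<in>comps_upto N. comp_coeff \<alpha> \<pi> *\<^sub>Q qsym_M \<alpha>) (packed \<beta>)"
    by (simp add: coeff_K_packed)
qed

lemma pure_tensor_sum:
  "(\<Sum>a\<in>A. f a *\<^sub>Q x a) \<otimes> (\<Sum>b\<in>B. g b *\<^sub>Q y b) = (\<Sum>a\<in>A. \<Sum>b\<in>B. (f a * g b) *\<^sub>Q (x a \<otimes> y b))"
  by (subst sum.swap) (simp add: mult.commute rat_linear_simps[OF rat_bilinearD(1)[OF rat_bilinear_pure_tensor]]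
      rat_linear_simps[OF rat_bilinearD(2)[OF rat_bilinear_pure_tensor]]
      ratv.scale_sum_right scaleQ_scaleQ)

lemma qsym_comult_K:
  "qsym_comult (K_perm \<pi>) = (\<Sum>k\<le>length \<pi>. K_perm (take k \<pi>) \<otimes> K_perm (drop k \<pi>))"
proof -
  let ?C = "comps_upto (length \<pi>)"
  let ?M = "\<lambda>\<beta> \<gamma>. comp_coeff (\<beta> @ \<gamma>) \<pi> *\<^sub>Q (qsym_M \<beta> \<otimes> qsym_M \<gamma>)"
  have "qsym_comult (K_perm \<pi>)
      = (\<Sum>\<alpha>\<in>?C. comp_coeff \<alpha> \<pi> *\<^sub>Q (\<Sum>i\<le>length \<alpha>. qsym_M (take i \<alpha>) \<otimes> qsym_M (drop i \<alpha>)))"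
    unfolding qsym_comult_def coeff_K_packed
    by (rule sum.mono_neutral_left[OF finite_comps_upto])
      (auto simp: comps_upto_def intro: ccontr[of "_ \<le> _"] comp_coeff_eq_0)
  also have "\<dots> = (\<Sum>(\<alpha>, i)\<in>(SIGMA \<alpha>:?C. {..length \<alpha>}). ?M (take i \<alpha>) (drop i \<alpha>))"
    by (simp add: ratv.scale_sum_right sum.Sigma finite_comps_upto)
  also have "\<dots> = (\<Sum>(\<beta>, \<gamma>)\<in>{(\<beta>, \<gamma>). \<beta> @ \<gamma> \<in> ?C}. ?M \<beta> \<gamma>)"
    by (rule sum.reindex_bij_witness[where j = "\<lambda>(\<alpha>, i). (take i \<alpha>, drop i \<alpha>)"
          and i = "\<lambda>(\<beta>, \<gamma>). (\<beta> @ \<gamma>, length \<beta>)"]) auto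
  \<comment> \<open>The pairs that are added have total weight above \<open>length \<pi>\<close>, so
    their coefficient is 0.\<close>
  also have "\<dots> = (\<Sum>(\<beta>, \<gamma>)\<in>?C \<times> ?C. ?M \<beta> \<gamma>)"
    by (rule sum.mono_neutral_left[OF finite_cartesian_product[OF finite_comps_upto finite_comps_upto]])
      (auto simp: comps_upto_def, metis comp_coeff_eq_0 order_refl sum_list_append)
  also have "\<dots> = (\<Sum>\<beta>\<in>?C. \<Sum>\<gamma>\<in>?C. \<Sum>k\<le>length \<pi>.
      (comp_coeff \<beta> (take k \<pi>) * comp_coeff \<gamma> (drop k \<pi>)) *\<^sub>Q (qsym_M \<beta> \<otimes> qsym_M \<gamma>))"
    by (simp add: comp_coeff_append_deconcat ratv.scale_sum_left flip: sum.cartesian_product)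
  also have "\<dots> = (\<Sum>k\<le>length \<pi>. \<Sum>\<beta>\<in>?C. \<Sum>\<gamma>\<in>?C.
      (comp_coeff \<beta> (take k \<pi>) * comp_coeff \<gamma> (drop k \<pi>)) *\<^sub>Q (qsym_M \<beta> \<otimes> qsym_M \<gamma>))"
    by (simp only: sum.swap[of _ "{..length \<pi>}"])
  also have "\<dots> = (\<Sum>k\<le>length \<pi>. K_perm (take k \<pi>) \<otimes> K_perm (drop k \<pi>))"
    by (intro sum.cong refl)
      (simp only: pure_tensor_sum[symmetric], subst (1 2) K_expansion[of _ "length \<pi>"], simp_all)
  finally show ?thesis .
qed

section \<open>Associativity and bilinearity of the product of series\<close>

lemma series_times_assoc:
  "series_times (series_times f g) h m = series_times f (series_times g h) m"
proof -
  let ?D = "\<lambda>m. {(a, b). a + b = (m :: nat \<Rightarrow>\<^sub>0 nat)}"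
  have fin: "finite {p. fst p + snd p = m}" for m :: "nat \<Rightarrow>\<^sub>0 nat"
    using finite_decompositions[of m] by (simp add: case_prod_unfold)
  have "series_times (series_times f g) h m
      = (\<Sum>(p, q)\<in>(SIGMA p:?D m. ?D (fst p)). f (fst q) * g (snd q) * h (snd p))"
    unfolding series_times_def
    by (subst sum.Sigma[symmetric])
      (auto simp: fin case_prod_unfold sum_distrib_right)
  also have "\<dots> = (\<Sum>(p, q)\<in>(SIGMA p:?D m. ?D (snd p)). f (fst p) * (g (fst q) * h (snd q)))"
    by (rule sum.reindex_bij_witness[where
          j = "\<lambda>((s, c), (a, b)). ((a, b + c), (b, c))" and
          i = "\<lambda>((a, s), (b, c)). ((a + b, c), (a, b))"])
      (auto simp: add_ac)
  also have "\<dots> = series_times f (series_times g h) m"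
    unfolding series_times_def
    by (subst sum.Sigma[symmetric])
      (auto simp: fin case_prod_unfold sum_distrib_left)
  finally show ?thesis .
qed

lemma qsym_times_assoc: "qsym_times (qsym_times f g) h = qsym_times f (qsym_times g h)"
  by transfer (rule ext, rule series_times_assoc)

lemma rat_bilinear_qsym_times: "rat_bilinear qsym_times"
  by (intro rat_bilinearI rat_linearI; transfer; rule ext)
    (simp_all add: series_times_def case_prod_unfold sum.distrib sum_distrib_left algebra_simps)

section \<open>Linear independence of the peak functions\<close>

lemma ex_word_with_ascents:
  assumes "E \<subseteq> {1..<n}"
  shows "\<exists>w. sorted w \<and> length w = n \<and> ascents w = E"
proof (intro exI conjI)
  \<comment> \<open>Each letter counts the elements of \<open>E\<close> up to its position, so the
    word rises exactly at the elements of \<open>E\<close>.\<close>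
  let ?w = "map (\<lambda>j. card (E \<inter> {..j})) [0..<n]"
  show "sorted ?w"
    by (auto simp: sorted_iff_nth_mono intro!: card_mono)
  have step: "card (E \<inter> {..j - 1}) < card (E \<inter> {..j}) \<longleftrightarrow> j \<in> E" if "1 \<le> j" for j
  proof (cases "j \<in> E")
    case True
    have "E \<inter> {..j} = insert j (E \<inter> {..j - 1})" using True that by auto
    moreover have "j \<notin> E \<inter> {..j - 1}" using that by auto
    ultimately show ?thesis using True by simp
  next
    case False
    have "E \<inter> {..j} = E \<inter> {..j - 1}"
    proof (intro set_eqI iffI)
      fix x assume "x \<in> E \<inter> {..j}"
      then have "x \<in> E" "x < j" using False by (auto simp: le_less)
      then show "x \<in> E \<inter> {..j - 1}" by auto
    qed auto
    then show ?thesis using False by simp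
  qed
  have "j \<in> ascents ?w \<longleftrightarrow> 1 \<le> j \<and> j < n \<and> j \<in> E" for j
    using step[of j] by (cases "1 \<le> j \<and> j < n") (auto simp: ascents_def)
  then show "ascents ?w = E" using assms by auto
qed simp

text \<open>Moving each element of \<open>B\<close> to itself or its successor in \<open>A\<close>
  is injective, since \<open>B\<close> has no consecutive elements, and never lowers the sum. Either
  some element moves, or \<open>A\<close> has an additional, positive element. In the application
  \<open>A\<close> and \<open>B\<close> are peak sets.\<close>

lemma sum_less_of_shifted_subset:
  fixes A B :: "nat set"
  assumes "finite A" "0 \<notin> A" "\<forall>i\<in>B. Suc i \<notin> B" "\<forall>i\<in>B. i \<in> A \<or> Suc i \<in> A" "A \<noteq> B"
  shows "\<Sum>B < \<Sum>A"
proof -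
  define h where "h x = (if x \<in> A then x else Suc x)" for x
  have inj: "inj_on h B"
    using assms(3) by (auto simp: inj_on_def h_def split: if_splits)
  have sub: "h ` B \<subseteq> A" using assms(4) by (auto simp: h_def)
  have fin: "finite B" using sub inj assms(1) by (metis finite_imageD finite_subset)
  have le': "\<Sum>(h ` B) \<le> \<Sum>A"
    by (rule sum_mono2) (use assms(1) sub in auto)
  show ?thesis
  proof (cases "B \<subseteq> A")
    case True
    then obtain a where "a \<in> A - B" using assms(5) by auto
    then show ?thesis using True assms(1,2) by (intro sum_strict_mono2[of A B a]) (auto intro: gr0I)
  next
    case False
    then obtain b where "b \<in> B" "b \<notin> A" by blast
    then have "\<Sum>B < \<Sum>(h ` B)"
      unfolding sum.reindex[OF inj] using fin \<open>b \<in> B\<close> \<open>b \<notin> A\<close>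
      by (intro sum_strict_mono_ex1) (auto simp: h_def)
    then show ?thesis using le' by linarith
  qed
qed

lemma rat_linear_peak_incl: "rat_linear peak_incl"
  by (rule rat_linearI) (simp_all add: plus_peak_fun.rep_eq scaleQ_peak_fun.rep_eq)

lemma inj_peak_incl: "inj peak_incl"
  by (simp add: inj_def peak_incl_inject)

text \<open>The composite with the inclusion lets the operations of \<open>QSym\<close> be applied
  directly, without \<open>inv peak_incl\<close>.\<close>

definition pk_to_qsym :: "(pk_class \<Rightarrow>\<^sub>0 rat) \<Rightarrow> qsym" where
  "pk_to_qsym p = peak_incl (pk_to_peak p)"

lemma rat_linear_pk_to_peak: "rat_linear pk_to_peak"
  unfolding pk_to_peak_def by (rule rat_linear_lin_ext)

lemma rat_linear_pk_to_qsym: "rat_linear pk_to_qsym"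
  unfolding pk_to_qsym_def by (rule rat_linear_compose[OF rat_linear_pk_to_peak rat_linear_peak_incl])

lemma pk_to_qsym_basis: "permutation \<pi> \<Longrightarrow> pk_to_qsym (pk_basis \<pi>) = K_perm \<pi>"
  by (simp add: pk_to_qsym_def pk_to_peak_basis)

lemma pk_basis_ext:
  assumes "rat_linear g" "rat_linear h" "\<And>\<pi>. permutation \<pi> \<Longrightarrow> g (pk_basis \<pi>) = h (pk_basis \<pi>)"
  shows "g x = h x"
proof (rule poly_mapping_linear_ext[OF assms(1,2)])
  fix c
  obtain \<pi> where "permutation \<pi>" "pk_class \<pi> = c" using ex_pk_class by blast
  then show "g (Poly_Mapping.single c 1) = h (Poly_Mapping.single c 1)"
    using assms(3)[of \<pi>] by (simp add: pk_basis_def)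
qed

text \<open>The coefficient at a monomial whose ascents are \<open>{i - 1 | i \<in> Pk \<pi>}\<close> vanishes for all peak
  functions of other permutations \<open>\<sigma>\<close>, except when the sum of \<open>Pk \<sigma>\<close> is smaller than that of
  \<open>Pk \<pi>\<close>. Thus a nontrivial relation fails at a member with the least sum.\<close>

lemma inj_pk_to_qsym: "inj pk_to_qsym"
proof -
  have "p = 0" if p: "pk_to_qsym p = 0" for p
  proof (rule ccontr)
    assume "p \<noteq> 0"
    then have ne: "\<exists>c. c \<in> Poly_Mapping.keys p" by (metis all_not_in_conv keys_eq_empty)
    obtain r where r: "\<And>c. permutation (r c)" "\<And>c. pk_class (r c) = c"
      using ex_pk_class by metis
    obtain c where c: "c \<in> Poly_Mapping.keys p"
      and least: "\<And>d. d \<in> Poly_Mapping.keys p \<Longrightarrow> \<Sum>(Pk (r c)) \<le> \<Sum>(Pk (r d))"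
      using ex_has_least_nat[of "\<lambda>c. c \<in> Poly_Mapping.keys p" _ "\<lambda>c. \<Sum>(Pk (r c))"] ne by blast
    let ?E = "{i. Suc i \<in> Pk (r c)}"
    have "?E \<subseteq> {1..<length (r c)}" by (auto simp: Pk_def)
    then obtain w where w: "sorted w" "length w = length (r c)" "ascents w = ?E"
      using ex_word_with_ascents by blast
    have "x \<in> Suc ` ?E" if "x \<in> Pk (r c)" for x
      using that Pk_ge_2[OF that] by (intro image_eqI[of _ _ "x - 1"]) auto
    then have SucE: "Suc ` ?E = Pk (r c)" by auto
    have zero: "K_word_coeff w (r d) = 0" if d: "d \<in> Poly_Mapping.keys p" "d \<noteq> c" for d
    proof (rule ccontr)
      assume nz: "K_word_coeff w (r d) \<noteq> 0"
      then have len: "length (r d) = length (r c)"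
        using w by (auto simp: K_word_coeff_def split: if_splits)
      then have neq: "Pk (r c) \<noteq> Pk (r d)" using d(2) r pk_class_eq_iff by metis
      \<comment> \<open>As \<open>w\<close> rises exactly one position before each peak of
        \<open>r c\<close>, a nonzero coefficient places every peak of \<open>r d\<close> at or just
        before a peak of \<open>r c\<close>.\<close>
      have "Pk (r d) \<subseteq> ?E \<union> Pk (r c)"
        using nz w(3) SucE Pk_short[of "r d"] by (auto simp: K_word_coeff_def split: if_splits)
      then have "\<Sum>(Pk (r d)) < \<Sum>(Pk (r c))"
        using neq Pk_no_consecutive Pk_ge_2[of 0 "r c"]
        by (intro sum_less_of_shifted_subset) (auto simp: finite_Pk)
      then show False using least[OF d(1)] by simp
    qed
    have "pk_to_qsym p = lin_ext (\<lambda>d. K_perm (r d)) p"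
      by (subst lin_ext_cong_single[OF rat_linear_pk_to_qsym])
        (metis pk_to_qsym_basis r pk_basis_def)
    then have "0 = qsym_coeff (\<Sum>d\<in>Poly_Mapping.keys p. Poly_Mapping.lookup p d *\<^sub>Q K_perm (r d))
        (word_monomial w)"
      using p by (simp add: lin_ext_def zero_qsym.rep_eq)
    also have "\<dots> = (\<Sum>d\<in>Poly_Mapping.keys p. Poly_Mapping.lookup p d * K_word_coeff w (r d))"
      by (simp only: rat_linear_simps(2,5)[OF rat_linear_qsym_coeff] coeff_K_word[OF w(1)] scaleQ_rat_def)
    also have "\<dots> = Poly_Mapping.lookup p c * K_word_coeff w (r c)"
      using c zero by (simp add: sum.remove[OF finite_keys c])
    finally have "K_word_coeff w (r c) = 0" using c by (simp add: in_keys_iff)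
    moreover have "Pk (r c) \<subseteq> ascents w \<union> Suc ` ascents w"
      unfolding w(3) SucE by blast
    ultimately show False using w(2) by (simp add: K_word_coeff_def split: if_splits)
  qed
  then show ?thesis
    using rat_linear_simps(4)[OF rat_linear_pk_to_qsym] by (intro injI) (metis right_minus_eq)
qed

section \<open>The Hopf algebra of peak classes\<close>

lemma permutation_take: "permutation \<pi> \<Longrightarrow> permutation (take i \<pi>)"
  by (auto simp: permutation_def dest: in_set_takeD)

lemma permutation_drop: "permutation \<pi> \<Longrightarrow> permutation (drop i \<pi>)"
  by (auto simp: permutation_def dest: in_set_dropD)

lemma permutation_rev: "permutation \<pi> \<Longrightarrow> permutation (rev \<pi>)"
  by (simp add: permutation_def)

lemma permutation_shuffles:
  assumes "permutation \<pi>" "permutation \<sigma>" "set \<pi> \<inter> set \<sigma> = {}" "\<tau> \<in> shuffles \<pi> \<sigma>"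
  shows "permutation \<tau>"
  using assms distinct_disjoint_shuffles[of \<pi> \<sigma> \<tau>] set_shuffles[of \<tau> \<pi> \<sigma>]
  by (auto simp: permutation_def)

lemma ex_disjoint_representative:
  assumes "permutation \<sigma>"
  shows "\<exists>\<sigma>'. permutation \<sigma>' \<and> pk_class \<sigma>' = pk_class \<sigma> \<and> set \<pi> \<inter> set \<sigma>' = {}"
proof (intro exI conjI)
  \<comment> \<open>Letters of \<sigma> are positive and no letter of \<pi> exceeds
    \<open>sum_list \<pi>\<close>, so the shifted letters are new; the common shift preserves the
    peaks.\<close>
  let ?\<sigma> = "map (\<lambda>x. x + sum_list \<pi>) \<sigma>"
  show perm: "permutation ?\<sigma>"
    using assms by (auto simp: permutation_def distinct_map inj_on_def)
  have "Pk ?\<sigma> = Pk \<sigma>" by (auto simp: Pk_def)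
  then show "pk_class ?\<sigma> = pk_class \<sigma>"
    using assms perm by (simp add: pk_class_eq_iff)
  show "set \<pi> \<inter> set ?\<sigma> = {}"
    using assms member_le_sum_list[of _ \<pi>] by (fastforce simp: permutation_def)
qed

text \<open>The product of classes is accessible only through disjoint representatives; since these
  always exist, they suffice to test bilinear identities.\<close>

lemma pk_bilinear_ext:
  assumes B: "rat_bilinear B" and C: "rat_bilinear C"
    and eq: "\<And>\<pi> \<sigma>. permutation \<pi> \<Longrightarrow> permutation \<sigma> \<Longrightarrow> set \<pi> \<inter> set \<sigma> = {}
      \<Longrightarrow> B (pk_basis \<pi>) (pk_basis \<sigma>) = C (pk_basis \<pi>) (pk_basis \<sigma>)"
  shows "B x y = C x y"
proof (rule pk_basis_ext[OF rat_bilinearD(2)[OF B] rat_bilinearD(2)[OF C]])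
  fix \<pi> assume \<pi>: "permutation \<pi>"
  show "B (pk_basis \<pi>) y = C (pk_basis \<pi>) y"
  proof (rule pk_basis_ext[OF rat_bilinearD(1)[OF B] rat_bilinearD(1)[OF C]])
    fix \<sigma> assume "permutation \<sigma>"
    then obtain \<sigma>' where "permutation \<sigma>'" "pk_class \<sigma>' = pk_class \<sigma>" "set \<pi> \<inter> set \<sigma>' = {}"
      using ex_disjoint_representative by blast
    then show "B (pk_basis \<pi>) (pk_basis \<sigma>) = C (pk_basis \<pi>) (pk_basis \<sigma>)"
      using eq[OF \<pi>, of \<sigma>'] by (simp add: pk_basis_def)
  qed
qed

lemma pk_to_qsym_sum_shuffles:
  assumes "permutation \<pi>" "permutation \<sigma>" "set \<pi> \<inter> set \<sigma> = {}"
  shows "pk_to_qsym (\<Sum>\<tau>\<in>shuffles \<pi> \<sigma>. pk_basis \<tau>) = qsym_times (K_perm \<pi>) (K_perm \<sigma>)"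
proof -
  have "pk_to_qsym (\<Sum>\<tau>\<in>shuffles \<pi> \<sigma>. pk_basis \<tau>) = (\<Sum>\<tau>\<in>shuffles \<pi> \<sigma>. K_perm \<tau>)"
    unfolding rat_linear_simps[OF rat_linear_pk_to_qsym]
    by (intro sum.cong refl pk_to_qsym_basis permutation_shuffles[OF assms])
  then show ?thesis using assms by (simp add: qsym_times_K permutation_def)
qed

text \<open>This is shuffle-compatibility: the shuffle sums of any two disjoint pairs of
  representatives go to the same product of peak functions, and \<open>pk_to_qsym\<close> is
  injective.\<close>

lemma pk_times_basis_shuffles:
  assumes "permutation \<pi>" "permutation \<sigma>" "set \<pi> \<inter> set \<sigma> = {}"
  shows "pk_times_basis (pk_class \<pi>) (pk_class \<sigma>) = (\<Sum>\<tau>\<in>shuffles \<pi> \<sigma>. pk_basis \<tau>)"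
  unfolding pk_times_basis_def
proof (rule the_equality, intro allI impI)
  fix \<pi>' \<sigma>' assume *: "permutation \<pi>' \<and> permutation \<sigma>' \<and> set \<pi>' \<inter> set \<sigma>' = {}
    \<and> pk_class \<pi>' = pk_class \<pi> \<and> pk_class \<sigma>' = pk_class \<sigma>"
  then have "K_perm \<pi>' = K_perm \<pi>" "K_perm \<sigma>' = K_perm \<sigma>"
    using assms by (auto simp: pk_class_eq_iff)
  then have "pk_to_qsym (\<Sum>\<tau>\<in>shuffles \<pi> \<sigma>. pk_basis \<tau>) = pk_to_qsym (\<Sum>\<tau>\<in>shuffles \<pi>' \<sigma>'. pk_basis \<tau>)"
    using * assms by (simp add: pk_to_qsym_sum_shuffles)
  then show "(\<Sum>\<tau>\<in>shuffles \<pi> \<sigma>. pk_basis \<tau>) = (\<Sum>\<tau>\<in>shuffles \<pi>' \<sigma>'. pk_basis \<tau>)"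
    by (rule injD[OF inj_pk_to_qsym])
qed (use assms in blast)

lemma rat_bilinear_pk_times: "rat_bilinear pk_times"
proof (rule rat_bilinearI)
  show "rat_linear (pk_times p)" for p
    by (rule rat_linearI)
      (simp_all add: pk_times_def rat_linear_simps[OF rat_linear_lin_ext] lin_ext_add_fun
        lin_ext_scale_fun)
  show "rat_linear (\<lambda>p. pk_times p q)" for q
    unfolding pk_times_def by (rule rat_linear_lin_ext)
qed

lemma pk_times_pk_basis:
  assumes "permutation \<pi>" "permutation \<sigma>" "set \<pi> \<inter> set \<sigma> = {}"
  shows "pk_times (pk_basis \<pi>) (pk_basis \<sigma>) = shuffle_sum pk_basis \<pi> \<sigma>"
proof -
  have "pk_times (pk_basis \<pi>) (pk_basis \<sigma>) = pk_times_basis (pk_class \<pi>) (pk_class \<sigma>)"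
    by (simp add: pk_times_def pk_basis_def lin_ext_single scaleQ_one)
  then show ?thesis
    using assms by (simp add: pk_times_basis_shuffles sum_shuffles permutation_def)
qed

lemma pk_to_qsym_times: "pk_to_qsym (pk_times x y) = qsym_times (pk_to_qsym x) (pk_to_qsym y)"
proof (rule pk_bilinear_ext[where B = "\<lambda>x y. pk_to_qsym (pk_times x y)"
      and C = "\<lambda>x y. qsym_times (pk_to_qsym x) (pk_to_qsym y)"])
  show "rat_bilinear (\<lambda>x y. pk_to_qsym (pk_times x y))"
    by (intro rat_bilinearI rat_linear_compose[OF _ rat_linear_pk_to_qsym]
        rat_bilinearD[OF rat_bilinear_pk_times])
  show "rat_bilinear (\<lambda>x y. qsym_times (pk_to_qsym x) (pk_to_qsym y))"
    by (rule rat_bilinear_compose[OF rat_bilinear_qsym_times rat_linear_pk_to_qsym rat_linear_pk_to_qsym])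
  fix \<pi> \<sigma> assume "permutation \<pi>" "permutation \<sigma>" "set \<pi> \<inter> set \<sigma> = {}"
  then show "pk_to_qsym (pk_times (pk_basis \<pi>) (pk_basis \<sigma>))
      = qsym_times (pk_to_qsym (pk_basis \<pi>)) (pk_to_qsym (pk_basis \<sigma>))"
    using pk_to_qsym_sum_shuffles[of \<pi> \<sigma>]
    by (simp add: pk_times_pk_basis pk_to_qsym_basis sum_shuffles permutation_def)
qed

lemma permutation_Nil: "permutation []"
  by (simp add: permutation_def)

lemma assoc_algebra_H_Pk: "assoc_algebra H_Pk"
proof -
  have "pk_times (pk_times x y) z = pk_times x (pk_times y z)" for x y z
    by (rule injD[OF inj_pk_to_qsym]) (simp add: pk_to_qsym_times qsym_times_assoc)
  moreover have "pk_times (pk_basis []) x = x" for x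
    by (rule pk_basis_ext[OF rat_bilinearD(1)[OF rat_bilinear_pk_times] rat_linear_id(2)])
      (simp add: pk_times_pk_basis permutation_Nil)
  moreover have "pk_times x (pk_basis []) = x" for x
    by (rule pk_basis_ext[OF rat_bilinearD(2)[OF rat_bilinear_pk_times] rat_linear_id(2)])
      (simp add: pk_times_pk_basis permutation_Nil)
  ultimately show ?thesis
    by (simp add: assoc_algebra_def H_Pk_def rat_bilinear_pk_times)
qed

section \<open>Coalgebra and bialgebra axioms for peak classes\<close>

definition pk_comult :: "(pk_class \<Rightarrow>\<^sub>0 rat) \<Rightarrow> (pk_class \<Rightarrow>\<^sub>0 rat, pk_class \<Rightarrow>\<^sub>0 rat) tensor" where
  "pk_comult = lin_ext pk_comult_basis"

definition pk_counit :: "(pk_class \<Rightarrow>\<^sub>0 rat) \<Rightarrow> rat" where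
  "pk_counit p = Poly_Mapping.lookup p (pk_class [])"

lemma H_Pk_sel:
  "mul H_Pk = pk_times" "unit H_Pk = pk_basis []" "comult H_Pk = pk_comult" "counit H_Pk = pk_counit"
  by (simp_all add: H_Pk_def pk_comult_def pk_counit_def fun_eq_iff)

lemma rat_linear_pk_comult: "rat_linear pk_comult"
  unfolding pk_comult_def by (rule rat_linear_lin_ext)

lemma rat_linear_pk_counit: "rat_linear pk_counit"
  unfolding pk_counit_def by (rule rat_linear_lookup)

lemma pk_comult_pk_basis:
  assumes "permutation \<pi>"
  shows "pk_comult (pk_basis \<pi>) = (\<Sum>i\<le>length \<pi>. pk_basis (take i \<pi>) \<otimes> pk_basis (drop i \<pi>))"
  using pk_comult_basis[OF assms]
  by (simp add: pk_comult_def pk_basis_def lin_ext_single scaleQ_one)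

lemma pk_counit_pk_basis:
  assumes "permutation \<pi>"
  shows "pk_counit (pk_basis \<pi>) = of_bool (\<pi> = [])"
  using assms pk_class_eq_iff[OF assms permutation_Nil]
  by (auto simp: pk_counit_def pk_basis_def lookup_single when_def)

lemma coassoc_pk_comult:
  "tensor_assoc (tensor_map pk_comult id (pk_comult x)) = tensor_map id pk_comult (pk_comult x)"
proof (rule pk_basis_ext)
  note lin = rat_linear_pk_comult rat_linear_id
  note left = rat_linear_compose[OF rat_linear_tensor_map[OF lin(1,2)] rat_linear_tensor_assoc]
  note right = rat_linear_tensor_map[OF lin(2,1)]
  show "rat_linear (\<lambda>x. tensor_assoc (tensor_map pk_comult id (pk_comult x)))"
    by (rule rat_linear_compose[OF lin(1) left])
  show "rat_linear (\<lambda>x. tensor_map id pk_comult (pk_comult x))"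
    by (rule rat_linear_compose[OF lin(1) right])
  fix \<pi> assume \<pi>: "permutation \<pi>"
  let ?n = "length \<pi>" and ?b = pk_basis
  note pure_sum = rat_linear_simps(5)[OF rat_bilinearD(1)[OF rat_bilinear_pure_tensor]]
    rat_linear_simps(5)[OF rat_bilinearD(2)[OF rat_bilinear_pure_tensor]]
  have "tensor_assoc (tensor_map pk_comult id (pk_comult (?b \<pi>)))
      = (\<Sum>i\<le>?n. \<Sum>j\<le>i. ?b (take j (take i \<pi>)) \<otimes> ?b (drop j (take i \<pi>)) \<otimes> ?b (drop i \<pi>))"
    unfolding pk_comult_pk_basis[OF \<pi>] rat_linear_simps(5)[OF left]
    by (intro sum.cong refl)
      (simp add: tensor_map_pure lin pk_comult_pk_basis permutation_take \<pi> pure_sum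
        rat_linear_simps(5)[OF rat_linear_tensor_assoc] tensor_assoc_pure min_def)
  also have "\<dots> = (\<Sum>(i, j)\<in>(SIGMA i:{..?n}. {..i}).
      ?b (take j \<pi>) \<otimes> ?b (take (i - j) (drop j \<pi>)) \<otimes> ?b (drop i \<pi>))"
    by (subst sum.Sigma[symmetric]) (auto intro!: sum.cong simp: drop_take min_def)
  \<comment> \<open>Both sides list the ways to cut \<pi> into three pieces. The two cut positions
    are replaced by the lengths of the first and second piece.\<close>
  also have "\<dots> = (\<Sum>(i, k)\<in>(SIGMA i:{..?n}. {..?n - i}).
      ?b (take i \<pi>) \<otimes> ?b (take k (drop i \<pi>)) \<otimes> ?b (drop k (drop i \<pi>)))"
    by (rule sum.reindex_bij_witness[where j = "\<lambda>(i, j). (j, i - j)" and i = "\<lambda>(i, k). (i + k, i)"])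
      auto
  also have "\<dots> = (\<Sum>i\<le>?n. \<Sum>k\<le>?n - i.
      ?b (take i \<pi>) \<otimes> ?b (take k (drop i \<pi>)) \<otimes> ?b (drop k (drop i \<pi>)))"
    by (subst sum.Sigma[symmetric]) auto
  also have "\<dots> = tensor_map id pk_comult (pk_comult (?b \<pi>))"
    unfolding pk_comult_pk_basis[OF \<pi>] rat_linear_simps(5)[OF right]
    by (intro sum.cong refl)
      (simp add: tensor_map_pure lin pk_comult_pk_basis permutation_drop \<pi> pure_sum)
  finally show "tensor_assoc (tensor_map pk_comult id (pk_comult (?b \<pi>)))
      = tensor_map id pk_comult (pk_comult (?b \<pi>))" .
qed

lemma coalgebra_H_Pk: "coalgebra H_Pk"
proof -
  have bil: "rat_bilinear (\<lambda>a b. pk_counit a *\<^sub>Q b)" "rat_bilinear (\<lambda>a b. pk_counit b *\<^sub>Q a)"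
    by (intro rat_bilinearI rat_linear_scale rat_linear_scale_left rat_linear_pk_counit rat_linear_id)+
  note lift = tensor_lift(1)[OF bil(1)] tensor_lift(1)[OF bil(2)]
  have "tensor_lift (\<lambda>a b. pk_counit a *\<^sub>Q b) (pk_comult x) = x" for x
  proof (rule pk_basis_ext[OF rat_linear_compose[OF rat_linear_pk_comult lift(1)] rat_linear_id(2)])
    fix \<pi> assume \<pi>: "permutation \<pi>"
    have "tensor_lift (\<lambda>a b. pk_counit a *\<^sub>Q b) (pk_comult (pk_basis \<pi>))
        = (\<Sum>i\<le>length \<pi>. if i = 0 then pk_basis (drop i \<pi>) else 0)"
      unfolding pk_comult_pk_basis[OF \<pi>] rat_linear_simps(5)[OF lift(1)]
      by (intro sum.cong refl)
        (auto simp: tensor_lift(2)[OF bil(1)] pk_counit_pk_basis permutation_take \<pi> scaleQ_one)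
    then show "tensor_lift (\<lambda>a b. pk_counit a *\<^sub>Q b) (pk_comult (pk_basis \<pi>)) = pk_basis \<pi>"
      by simp
  qed
  moreover have "tensor_lift (\<lambda>a b. pk_counit b *\<^sub>Q a) (pk_comult x) = x" for x
  proof (rule pk_basis_ext[OF rat_linear_compose[OF rat_linear_pk_comult lift(2)] rat_linear_id(2)])
    fix \<pi> assume \<pi>: "permutation \<pi>"
    have "tensor_lift (\<lambda>a b. pk_counit b *\<^sub>Q a) (pk_comult (pk_basis \<pi>))
        = (\<Sum>i\<le>length \<pi>. if i = length \<pi> then pk_basis (take i \<pi>) else 0)"
      unfolding pk_comult_pk_basis[OF \<pi>] rat_linear_simps(5)[OF lift(2)]
      by (intro sum.cong refl)
        (auto simp: tensor_lift(2)[OF bil(2)] pk_counit_pk_basis permutation_drop \<pi> scaleQ_one)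
    then show "tensor_lift (\<lambda>a b. pk_counit b *\<^sub>Q a) (pk_comult (pk_basis \<pi>)) = pk_basis \<pi>"
      by simp
  qed
  ultimately show ?thesis
    by (simp add: coalgebra_def H_Pk_sel rat_linear_pk_comult rat_linear_pk_counit coassoc_pk_comult)
qed

lemma pk_comult_times:
  "pk_comult (pk_times x y) = tensor_times pk_times (pk_comult x) (pk_comult y)"
proof (rule pk_bilinear_ext[where B = "\<lambda>x y. pk_comult (pk_times x y)"
      and C = "\<lambda>x y. tensor_times pk_times (pk_comult x) (pk_comult y)"])
  note tt = rat_bilinear_tensor_times[OF rat_bilinear_pk_times]
  show "rat_bilinear (\<lambda>x y. pk_comult (pk_times x y))"
    by (intro rat_bilinearI rat_linear_compose[OF _ rat_linear_pk_comult]
        rat_bilinearD[OF rat_bilinear_pk_times])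
  show "rat_bilinear (\<lambda>x y. tensor_times pk_times (pk_comult x) (pk_comult y))"
    by (rule rat_bilinear_compose[OF tt rat_linear_pk_comult rat_linear_pk_comult])
  fix \<pi> \<sigma> assume *: "permutation \<pi>" "permutation \<sigma>" "set \<pi> \<inter> set \<sigma> = {}"
  let ?b = pk_basis
  have pure: "shuffle_sum (\<lambda>s. shuffle_sum (\<lambda>t. ?b s \<otimes> ?b t) xs ys) us vs
      = shuffle_sum ?b us vs \<otimes> shuffle_sum ?b xs ys" for xs ys us vs
    by (simp only: additive_shuffle_sum[where h = "\<lambda>x. x \<otimes> y" for y, OF pure_tensor_add_left, symmetric]
        additive_shuffle_sum[where h = "\<lambda>x. y \<otimes> x" for y, OF pure_tensor_add_right, symmetric])
  have "pk_comult (pk_times (?b \<pi>) (?b \<sigma>)) = shuffle_sum (\<lambda>\<tau>. pk_comult (?b \<tau>)) \<pi> \<sigma>"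
    unfolding pk_times_pk_basis[OF *]
    by (rule additive_shuffle_sum) (rule rat_linear_simps(1)[OF rat_linear_pk_comult])
  also have "\<dots> = shuffle_sum (\<lambda>\<tau>. \<Sum>k\<le>length \<tau>. ?b (take k \<tau>) \<otimes> ?b (drop k \<tau>)) \<pi> \<sigma>"
    by (rule shuffle_sum_cong) (rule pk_comult_pk_basis[OF permutation_shuffles[OF *]])
  also have "\<dots> = (\<Sum>i\<le>length \<pi>. \<Sum>j\<le>length \<sigma>.
      shuffle_sum ?b (take i \<pi>) (take j \<sigma>) \<otimes> shuffle_sum ?b (drop i \<pi>) (drop j \<sigma>))"
    unfolding shuffle_sum_deconcat[of "\<lambda>s t. ?b s \<otimes> ?b t"] pure ..
  also have "\<dots> = (\<Sum>i\<le>length \<pi>. \<Sum>j\<le>length \<sigma>.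
      tensor_times pk_times (?b (take i \<pi>) \<otimes> ?b (drop i \<pi>)) (?b (take j \<sigma>) \<otimes> ?b (drop j \<sigma>)))"
    by (simp add: tensor_times_pure[OF rat_bilinear_pk_times] pk_times_pk_basis permutation_take
        permutation_drop * disjoint_take_drop)
  also have "\<dots> = tensor_times pk_times (pk_comult (?b \<pi>)) (pk_comult (?b \<sigma>))"
    unfolding pk_comult_pk_basis[OF *(1)] pk_comult_pk_basis[OF *(2)]
      rat_linear_simps(5)[OF rat_bilinearD(2)[OF tt]] rat_linear_simps(5)[OF rat_bilinearD(1)[OF tt]]
    by (rule sum.swap)
  finally show "pk_comult (pk_times (?b \<pi>) (?b \<sigma>))
      = tensor_times pk_times (pk_comult (?b \<pi>)) (pk_comult (?b \<sigma>))" .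
qed

lemma pk_counit_times: "pk_counit (pk_times x y) = pk_counit x * pk_counit y"
proof (rule pk_bilinear_ext[where B = "\<lambda>x y. pk_counit (pk_times x y)"
      and C = "\<lambda>x y. pk_counit x * pk_counit y"])
  show "rat_bilinear (\<lambda>x y. pk_counit (pk_times x y))"
    by (intro rat_bilinearI rat_linear_compose[OF _ rat_linear_pk_counit]
        rat_bilinearD[OF rat_bilinear_pk_times])
  show "rat_bilinear (\<lambda>x y. pk_counit x * pk_counit y)"
    by (intro rat_bilinearI rat_linearI)
      (simp_all add: rat_linear_simps[OF rat_linear_pk_counit] scaleQ_rat_def algebra_simps)
  fix \<pi> \<sigma> assume *: "permutation \<pi>" "permutation \<sigma>" "set \<pi> \<inter> set \<sigma> = {}"
  have "pk_counit (pk_times (pk_basis \<pi>) (pk_basis \<sigma>)) = shuffle_sum (\<lambda>\<tau>. pk_counit (pk_basis \<tau>)) \<pi> \<sigma>"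
    unfolding pk_times_pk_basis[OF *]
    by (rule additive_shuffle_sum) (rule rat_linear_simps(1)[OF rat_linear_pk_counit])
  \<comment> \<open>\<open>comp_coeff []\<close> stands in for the indicator of the empty
    word.\<close>
  also have "\<dots> = shuffle_sum (comp_coeff []) \<pi> \<sigma>"
    by (rule shuffle_sum_cong) (simp add: pk_counit_pk_basis[OF permutation_shuffles[OF *]])
  also have "\<dots> = of_bool (\<pi> = []) * of_bool (\<sigma> = [])"
    by (cases \<pi>; cases \<sigma>) (simp_all add: shuffle_sum_zero)
  finally show "pk_counit (pk_times (pk_basis \<pi>) (pk_basis \<sigma>))
      = pk_counit (pk_basis \<pi>) * pk_counit (pk_basis \<sigma>)"
    by (simp add: pk_counit_pk_basis *)
qed

lemma bialgebra_H_Pk: "bialgebra H_Pk"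
  unfolding bialgebra_def
  by (simp add: assoc_algebra_H_Pk coalgebra_H_Pk H_Pk_sel pk_comult_times pk_counit_times
      pk_comult_pk_basis pk_counit_pk_basis permutation_Nil)

section \<open>The antipode\<close>

lemma shuffle_sum_commute: "shuffle_sum f xs ys = shuffle_sum f ys xs"
  by (induction xs ys arbitrary: f rule: shuffles.induct) (simp_all add: add.commute)

text \<open>The mirror image of the defining recursion, splitting by the last letter; it is what
  relates shuffles to reversal.\<close>

lemma shuffle_sum_snoc:
  "shuffle_sum f (xs @ [x]) (ys @ [y])
    = shuffle_sum (\<lambda>t. f (t @ [x])) xs (ys @ [y]) + shuffle_sum (\<lambda>t. f (t @ [y])) (xs @ [x]) ys"
proof (induction xs ys arbitrary: f rule: shuffles.induct)
  case (1 ys)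
  show ?case by (induction ys arbitrary: f) (simp_all add: add_ac)
next
  case (2 xs)
  show ?case by (induction xs arbitrary: f) (simp_all add: add_ac)
next
  case (3 x' xs y' ys)
  then show ?case by (simp add: add_ac)
qed

lemma shuffle_sum_rev: "shuffle_sum f (rev xs) (rev ys) = shuffle_sum (\<lambda>t. f (rev t)) xs ys"
proof (induction xs ys arbitrary: f rule: shuffles.induct)
  case (3 x xs y ys)
  have "shuffle_sum f (rev (x # xs)) (rev (y # ys))
      = shuffle_sum (\<lambda>t. f (t @ [x])) (rev xs) (rev (y # ys))
        + shuffle_sum (\<lambda>t. f (t @ [y])) (rev (x # xs)) (rev ys)"
    by (simp add: shuffle_sum_snoc)
  then show ?case unfolding 3 by simp
qed simp_all

text \<open>A shuffle of \<open>x\<^sub>i \<dots> x\<^sub>1\<close> and \<open>x\<^sub>i\<^sub>+\<^sub>1 \<dots> x\<^sub>n\<close> starts with \<open>x\<^sub>i\<close> or with \<open>x\<^sub>i\<^sub>+\<^sub>1\<close>, so the alternating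
  sum telescopes.\<close>

lemma alternating_shuffle_sum:
  fixes f :: "'a list \<Rightarrow> 'b::rat_vector"
  shows "(\<Sum>i\<le>length xs. (- 1) ^ i *\<^sub>Q shuffle_sum f (rev (take i xs)) (drop i xs))
    = (if xs = [] then f [] else 0)"
proof (cases "length xs")
  case (Suc n)
  define A where "A i = shuffle_sum f (rev (take i xs)) (drop i xs)" for i
  \<comment> \<open>\<open>B i\<close> collects the shuffles in \<open>A i\<close> that start with
    \<open>xs ! i\<close>, the head of the suffix. The same words occur in \<open>A (Suc i)\<close>,
    where \<open>xs ! i\<close> heads the reversed prefix, so consecutive terms share a summand of
    opposite sign.\<close>
  define B where "B i = shuffle_sum (\<lambda>t. f (xs ! i # t)) (rev (take i xs)) (drop (Suc i) xs)" for i
  have rev_take: "rev (take (Suc i) xs) = xs ! i # rev (take i xs)" if "i < length xs" for i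
    using that by (simp add: take_Suc_conv_app_nth)
  have drop: "drop i xs = xs ! i # drop (Suc i) xs" if "i < length xs" for i
    using that by (simp add: Cons_nth_drop_Suc)
  have "(\<Sum>i\<le>m. (- 1) ^ i *\<^sub>Q A i) = (- 1) ^ m *\<^sub>Q B m" if "m \<le> n" for m
    using that
  proof (induction m)
    case 0
    have "A 0 = B 0" using drop[of 0] Suc by (simp add: A_def B_def)
    then show ?case by simp
  next
    case (Suc m)
    have m: "m < length xs" "Suc m < length xs" using Suc.prems \<open>length xs = Suc n\<close> by auto
    have "A (Suc m) = B m + B (Suc m)"
      unfolding A_def rev_take[OF m(1)] drop[OF m(2)] shuffle_sum.simps
      by (simp add: B_def drop[OF m(2)] rev_take[OF m(1)])
    then show ?case using Suc by (simp add: scaleQ_add_right ratv.scale_minus_left)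
  qed
  moreover have "A (Suc n) = B n"
    unfolding A_def B_def rev_take[of n, unfolded Suc, OF lessI] using Suc by simp
  ultimately have "(\<Sum>i\<le>Suc n. (- 1) ^ i *\<^sub>Q A i) = 0"
    by (simp add: ratv.scale_minus_left)
  then show ?thesis using Suc by (auto simp: A_def)
qed (simp add: scaleQ_one)

text \<open>Reversal exchanges prefixes and suffixes, so this is the left identity for
  \<open>rev xs\<close> and the functional composed with \<open>rev\<close>.\<close>

lemma alternating_shuffle_sum_right:
  fixes f :: "'a list \<Rightarrow> 'b::rat_vector"
  shows "(\<Sum>i\<le>length xs. (- 1) ^ (length xs - i) *\<^sub>Q shuffle_sum f (take i xs) (rev (drop i xs)))
    = (if xs = [] then f [] else 0)"
proof -
  have "(\<Sum>i\<le>length xs. (- 1) ^ (length xs - i) *\<^sub>Q shuffle_sum f (take i xs) (rev (drop i xs)))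
      = (\<Sum>j\<le>length (rev xs). (- 1) ^ j *\<^sub>Q
          shuffle_sum (\<lambda>t. f (rev t)) (rev (take j (rev xs))) (drop j (rev xs)))"
  proof (rule sum.reindex_bij_witness[where i = "\<lambda>j. length xs - j" and j = "\<lambda>i. length xs - i"])
    fix i assume i: "i \<in> {..length xs}"
    have "shuffle_sum f (take i xs) (rev (drop i xs))
        = shuffle_sum (\<lambda>t. f (rev t)) (drop i xs) (rev (take i xs))"
      using shuffle_sum_rev[of f "rev (take i xs)" "drop i xs"] by (simp add: shuffle_sum_commute)
    then show "(- 1) ^ (length xs - i) *\<^sub>Q
          shuffle_sum (\<lambda>t. f (rev t)) (rev (take (length xs - i) (rev xs))) (drop (length xs - i) (rev xs))
        = (- 1) ^ (length xs - i) *\<^sub>Q shuffle_sum f (take i xs) (rev (drop i xs))"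
      using i by (simp add: rev_drop rev_take)
  qed auto
  then show ?thesis using alternating_shuffle_sum[of "\<lambda>t. f (rev t)" "rev xs"] by simp
qed

lemma Pk_rev: "Pk (rev \<pi>) = {i. 2 \<le> i \<and> i \<le> length \<pi> - 1 \<and> Suc (length \<pi>) - i \<in> Pk \<pi>}"
proof (rule set_eqI)
  fix i
  show "i \<in> Pk (rev \<pi>) \<longleftrightarrow> i \<in> {i. 2 \<le> i \<and> i \<le> length \<pi> - 1 \<and> Suc (length \<pi>) - i \<in> Pk \<pi>}"
  proof (cases "2 \<le> i \<and> i \<le> length \<pi> - 1")
    case True
    then have "length \<pi> - Suc (i - 2) = Suc (length \<pi>) - i" "length \<pi> - Suc (i - 1) = Suc (length \<pi>) - i - 1"
      "length \<pi> - Suc i = Suc (length \<pi>) - i - 2" by auto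
    with True show ?thesis by (auto simp: Pk_def rev_nth)
  qed (auto simp: Pk_def)
qed

text \<open>The choice is harmless: by \<open>Pk_rev\<close> the class of the reversal depends only
  on the class of \<pi>.\<close>

definition pk_antipode_basis :: "pk_class \<Rightarrow> pk_class \<Rightarrow>\<^sub>0 rat" where
  "pk_antipode_basis c = (let \<pi> = SOME \<pi>. permutation \<pi> \<and> pk_class \<pi> = c
     in (- 1) ^ length \<pi> *\<^sub>Q pk_basis (rev \<pi>))"

definition pk_antipode :: "(pk_class \<Rightarrow>\<^sub>0 rat) \<Rightarrow> (pk_class \<Rightarrow>\<^sub>0 rat)" where
  "pk_antipode = lin_ext pk_antipode_basis"

lemma rat_linear_pk_antipode: "rat_linear pk_antipode"
  unfolding pk_antipode_def by (rule rat_linear_lin_ext)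

lemma pk_antipode_pk_basis:
  assumes "permutation \<pi>"
  shows "pk_antipode (pk_basis \<pi>) = (- 1) ^ length \<pi> *\<^sub>Q pk_basis (rev \<pi>)"
proof -
  define \<sigma> where "\<sigma> = (SOME \<sigma>. permutation \<sigma> \<and> pk_class \<sigma> = pk_class \<pi>)"
  have "permutation \<sigma> \<and> pk_class \<sigma> = pk_class \<pi>"
    unfolding \<sigma>_def by (rule someI[of _ \<pi>]) (simp add: assms)
  then have "length \<sigma> = length \<pi>" "pk_class (rev \<sigma>) = pk_class (rev \<pi>)"
    using assms by (auto simp: pk_class_eq_iff permutation_rev Pk_rev)
  then have "pk_antipode_basis (pk_class \<pi>) = (- 1) ^ length \<pi> *\<^sub>Q pk_basis (rev \<pi>)"
    unfolding pk_antipode_basis_def \<sigma>_def[symmetric] by (simp add: pk_basis_def)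
  then show ?thesis
    by (simp add: pk_antipode_def lin_ext_single scaleQ_one flip: pk_basis_def[of \<pi>])
      (simp add: pk_basis_def lin_ext_single scaleQ_one)
qed

lemma disjoint_take_drop_self:
  assumes "permutation \<pi>"
  shows "set (take i \<pi>) \<inter> set (drop i \<pi>) = {}"
  using assms by (auto simp: permutation_def dest: set_take_disj_set_drop_if_distinct[of _ i i])

lemma is_antipode_pk_antipode: "is_antipode H_Pk pk_antipode"
proof -
  note S = rat_linear_pk_antipode
  have bil: "rat_bilinear (\<lambda>a b. pk_times (pk_antipode a) b)" "rat_bilinear (\<lambda>a b. pk_times a (pk_antipode b))"
    by (rule rat_bilinear_compose[OF rat_bilinear_pk_times S rat_linear_id(2)]
        rat_bilinear_compose[OF rat_bilinear_pk_times rat_linear_id(2) S])+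
  note lin = rat_linear_simps(2)[OF rat_bilinearD(1)[OF rat_bilinear_pk_times]]
    rat_linear_simps(2)[OF rat_bilinearD(2)[OF rat_bilinear_pk_times]]
  note counit = rat_linear_scale_left[OF rat_linear_pk_counit]
  have "tensor_lift (\<lambda>a b. pk_times (pk_antipode a) b) (pk_comult x) = pk_counit x *\<^sub>Q pk_basis []" for x
  proof (rule pk_basis_ext[OF rat_linear_compose[OF rat_linear_pk_comult tensor_lift(1)[OF bil(1)]] counit])
    fix \<pi> assume \<pi>: "permutation \<pi>"
    have "tensor_lift (\<lambda>a b. pk_times (pk_antipode a) b) (pk_comult (pk_basis \<pi>))
        = (\<Sum>i\<le>length \<pi>. (- 1) ^ i *\<^sub>Q shuffle_sum pk_basis (rev (take i \<pi>)) (drop i \<pi>))"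
      unfolding pk_comult_pk_basis[OF \<pi>] rat_linear_simps(5)[OF tensor_lift(1)[OF bil(1)]]
      by (intro sum.cong refl)
        (simp add: tensor_lift(2)[OF bil(1)] pk_antipode_pk_basis permutation_take permutation_drop
          permutation_rev \<pi> lin pk_times_pk_basis disjoint_take_drop_self min_def)
    then show "tensor_lift (\<lambda>a b. pk_times (pk_antipode a) b) (pk_comult (pk_basis \<pi>))
        = pk_counit (pk_basis \<pi>) *\<^sub>Q pk_basis []"
      by (simp add: alternating_shuffle_sum pk_counit_pk_basis \<pi> scaleQ_one)
  qed
  moreover have "tensor_lift (\<lambda>a b. pk_times a (pk_antipode b)) (pk_comult x) = pk_counit x *\<^sub>Q pk_basis []" for x
  proof (rule pk_basis_ext[OF rat_linear_compose[OF rat_linear_pk_comult tensor_lift(1)[OF bil(2)]] counit])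
    fix \<pi> assume \<pi>: "permutation \<pi>"
    have "tensor_lift (\<lambda>a b. pk_times a (pk_antipode b)) (pk_comult (pk_basis \<pi>))
        = (\<Sum>i\<le>length \<pi>. (- 1) ^ (length \<pi> - i) *\<^sub>Q shuffle_sum pk_basis (take i \<pi>) (rev (drop i \<pi>)))"
      unfolding pk_comult_pk_basis[OF \<pi>] rat_linear_simps(5)[OF tensor_lift(1)[OF bil(2)]]
      by (intro sum.cong refl)
        (simp add: tensor_lift(2)[OF bil(2)] pk_antipode_pk_basis permutation_take permutation_drop
          permutation_rev \<pi> lin pk_times_pk_basis disjoint_take_drop_self)
    then show "tensor_lift (\<lambda>a b. pk_times a (pk_antipode b)) (pk_comult (pk_basis \<pi>))
        = pk_counit (pk_basis \<pi>) *\<^sub>Q pk_basis []"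
      by (simp add: alternating_shuffle_sum_right pk_counit_pk_basis \<pi> scaleQ_one)
  qed
  ultimately show ?thesis by (simp add: is_antipode_def H_Pk_sel S)
qed

text \<open>The argument for graded connected bialgebras: in the left antipode identity at \<pi> the
  last term is the value at \<pi> times the unit, and the others involve proper prefixes. So the
  values are forced by recursion on the length.\<close>

lemma is_antipode_H_Pk_unique:
  assumes "is_antipode H_Pk S" "is_antipode H_Pk T"
  shows "S = T"
proof
  have lin: "rat_linear S" "rat_linear T" using assms by (auto simp: is_antipode_def)
  have rec: "(\<Sum>i\<le>length \<pi>. pk_times (U (pk_basis (take i \<pi>))) (pk_basis (drop i \<pi>)))
      = pk_counit (pk_basis \<pi>) *\<^sub>Q pk_basis []"
    if U: "is_antipode H_Pk U" and \<pi>: "permutation \<pi>" for U \<pi>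
  proof -
    have "rat_linear U" using U by (simp add: is_antipode_def)
    then have bil: "rat_bilinear (\<lambda>a b. pk_times (U a) b)"
      by (rule rat_bilinear_compose[OF rat_bilinear_pk_times _ rat_linear_id(2)])
    have "tensor_lift (\<lambda>a b. pk_times (U a) b) (pk_comult (pk_basis \<pi>))
        = pk_counit (pk_basis \<pi>) *\<^sub>Q pk_basis []"
      using U by (simp add: is_antipode_def H_Pk_sel)
    then show ?thesis
      unfolding pk_comult_pk_basis[OF \<pi>] rat_linear_simps(5)[OF tensor_lift(1)[OF bil]]
      by (simp add: tensor_lift(2)[OF bil])
  qed
  have one: "pk_times x (pk_basis []) = x" for x
    using assoc_algebra_H_Pk by (simp add: assoc_algebra_def H_Pk_sel)
  have "S (pk_basis \<pi>) = T (pk_basis \<pi>)" if "permutation \<pi>" for \<pi>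
    using that
  proof (induction \<pi> rule: length_induct)
    case (1 \<pi>)
    have "S (pk_basis (take i \<pi>)) = T (pk_basis (take i \<pi>))" if "i < length \<pi>" for i
      using 1 that by (simp add: permutation_take)
    then have "(\<Sum>i<length \<pi>. pk_times (S (pk_basis (take i \<pi>))) (pk_basis (drop i \<pi>)))
        = (\<Sum>i<length \<pi>. pk_times (T (pk_basis (take i \<pi>))) (pk_basis (drop i \<pi>)))"
      by simp
    moreover have "(\<Sum>i\<le>length \<pi>. pk_times (S (pk_basis (take i \<pi>))) (pk_basis (drop i \<pi>)))
        = (\<Sum>i\<le>length \<pi>. pk_times (T (pk_basis (take i \<pi>))) (pk_basis (drop i \<pi>)))"
      using rec[OF assms(1)] rec[OF assms(2)] 1(2) by simp
    ultimately show ?case by (simp add: one flip: lessThan_Suc_atMost)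
  qed
  then show "S x = T x" for x by (rule pk_basis_ext[OF lin])
qed

section \<open>The isomorphism\<close>

lemma ex_permutation_with_peaks:
  assumes "\<Lambda> \<subseteq> {2..n - 1}" "\<forall>i\<in>\<Lambda>. Suc i \<notin> \<Lambda>"
  shows "\<exists>\<pi>. permutation \<pi> \<and> length \<pi> = n \<and> Pk \<pi> = \<Lambda>"
proof (intro exI conjI)
  \<comment> \<open>The increasing arrangement with \<open>n\<close> added at the positions in
    \<Lambda>. Raised entries exceed their neighbours, which are not raised; an entry that is not
    raised lies below its right neighbour and is no peak.\<close>
  define v where "v i = (if i \<in> \<Lambda> then n + i else i)" for i
  let ?\<pi> = "map (\<lambda>i. v (Suc i)) [0..<n]"
  show "permutation ?\<pi>"
    by (auto simp: permutation_def distinct_map inj_on_def v_def split: if_splits)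
  show "Pk ?\<pi> = \<Lambda>"
  proof (rule set_eqI)
    fix i
    show "i \<in> Pk ?\<pi> \<longleftrightarrow> i \<in> \<Lambda>"
    proof (cases "2 \<le> i \<and> i \<le> n - 1")
      case True
      then have "i \<in> Pk ?\<pi> \<longleftrightarrow> v (i - 1) < v i \<and> v (Suc i) < v i"
        by (auto simp: Pk_def Suc_diff_Suc numeral_2_eq_2 Suc_diff_le)
      also have "\<dots> \<longleftrightarrow> i \<in> \<Lambda>"
      proof (cases "i \<in> \<Lambda>")
        case in\<Lambda>: True
        have "i - 1 \<notin> \<Lambda>" using assms(2) in\<Lambda> True by (metis Suc_diff_1 zero_less_numeral order_less_le_trans)
        then show ?thesis using in\<Lambda> assms(2) True by (auto simp: v_def)
      qed (simp add: v_def)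
      finally show ?thesis .
    qed (use assms(1) in \<open>auto simp: Pk_def\<close>)
  qed
qed simp

lemma range_pk_to_qsym: "range pk_to_qsym = peak_space"
proof
  show "range pk_to_qsym \<subseteq> peak_space"
    using peak_incl by (auto simp: pk_to_qsym_def)
  note simps = rat_linear_simps[OF rat_linear_pk_to_qsym, symmetric]
  have "ratv.subspace (range pk_to_qsym)"
    unfolding ratv.subspace_def
  proof (intro conjI ballI allI)
    show "0 \<in> range pk_to_qsym" by (metis rangeI simps(3))
    show "x + y \<in> range pk_to_qsym" if "x \<in> range pk_to_qsym" "y \<in> range pk_to_qsym" for x y
      using that by (auto simp only: simps(1) image_iff)
    show "c *\<^sub>Q x \<in> range pk_to_qsym" if "x \<in> range pk_to_qsym" for c x
      using that by (auto simp only: simps(2) image_iff)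
  qed
  moreover have "qsym_K n \<Lambda> \<in> range pk_to_qsym"
    if \<Lambda>: "\<Lambda> \<subseteq> {2..n - 1}" "\<forall>i\<in>\<Lambda>. Suc i \<notin> \<Lambda>" for n \<Lambda>
  proof -
    obtain \<pi> where "permutation \<pi>" "length \<pi> = n" "Pk \<pi> = \<Lambda>"
      using ex_permutation_with_peaks[OF \<Lambda>] by blast
    then show ?thesis using pk_to_qsym_basis by (metis rangeI)
  qed
  ultimately show "peak_space \<subseteq> range pk_to_qsym"
    unfolding peak_space_def by (intro ratv.span_minimal) auto
qed

lemma bij_pk_to_peak: "bij pk_to_peak"
proof (rule bijI)
  show "inj pk_to_peak"
    using inj_pk_to_qsym by (auto simp: inj_def pk_to_qsym_def)
  have "\<exists>x. y = pk_to_peak x" for y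
  proof -
    have "peak_incl y \<in> range pk_to_qsym" using peak_incl[of y] range_pk_to_qsym by blast
    then show ?thesis by (auto simp: pk_to_qsym_def peak_incl_inject)
  qed
  then show "surj pk_to_peak" unfolding surj_def by blast
qed

text \<open>The index set of the coproduct varies with \<open>f\<close>; a common finite superset
  makes linearity a termwise computation.\<close>

lemma qsym_comult_superset:
  assumes "finite A" "{\<alpha>. 0 \<notin> set \<alpha> \<and> qsym_coeff f (packed \<alpha>) \<noteq> 0} \<subseteq> A" "\<forall>\<alpha>\<in>A. 0 \<notin> set \<alpha>"
  shows "qsym_comult f = (\<Sum>\<alpha>\<in>A.
     qsym_coeff f (packed \<alpha>) *\<^sub>Q (\<Sum>i\<le>length \<alpha>. qsym_M (take i \<alpha>) \<otimes> qsym_M (drop i \<alpha>)))"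
  unfolding qsym_comult_def by (rule sum.mono_neutral_left) (use assms in auto)

lemma rat_linear_qsym_comult: "rat_linear qsym_comult"
proof (rule rat_linearI)
  let ?S = "\<lambda>f. {\<alpha>. 0 \<notin> set \<alpha> \<and> qsym_coeff f (packed \<alpha>) \<noteq> 0}"
  note coeff = rat_linear_simps(1,2)[OF rat_linear_qsym_coeff]
  show "qsym_comult (f + g) = qsym_comult f + qsym_comult g" for f g
  proof -
    have fin: "finite (?S f \<union> ?S g)" by (intro finite_UnI finite_qsym_support)
    have "qsym_comult h = (\<Sum>\<alpha>\<in>?S f \<union> ?S g.
       qsym_coeff h (packed \<alpha>) *\<^sub>Q (\<Sum>i\<le>length \<alpha>. qsym_M (take i \<alpha>) \<otimes> qsym_M (drop i \<alpha>)))"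
      if "h \<in> {f, g, f + g}" for h
      by (rule qsym_comult_superset[OF fin]) (use that in \<open>auto simp: coeff\<close>)
    then show ?thesis
      by (simp add: coeff scaleQ_add_left sum.distrib)
  qed
  show "qsym_comult (c *\<^sub>Q f) = c *\<^sub>Q qsym_comult f" for c f
  proof -
    have "qsym_comult (c *\<^sub>Q f) = (\<Sum>\<alpha>\<in>?S f.
       qsym_coeff (c *\<^sub>Q f) (packed \<alpha>) *\<^sub>Q (\<Sum>i\<le>length \<alpha>. qsym_M (take i \<alpha>) \<otimes> qsym_M (drop i \<alpha>)))"
      by (rule qsym_comult_superset[OF finite_qsym_support]) (auto simp: coeff)
    then show ?thesis
      unfolding qsym_comult_def[of f]
      by (simp add: coeff ratv.scale_sum_right[of c] scaleQ_scaleQ scaleQ_rat_def)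
  qed
qed

lemma qsym_comult_pk_to_qsym:
  "qsym_comult (pk_to_qsym x) = tensor_map pk_to_qsym pk_to_qsym (pk_comult x)"
proof (rule pk_basis_ext)
  note map = rat_linear_tensor_map[OF rat_linear_pk_to_qsym rat_linear_pk_to_qsym]
  show "rat_linear (\<lambda>x. qsym_comult (pk_to_qsym x))"
    by (rule rat_linear_compose[OF rat_linear_pk_to_qsym rat_linear_qsym_comult])
  show "rat_linear (\<lambda>x. tensor_map pk_to_qsym pk_to_qsym (pk_comult x))"
    by (rule rat_linear_compose[OF rat_linear_pk_comult map])
  fix \<pi> assume \<pi>: "permutation \<pi>"
  show "qsym_comult (pk_to_qsym (pk_basis \<pi>)) = tensor_map pk_to_qsym pk_to_qsym (pk_comult (pk_basis \<pi>))"
    unfolding pk_comult_pk_basis[OF \<pi>] rat_linear_simps(5)[OF map] pk_to_qsym_basis[OF \<pi>] qsym_comult_K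
    by (intro sum.cong refl)
      (simp only: tensor_map_pure[OF rat_linear_pk_to_qsym rat_linear_pk_to_qsym]
        pk_to_qsym_basis[OF permutation_take[OF \<pi>]] pk_to_qsym_basis[OF permutation_drop[OF \<pi>]])
qed

lemma qsym_coeff_pk_to_qsym_0: "qsym_coeff (pk_to_qsym x) 0 = pk_counit x"
proof (rule pk_basis_ext[OF rat_linear_compose[OF rat_linear_pk_to_qsym rat_linear_qsym_coeff]
      rat_linear_pk_counit])
  fix \<pi> assume \<pi>: "permutation \<pi>"
  have "qsym_coeff (K_perm \<pi>) (packed []) = of_bool (\<pi> = [])" by (simp only: coeff_K_packed comp_coeff.simps)
  then show "qsym_coeff (pk_to_qsym (pk_basis \<pi>)) 0 = pk_counit (pk_basis \<pi>)"
    by (simp add: pk_to_qsym_basis pk_counit_pk_basis \<pi> packed_def)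
qed

text \<open>Each operation of \<open>Peak_Pi\<close> is evaluated at images of classes, where its
  value in \<open>QSym\<close> visibly lies in the range of the inclusion, so that
  \<open>inv\<close> cancels by injectivity.\<close>

lemma bialg_bijection_pk_to_peak: "bialg_bijection H_Pk Peak_Pi pk_to_peak"
proof (rule bialg_bijection.intro)
  note sel = Peak_Pi_def sub_bialg_def QSym_def H_Pk_sel
  note inv = inv_f_f[OF inj_peak_incl]
  show "rat_linear pk_to_peak" "bij pk_to_peak"
    by (rule rat_linear_pk_to_peak bij_pk_to_peak)+
  show "mul Peak_Pi (pk_to_peak x) (pk_to_peak y) = pk_to_peak (mul H_Pk x y)" for x y
    using pk_to_qsym_times[of x y, symmetric] by (simp add: sel pk_to_qsym_def inv)
  have "qsym_one = peak_incl (pk_to_peak (pk_basis []))"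
    using pk_to_qsym_basis[OF permutation_Nil] by (simp add: qsym_K_def pk_to_qsym_def)
  then have "inv peak_incl qsym_one = pk_to_peak (pk_basis [])"
    using inv[of "pk_to_peak (pk_basis [])"] by metis
  then show "unit Peak_Pi = pk_to_peak (unit H_Pk)" by (simp add: sel)
  have "qsym_comult (peak_incl (pk_to_peak x))
      = tensor_map peak_incl peak_incl (tensor_map pk_to_peak pk_to_peak (pk_comult x))" for x
    using qsym_comult_pk_to_qsym[of x]
    unfolding tensor_map_compose[OF rat_linear_peak_incl rat_linear_peak_incl
        rat_linear_pk_to_peak rat_linear_pk_to_peak] pk_to_qsym_def[abs_def] .
  then show "comult Peak_Pi (pk_to_peak x) = tensor_map pk_to_peak pk_to_peak (comult H_Pk x)" for x
    by (simp add: sel inv_f_f[OF inj_tensor_map[OF rat_linear_peak_incl inj_peak_incl]])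
  show "counit Peak_Pi (pk_to_peak x) = counit H_Pk x" for x
    using qsym_coeff_pk_to_qsym_0[of x] by (simp add: sel pk_to_qsym_def)
qed

theorem proposition3p19:
  shows "hopf_iso H_Pk Peak_Pi pk_to_peak"
proof (rule bialg_bijection.hopf_iso_transport[OF bialg_bijection_pk_to_peak])
  show "hopf_algebra H_Pk"
    using bialgebra_H_Pk is_antipode_pk_antipode by (auto simp: hopf_algebra_def)
qed (rule is_antipode_H_Pk_unique)

end
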